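(* Let $p$ be a prime and let $\mathbb{M}_{\mathbf{G}}$ be a monster model of $T_{\mathbf{G}}$. Suppose small sets $A,B,C_0,C_1,D\subseteq\mathbb{M}_{\mathbf{G}}$ satisfy $A\mathop{\smile\!\!\!\!\!\mid}^{*}_D C_0$, $B\mathop{\smile\!\!\!\!\!\mid}^{*}_D C_1$, $A\mathop{\smile\!\!\!\!\!\mid}^{*}_D B$, and $C_0\equiv_D C_1$. Then there is $C_*$ with $C_*\equiv_{AD}C_0$, $C_*\equiv_{BD}C_1$, and $C_*\mathop{\smile\!\!\!\!\!\mid}^{*}_D AB$.
   Context: Let $\mathcal{L}_P$ be the language of groups together with a unary predicate $P$. Let $\mathbb{K}^P$ be the class of finite $\mathcal{L}_P$-structures $G$ which are groups of exponent $p$ and nilpotency class at most $2$ in which $P(G)$ is a normal subgroup with $[G,G]\subseteq P(G)\subseteq Z(G)$. This is a Fraïssé class (Baudisch); $\mathbf{G}$ denotes its Fraïssé limit and $T_{\mathbf{G}}=\mathrm{Th}(\mathbf{G})$. Let $Z$ be the center of $\mathbb{M}_{\mathbf{G}}$ and $\langle X\rangle$ the subgroup generated by $X$. For small $A,B,C\subseteq\mathbb{M}_{\mathbf{G}}$, define $A\mathop{\smile\!\!\!\!\!\mid}^{*}_C B$ to hold iff (1) $\langle AC\rangle\cap\langle BC\rangle=\langle C\rangle$, and (2) $\langle A/Z\rangle\cap\langle B/Z\rangle=\langle C/Z\rangle$, where $\langle A/Z\rangle$ denotes the subgroup of $\mathbb{M}_{\mathbf{G}}/Z$ generated by the cosets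 of elements of $A$ (and similarly for $B$, $C$). $X\equiv_E Y$ means equality of types over $E$.
   Formalization: The prime p is assumed odd: for p = 2 the groups are abelian, Z is the whole monster, condition (2) is void, and the claim fails (D empty, A={a}, B={b}, C_0={a+z}, C_1={b+z'} with a, b, a-b outside P and z, z' nonzero in P). *)

theory Defs
  imports
    "HOL-Algebra.Generated_Groups"
    "HOL-Computational_Algebra.Primes"
    "HOL-Library.Countable_Set"
begin

unbundle cardinal_syntax

section \<open>Groups with a distinguished subset\<close>

text \<open>The symbol for the inverse is interpreted by the inverse of HOL-Algebra, which is determined
  by the multiplication; all structures considered are groups, so nothing else needs recording.\<close>

record 'a lp_struct = "'a monoid" +
  ppred :: "'a set"

definition lp_group :: "'a lp_struct \<Rightarrow> bool" where
  "lp_group G \<longleftrightarrow> group G \<and> ppred G \<subseteq> carrier G"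

definition lp_generated :: "'a lp_struct \<Rightarrow> 'a set \<Rightarrow> 'a lp_struct" where
  "lp_generated G X = G\<lparr>carrier := generate G X, ppred := generate G X \<inter> ppred G\<rparr>"

definition lp_iso :: "'a lp_struct \<Rightarrow> 'b lp_struct \<Rightarrow> ('a \<Rightarrow> 'b) set" where
  "lp_iso G H = {h \<in> iso G H. \<forall>x\<in>carrier G. x \<in> ppred G \<longleftrightarrow> h x \<in> ppred H}"


section \<open>First-order formulas in the language of groups with a unary predicate\<close>

datatype lp_term = Var nat | One | Mult lp_term lp_term | Inv lp_term

datatype lp_form =
    Eq lp_term lp_term | Pred lp_term | Neg lp_form | Conj lp_form lp_form | All nat lp_form

primrec term_vars :: "lp_term \<Rightarrow> nat set" where
  "term_vars (Var n) = {n}"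
| "term_vars One = {}"
| "term_vars (Mult s t) = term_vars s \<union> term_vars t"
| "term_vars (Inv t) = term_vars t"

primrec free_vars :: "lp_form \<Rightarrow> nat set" where
  "free_vars (Eq s t) = term_vars s \<union> term_vars t"
| "free_vars (Pred t) = term_vars t"
| "free_vars (Neg \<phi>) = free_vars \<phi>"
| "free_vars (Conj \<phi> \<psi>) = free_vars \<phi> \<union> free_vars \<psi>"
| "free_vars (All n \<phi>) = free_vars \<phi> - {n}"

primrec term_val :: "'a lp_struct \<Rightarrow> (nat \<Rightarrow> 'a) \<Rightarrow> lp_term \<Rightarrow> 'a" where
  "term_val M v (Var n) = v n"
| "term_val M v One = \<one>\<^bsub>M\<^esub>"
| "term_val M v (Mult s t) = term_val M v s \<otimes>\<^bsub>M\<^esub> term_val M v t"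
| "term_val M v (Inv t) = inv\<^bsub>M\<^esub> (term_val M v t)"

primrec sat :: "'a lp_struct \<Rightarrow> (nat \<Rightarrow> 'a) \<Rightarrow> lp_form \<Rightarrow> bool" where
  "sat M v (Eq s t) \<longleftrightarrow> term_val M v s = term_val M v t"
| "sat M v (Pred t) \<longleftrightarrow> term_val M v t \<in> ppred M"
| "sat M v (Neg \<phi>) \<longleftrightarrow> \<not> sat M v \<phi>"
| "sat M v (Conj \<phi> \<psi>) \<longleftrightarrow> sat M v \<phi> \<and> sat M v \<psi>"
| "sat M v (All n \<phi>) \<longleftrightarrow> (\<forall>a\<in>carrier M. sat M (v(n := a)) \<phi>)"

definition models :: "'a lp_struct \<Rightarrow> lp_form \<Rightarrow> bool" where
  "models M \<phi> \<longleftrightarrow> (\<forall>v. range v \<subseteq> carrier M \<longrightarrow> sat M v \<phi>)"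

definition Th :: "'a lp_struct \<Rightarrow> lp_form set" where
  "Th M = {\<phi>. free_vars \<phi> = {} \<and> models M \<phi>}"

definition model_of :: "'a lp_struct \<Rightarrow> lp_form set \<Rightarrow> bool" where
  "model_of M T \<longleftrightarrow> lp_group M \<and> (\<forall>\<phi>\<in>T. models M \<phi>)"


section \<open>Types and monster models\<close>

text \<open>Types are types of tuples \<open>c\<close> indexed by an arbitrary set \<open>I\<close>; the set enumerated by \<open>c\<close> is
  \<open>c ` I\<close>. A formula over \<open>E\<close> in the variables \<open>x\<^sub>i\<close> (\<open>i \<in> I\<close>) is a pair \<open>(\<phi>, \<sigma>)\<close>: a free variable
  \<open>n\<close> of \<open>\<phi>\<close> stands for \<open>x\<^sub>i\<close> if \<open>\<sigma> n = Inl i\<close>, and for the parameter \<open>e\<close> if \<open>\<sigma> n = Inr e\<close>.\<close>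

definition form_over :: "'i set \<Rightarrow> 'a set \<Rightarrow> (lp_form \<times> (nat \<Rightarrow> 'i + 'a)) set" where
  "form_over I E = {(\<phi>, \<sigma>). \<sigma> ` free_vars \<phi> \<subseteq> I <+> E}"

definition satisfies ::
    "'a lp_struct \<Rightarrow> ('i \<Rightarrow> 'a) \<Rightarrow> lp_form \<times> (nat \<Rightarrow> 'i + 'a) \<Rightarrow> bool" where
  "satisfies M c = (\<lambda>(\<phi>, \<sigma>). sat M (\<lambda>n. case_sum c id (\<sigma> n)) \<phi>)"

definition tp ::
    "'a lp_struct \<Rightarrow> 'i set \<Rightarrow> ('i \<Rightarrow> 'a) \<Rightarrow> 'a set \<Rightarrow> (lp_form \<times> (nat \<Rightarrow> 'i + 'a)) set" where
  "tp M I c E = {\<psi> \<in> form_over I E. satisfies M c \<psi>}"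

definition small :: "'k rel \<Rightarrow> 'a set \<Rightarrow> bool" where
  "small \<kappa> A \<longleftrightarrow> |A| <o \<kappa>"

definition saturated :: "'k rel \<Rightarrow> 'a lp_struct \<Rightarrow> bool" where
  "saturated \<kappa> M \<longleftrightarrow>
     (\<forall>E S. E \<subseteq> carrier M \<longrightarrow> small \<kappa> E \<longrightarrow> S \<subseteq> form_over {()} E \<longrightarrow>
        (\<forall>F\<subseteq>S. finite F \<longrightarrow> (\<exists>a\<in>carrier M. \<forall>\<psi>\<in>F. satisfies M (\<lambda>_. a) \<psi>)) \<longrightarrow>
        (\<exists>a\<in>carrier M. \<forall>\<psi>\<in>S. satisfies M (\<lambda>_. a) \<psi>))"

definition partial_elementary :: "'a lp_struct \<Rightarrow> 'a set \<Rightarrow> ('a \<Rightarrow> 'a) \<Rightarrow> bool" where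
  "partial_elementary M A f \<longleftrightarrow>
     A \<subseteq> carrier M \<and> f ` A \<subseteq> carrier M \<and> tp M A f {} = tp M A id {}"

definition strongly_homogeneous :: "'k rel \<Rightarrow> 'a lp_struct \<Rightarrow> bool" where
  "strongly_homogeneous \<kappa> M \<longleftrightarrow>
     (\<forall>A f. small \<kappa> A \<longrightarrow> partial_elementary M A f \<longrightarrow> (\<exists>h\<in>lp_iso M M. \<forall>a\<in>A. h a = f a))"

definition monster_model :: "'k rel \<Rightarrow> lp_form set \<Rightarrow> 'a lp_struct \<Rightarrow> bool" where
  "monster_model \<kappa> T M \<longleftrightarrow>
     Card_order \<kappa> \<and> natLeq <o \<kappa> \<and> model_of M T \<and> saturated \<kappa> M \<and> strongly_homogeneous \<kappa> M"


section \<open>Fraisse limits\<close>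

text \<open>Ages are sets of structures with universe in the natural numbers; this loses nothing, as every
  finitely generated structure is countable.\<close>

definition age :: "'a lp_struct \<Rightarrow> nat lp_struct set" where
  "age G = {H. lp_group H \<and>
     (\<exists>X. finite X \<and> X \<subseteq> carrier G \<and> lp_iso H (lp_generated G X) \<noteq> {})}"

definition ultrahomogeneous :: "'a lp_struct \<Rightarrow> bool" where
  "ultrahomogeneous G \<longleftrightarrow>
     (\<forall>X Y h. finite X \<longrightarrow> finite Y \<longrightarrow> X \<subseteq> carrier G \<longrightarrow> Y \<subseteq> carrier G \<longrightarrow>
        h \<in> lp_iso (lp_generated G X) (lp_generated G Y) \<longrightarrow>
        (\<exists>g\<in>lp_iso G G. \<forall>x\<in>generate G X. g x = h x))"

definition fraisse_limit :: "nat lp_struct set \<Rightarrow> 'a lp_struct \<Rightarrow> bool" where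
  "fraisse_limit K G \<longleftrightarrow>
     lp_group G \<and> countable (carrier G) \<and> ultrahomogeneous G \<and> age G = K"


section \<open>Nilpotent groups of class at most two and exponent \<open>p\<close>\<close>

definition center :: "('a, 'b) monoid_scheme \<Rightarrow> 'a set" where
  "center G = {z \<in> carrier G. \<forall>x\<in>carrier G. z \<otimes>\<^bsub>G\<^esub> x = x \<otimes>\<^bsub>G\<^esub> z}"

definition comm_subgroup :: "('a, 'b) monoid_scheme \<Rightarrow> 'a set \<Rightarrow> 'a set \<Rightarrow> 'a set" where
  "comm_subgroup G H K =
     generate G {h \<otimes>\<^bsub>G\<^esub> k \<otimes>\<^bsub>G\<^esub> inv\<^bsub>G\<^esub> h \<otimes>\<^bsub>G\<^esub> inv\<^bsub>G\<^esub> k | h k. h \<in> H \<and> k \<in> K}"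

primrec lower_central :: "('a, 'b) monoid_scheme \<Rightarrow> nat \<Rightarrow> 'a set" where
  "lower_central G 0 = carrier G"
| "lower_central G (Suc n) = comm_subgroup G (lower_central G n) (carrier G)"

definition nilpotent_class_le :: "('a, 'b) monoid_scheme \<Rightarrow> nat \<Rightarrow> bool" where
  "nilpotent_class_le G c \<longleftrightarrow> lower_central G c = {\<one>\<^bsub>G\<^esub>}"

text \<open>Exponent \<open>p\<close> means that the identity \<open>x\<^sup>p = 1\<close> holds; the trivial group has to be included for
  the class to be closed under substructures. The theorem is about odd \<open>p\<close>: a group of exponent
  two is abelian, so for \<open>p = 2\<close> the centre is the whole group rather than the distinguished
  subgroup, condition (2) of the independence relation is void, and the amalgamation fails.\<close>

definition KP :: "nat \<Rightarrow> nat lp_struct set" where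
  "KP p = {G. group G \<and> finite (carrier G) \<and>
     (\<forall>x\<in>carrier G. x [^]\<^bsub>G\<^esub> p = \<one>\<^bsub>G\<^esub>) \<and> nilpotent_class_le G 2 \<and>
     ppred G \<lhd> G \<and> comm_subgroup G (carrier G) (carrier G) \<subseteq> ppred G \<and> ppred G \<subseteq> center G}"


section \<open>The independence relation\<close>

definition coset_generate :: "'a lp_struct \<Rightarrow> 'a set \<Rightarrow> 'a set set" where
  "coset_generate M X = generate (M Mod center M) ((\<lambda>x. center M #>\<^bsub>M\<^esub> x) ` X)"

text \<open>\<open>star_indep M A C B\<close>: \<open>A\<close> is independent from \<open>B\<close> over \<open>C\<close>.\<close>

definition star_indep :: "'a lp_struct \<Rightarrow> 'a set \<Rightarrow> 'a set \<Rightarrow> 'a set \<Rightarrow> bool" where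
  "star_indep M A C B \<longleftrightarrow>
     generate M (A \<union> C) \<inter> generate M (B \<union> C) = generate M C \<and>
     coset_generate M A \<inter> coset_generate M B = coset_generate M C"

end

theory Submission
  imports
    Defs
    "HOL-Algebra.Elementary_Groups"
begin

text \<open>
  For odd \<open>p\<close>, Baer's formula \<open>x + y = x y [x, y]^(-1/2)\<close> turns a group of exponent \<open>p\<close> and class two into
  an elementary abelian group with an alternating form \<open>b(x, y) = [x, y]^(1/2)\<close>, from which the
  group is recovered by \<open>x y = x + y + b(x, y)\<close>. Subgroups of an elementary abelian group have complements
  that are compatible with \<open>P\<close>, so the independence hypotheses yield additive retractions of \<open>M\<close> onto
  \<open>A\<close>, \<open>B\<close> and \<open>C\<close> that restrict to one common retraction onto \<open>D\<close>. With their help, three copies of \<open>M\<close>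
  (for \<open>AB\<close>, \<open>AC\<^sub>0\<close> and \<open>BC\<^sub>1\<close>) embed into the additive group \<open>M\<^sup>3\<close>, and an inclusion-exclusion formula defines
  a form on \<open>M\<^sup>3\<close> that all three embeddings preserve.

  The extension property of the Fraisse limit is expressible by first-order sentences, so \<open>M\<close> has it too.
  It makes isomorphisms between substructures of \<open>M\<close> elementary, it shows that the centre is \<open>P\<close>, and
  with saturation it embeds the small part of \<open>M\<^sup>3\<close> generated by \<open>ABC\<close> into \<open>M\<close> over \<open>ABD\<close>. The image of \<open>C\<close>
  is \<open>C*\<close>.
\<close>

section \<open>The Baer correspondence\<close>

text \<open>The retractions are additive and respect \<open>P\<close>, but they do not respect the
  form. So the copies cannot just be projected onto each other: the form on the triple sum needs
  correction terms, and these cancel only because all retractions come from one and the same map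
  onto \<open>D\<close>. The two independence conditions enter at different places. Condition (1)
  makes a map prescribed on two of the subgroups well defined on their sum; condition (2) lets its
  extension to all of \<open>M\<close> respect \<open>P\<close>, without which the three embeddings
  could create new elements of the predicate. On the first-order side the obstacle is that the
  Fraisse class has only finite members, while the amalgam is infinite. Groups of exponent
  \<open>p\<close> and class two are locally finite, so finite parts of the amalgam can be handled
  by the class. Saturation then treats one new element over a small set of parameters at a
  time.\<close>

lemma (in group) inv_mult_cancel [simp]:
  assumes "x \<in> carrier G" "y \<in> carrier G"
  shows "inv x \<otimes> (x \<otimes> y) = y" "x \<otimes> (inv x \<otimes> y) = y"
  using assms by (simp_all add: m_assoc[symmetric])

lemma (in comm_group) inv_mult_cancel_comm [simp]:
  assumes "x \<in> carrier G" "y \<in> carrier G"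
  shows "x \<otimes> (y \<otimes> inv x) = y" "inv x \<otimes> (y \<otimes> x) = y"
  using assms by (simp_all add: m_comm[of y])

definition lp_embedding :: "'a lp_struct \<Rightarrow> 'b lp_struct \<Rightarrow> ('a \<Rightarrow> 'b) \<Rightarrow> bool" where
  "lp_embedding G H f \<longleftrightarrow> f \<in> hom G H \<and> inj_on f (carrier G) \<and>
     (\<forall>x\<in>carrier G. f x \<in> ppred H \<longleftrightarrow> x \<in> ppred G)"

lemma lp_iso_inv_into:
  assumes "group G" "\<sigma> \<in> lp_iso G H"
  shows "inv_into (carrier G) \<sigma> \<in> lp_iso H G"
proof -
  have \<sigma>: "\<sigma> \<in> iso G H" "bij_betw \<sigma> (carrier G) (carrier H)" using assms(2) by (auto simp: lp_iso_def iso_def)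
  show ?thesis
    using group.iso_set_sym[OF assms(1) \<sigma>(1)] bij_betw_inv_into_right[OF \<sigma>(2)] assms(2)
      bij_betwE[OF bij_betw_inv_into[OF \<sigma>(2)]]
    by (auto simp: lp_iso_def)
qed

text \<open>The axioms of \<open>KP p\<close> for odd \<open>p\<close>, without finiteness and over
  any type. They are universal and first-order, so they pass to substructures and to models of the
  theory. Class at most two follows because commutators lie in the central subgroup
  \<open>ppred G\<close>; see \<open>finite_nil2_group_in_KP\<close>.\<close>

locale nil2_group = group G for G :: "'a lp_struct" (structure) +
  fixes p :: nat
  assumes prime_p: "prime p" and p_neq_2: "p \<noteq> 2"
    and exponent: "x \<in> carrier G \<Longrightarrow> x [^] p = \<one>"
    and P_subgroup: "subgroup (ppred G) G"
    and commutator_in_P: "x \<in> carrier G \<Longrightarrow> y \<in> carrier G \<Longrightarrow> x \<otimes> y \<otimes> inv x \<otimes> inv y \<in> ppred G"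
    and P_central: "z \<in> ppred G \<Longrightarrow> x \<in> carrier G \<Longrightarrow> z \<otimes> x = x \<otimes> z"

text \<open>In effect a vector space over the field with \<open>p\<close> elements together with a
  subspace, written multiplicatively, so that scalars appear as powers.\<close>

locale elementary_abelian_pair = comm_group V for V (structure) +
  fixes p :: nat and P :: "'a set"
  assumes prime_p: "prime p"
    and exponent: "x \<in> carrier V \<Longrightarrow> x [^] p = \<one>"
    and P_subgroup: "subgroup P V"

lemma (in elementary_abelian_pair) P_closed: "x \<in> P \<Longrightarrow> x \<in> carrier V"
  using P_subgroup by (rule subgroup.mem_carrier)

text \<open>Values in \<open>P\<close> together with \<open>P\<close> in the radical make
  \<open>b\<close> vanish on its own values. This is the additive counterpart of nilpotency class
  two, and it makes the product of \<open>baer_group\<close> associative with central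
  commutators.\<close>

locale alternating_form = elementary_abelian_pair V p P for V (structure) and p and P +
  fixes b :: "'a \<Rightarrow> 'a \<Rightarrow> 'a"
  assumes p_neq_2: "p \<noteq> 2"
    and form_in_P: "x \<in> carrier V \<Longrightarrow> y \<in> carrier V \<Longrightarrow> b x y \<in> P"
    and form_mult_left: "\<lbrakk>x \<in> carrier V; y \<in> carrier V; z \<in> carrier V\<rbrakk> \<Longrightarrow> b (x \<otimes> y) z = b x z \<otimes> b y z"
    and form_mult_right: "\<lbrakk>x \<in> carrier V; y \<in> carrier V; z \<in> carrier V\<rbrakk> \<Longrightarrow> b x (y \<otimes> z) = b x y \<otimes> b x z"
    and form_self: "x \<in> carrier V \<Longrightarrow> b x x = \<one>"
    and form_P_left: "x \<in> P \<Longrightarrow> y \<in> carrier V \<Longrightarrow> b x y = \<one>"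
begin

definition baer_group :: "'a lp_struct" where
  "baer_group = \<lparr>carrier = carrier V, monoid.mult = (\<lambda>x y. x \<otimes> y \<otimes> b x y), one = \<one>, ppred = P\<rparr>"

lemma baer_group_simps [simp]:
  "carrier baer_group = carrier V" "x \<otimes>\<^bsub>baer_group\<^esub> y = x \<otimes> y \<otimes> b x y"
  "\<one>\<^bsub>baer_group\<^esub> = \<one>" "ppred baer_group = P"
  by (simp_all add: baer_group_def)

lemma form_closed [simp, intro]: "x \<in> carrier V \<Longrightarrow> y \<in> carrier V \<Longrightarrow> b x y \<in> carrier V"
  by (simp add: P_closed form_in_P)

lemma form_one_left [simp]: "y \<in> carrier V \<Longrightarrow> b \<one> y = \<one>"
  by (simp add: P_subgroup form_P_left subgroup.one_closed)

text \<open>Polarisation: \<open>b\<close> vanishes on \<open>x \<otimes> y\<close> paired with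
  itself, and only the two mixed terms survive.\<close>

lemma form_swap:
  assumes "x \<in> carrier V" "y \<in> carrier V"
  shows "b x y \<otimes> b y x = \<one>"
proof -
  have "b (x \<otimes> y) (x \<otimes> y) = (b x x \<otimes> b x y) \<otimes> (b y x \<otimes> b y y)"
    using assms by (simp add: form_mult_left form_mult_right m_ac)
  then show ?thesis using assms by (simp add: form_self)
qed

lemma form_P_right: "x \<in> carrier V \<Longrightarrow> y \<in> P \<Longrightarrow> b x y = \<one>"
  using form_swap[of x y] P_closed form_P_left by auto

lemma form_one_right [simp]: "y \<in> carrier V \<Longrightarrow> b y \<one> = \<one>"
  by (simp add: P_subgroup form_P_right subgroup.one_closed)

lemma form_form [simp]:
  assumes "x \<in> carrier V" "y \<in> carrier V" "z \<in> carrier V"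
  shows "b (b x y) z = \<one>" "b z (b x y) = \<one>"
  using assms by (simp_all add: form_P_left form_P_right form_in_P)

lemma form_inv:
  assumes "x \<in> carrier V" "y \<in> carrier V"
  shows "b (inv x) y = inv (b x y)" "b x (inv y) = inv (b x y)"
proof -
  have "b (inv x) y \<otimes> b x y = \<one>" "b x (inv y) \<otimes> b x y = \<one>"
    using assms form_mult_left[of "inv x" x y, symmetric] form_mult_right[of x "inv y" y, symmetric]
    by simp_all
  then show "b (inv x) y = inv (b x y)" "b x (inv y) = inv (b x y)"
    using assms by (auto intro: inv_equality[symmetric])
qed

text \<open>Since \<open>b\<close> vanishes as soon as one argument is a value of \<open>b\<close>,
  both bracketings reduce to the product of \<open>x\<close>, \<open>y\<close>, \<open>z\<close>,
  \<open>b x y\<close>, \<open>b x z\<close> and \<open>b y z\<close>.\<close>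

lemma group_baer_group: "group baer_group"
proof (rule groupI)
  fix x y z assume "x \<in> carrier baer_group" "y \<in> carrier baer_group" "z \<in> carrier baer_group"
  then show "x \<otimes>\<^bsub>baer_group\<^esub> y \<otimes>\<^bsub>baer_group\<^esub> z = x \<otimes>\<^bsub>baer_group\<^esub> (y \<otimes>\<^bsub>baer_group\<^esub> z)"
    by (simp add: form_mult_left form_mult_right m_ac)
next
  fix x assume x: "x \<in> carrier baer_group"
  show "\<exists>y\<in>carrier baer_group. y \<otimes>\<^bsub>baer_group\<^esub> x = \<one>\<^bsub>baer_group\<^esub>"
    using x by (intro bexI[of _ "inv x"]) (simp_all add: form_inv form_self)
qed (simp_all add: form_closed)

lemma inv_baer_group: "x \<in> carrier V \<Longrightarrow> inv\<^bsub>baer_group\<^esub> x = inv x"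
  by (rule group.inv_equality[OF group_baer_group]) (simp_all add: form_inv form_self)

text \<open>The form vanishes between powers of one element, so both structures have the same
  powers; this carries exponent \<open>p\<close> over.\<close>

lemma pow_baer_group:
  assumes x: "x \<in> carrier V"
  shows "x [^]\<^bsub>baer_group\<^esub> (n::nat) = x [^] n"
proof (induction n)
  case (Suc n)
  have "b (x [^] n) x = \<one>"
  proof (induction n)
    case (Suc n) then show ?case using x by (simp add: form_mult_left form_self)
  qed (use x in simp)
  with Suc x show ?case by simp
qed simp

lemma nil2_baer_group: "nil2_group baer_group p"
proof -
  interpret B: group baer_group by (rule group_baer_group)
  show ?thesis
  proof (intro nil2_group.intro nil2_group_axioms.intro group_baer_group prime_p p_neq_2)
    show "x [^]\<^bsub>baer_group\<^esub> p = \<one>\<^bsub>baer_group\<^esub>" if "x \<in> carrier baer_group" for x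
      using that by (simp add: pow_baer_group exponent)
    show "subgroup (ppred baer_group) baer_group"
    proof (rule B.subgroupI)
      show "ppred baer_group \<noteq> {}" using P_subgroup subgroup.one_closed by auto
      fix a assume a: "a \<in> ppred baer_group"
      then show "inv\<^bsub>baer_group\<^esub> a \<in> ppred baer_group"
        using P_subgroup P_closed by (simp add: inv_baer_group subgroup.m_inv_closed)
      fix c assume "c \<in> ppred baer_group"
      with a show "a \<otimes>\<^bsub>baer_group\<^esub> c \<in> ppred baer_group"
        using P_subgroup P_closed by (simp add: form_P_left subgroup.m_closed)
    qed (use P_closed in auto)
    show "z \<otimes>\<^bsub>baer_group\<^esub> x = x \<otimes>\<^bsub>baer_group\<^esub> z" if "z \<in> ppred baer_group" "x \<in> carrier baer_group" for z x
      using that P_closed by (simp add: form_P_left form_P_right m_comm)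
    show "x \<otimes>\<^bsub>baer_group\<^esub> y \<otimes>\<^bsub>baer_group\<^esub> inv\<^bsub>baer_group\<^esub> x \<otimes>\<^bsub>baer_group\<^esub> inv\<^bsub>baer_group\<^esub> y \<in> ppred baer_group"
      if xy: "x \<in> carrier baer_group" "y \<in> carrier baer_group" for x y
    proof -
      \<comment> \<open>By \<open>form_swap\<close> this is the square of \<open>b x y\<close>. It
        is the commutator in the new group, since interchanging the factors replaces
        \<open>b y x\<close> by \<open>b x y\<close>.\<close>
      let ?c = "b x y \<otimes> inv (b y x)"
      have c: "?c \<in> P" using xy P_subgroup by (simp add: form_in_P subgroup.m_closed subgroup.m_inv_closed)
      have "x \<otimes>\<^bsub>baer_group\<^esub> y = ?c \<otimes>\<^bsub>baer_group\<^esub> (y \<otimes>\<^bsub>baer_group\<^esub> x)"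
      proof -
        have "?c \<otimes>\<^bsub>baer_group\<^esub> (y \<otimes>\<^bsub>baer_group\<^esub> x) = b x y \<otimes> inv (b y x) \<otimes> (y \<otimes> x \<otimes> b y x)"
          using c xy by (simp add: form_P_left)
        also have "\<dots> = x \<otimes> y \<otimes> b x y \<otimes> (inv (b y x) \<otimes> b y x)"
          using xy by (simp only: baer_group_simps form_closed inv_closed m_closed m_ac)
        finally show ?thesis using xy by simp
      qed
      then have "x \<otimes>\<^bsub>baer_group\<^esub> y \<otimes>\<^bsub>baer_group\<^esub> inv\<^bsub>baer_group\<^esub> x \<otimes>\<^bsub>baer_group\<^esub> inv\<^bsub>baer_group\<^esub> y = ?c"
      proof -
        have cc: "?c \<in> carrier baer_group" using c P_closed by simp
        have "x \<otimes>\<^bsub>baer_group\<^esub> y \<otimes>\<^bsub>baer_group\<^esub> inv\<^bsub>baer_group\<^esub> x \<otimes>\<^bsub>baer_group\<^esub> inv\<^bsub>baer_group\<^esub> y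
           = (x \<otimes>\<^bsub>baer_group\<^esub> y) \<otimes>\<^bsub>baer_group\<^esub> inv\<^bsub>baer_group\<^esub> (y \<otimes>\<^bsub>baer_group\<^esub> x)"
          by (simp only: B.inv_mult_group[OF xy(2,1)] B.m_assoc B.inv_closed xy B.m_closed)
        then show ?thesis
          using \<open>x \<otimes>\<^bsub>baer_group\<^esub> y = _\<close> xy cc B.inv_solve_right by (metis B.m_closed)
      qed
      then show ?thesis using c by simp
    qed
  qed
qed

end

section \<open>The additive group and the form of a group of class two\<close>

context nil2_group
begin

definition cmt :: "'a \<Rightarrow> 'a \<Rightarrow> 'a" where
  "cmt x y = x \<otimes> y \<otimes> inv x \<otimes> inv y"

text \<open>For odd \<open>p\<close> the exponent \<open>Suc p div 2\<close> is (p + 1) / 2, the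
  inverse of 2 modulo \<open>p\<close>; the power is therefore the square root of the commutator
  inside \<open>P\<close>.\<close>

definition half_cmt :: "'a \<Rightarrow> 'a \<Rightarrow> 'a" where
  "half_cmt x y = cmt x y [^] (Suc p div 2)"

definition baer_sum :: "'a monoid" where
  "baer_sum = \<lparr>carrier = carrier G, monoid.mult = (\<lambda>x y. x \<otimes> y \<otimes> inv (half_cmt x y)), one = \<one>\<rparr>"

lemma baer_sum_simps [simp]:
  "carrier baer_sum = carrier G" "x \<otimes>\<^bsub>baer_sum\<^esub> y = x \<otimes> y \<otimes> inv (half_cmt x y)" "\<one>\<^bsub>baer_sum\<^esub> = \<one>"
  by (simp_all add: baer_sum_def)

lemma P_closed: "z \<in> ppred G \<Longrightarrow> z \<in> carrier G"
  using P_subgroup by (rule subgroup.mem_carrier)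

lemma P_normal: "ppred G \<lhd> G"
  unfolding normal_inv_iff
proof (intro conjI ballI P_subgroup)
  fix x h assume xh: "x \<in> carrier G" "h \<in> ppred G"
  then have "x \<otimes> h \<otimes> inv x = h"
    using P_central[OF xh(2,1), symmetric] P_closed by (simp add: m_assoc)
  then show "x \<otimes> h \<otimes> inv x \<in> ppred G" using xh by simp
qed

lemma cmt_in_P: "x \<in> carrier G \<Longrightarrow> y \<in> carrier G \<Longrightarrow> cmt x y \<in> ppred G"
  by (simp add: cmt_def commutator_in_P)

lemma cmt_closed [simp]: "x \<in> carrier G \<Longrightarrow> y \<in> carrier G \<Longrightarrow> cmt x y \<in> carrier G"
  by (simp add: cmt_def)

lemma cmt_swap: "x \<in> carrier G \<Longrightarrow> y \<in> carrier G \<Longrightarrow> cmt x y \<otimes> (y \<otimes> x) = x \<otimes> y"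
  by (simp add: cmt_def m_assoc inv_solve_left')

lemma cmt_eqI:
  assumes "x \<in> carrier G" "y \<in> carrier G" "c \<in> carrier G" "c \<otimes> (y \<otimes> x) = x \<otimes> y"
  shows "cmt x y = c"
  using assms cmt_swap[of x y] by (metis cmt_closed m_closed right_cancel)

lemma cmt_P: "z \<in> ppred G \<Longrightarrow> x \<in> carrier G \<Longrightarrow> cmt z x = \<one>"
  "z \<in> ppred G \<Longrightarrow> x \<in> carrier G \<Longrightarrow> cmt x z = \<one>"
  by (rule cmt_eqI; simp add: P_central P_closed)+

lemma cmt_inv:
  assumes "x \<in> carrier G" "y \<in> carrier G"
  shows "cmt y x = inv (cmt x y)"
proof (rule cmt_eqI)
  show "inv (cmt x y) \<otimes> (x \<otimes> y) = y \<otimes> x"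
    using assms cmt_swap[of x y] inv_solve_left[of "y \<otimes> x" "cmt x y" "x \<otimes> y"] by simp
qed (use assms in auto)

text \<open>Moving \<open>z\<close> to the left past \<open>y\<close> and then past \<open>x\<close>
  releases one commutator each time; these are central, so they collect in front.\<close>

lemma cmt_mult_left:
  assumes "x \<in> carrier G" "y \<in> carrier G" "z \<in> carrier G"
  shows "cmt (x \<otimes> y) z = cmt x z \<otimes> cmt y z"
proof (rule cmt_eqI)
  have "x \<otimes> y \<otimes> z = x \<otimes> (cmt y z \<otimes> (z \<otimes> y))" using assms by (simp add: cmt_swap m_assoc)
  also have "\<dots> = cmt y z \<otimes> (x \<otimes> (z \<otimes> y))"
    using assms P_central[OF cmt_in_P, of y z x] by (simp add: m_assoc[symmetric])
  also have "\<dots> = cmt y z \<otimes> (cmt x z \<otimes> (z \<otimes> x) \<otimes> y)" using assms by (simp add: cmt_swap m_assoc)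
  also have "\<dots> = cmt x z \<otimes> cmt y z \<otimes> (z \<otimes> (x \<otimes> y))" using assms
    P_central[OF cmt_in_P, of y z "cmt x z"] by (simp add: m_assoc[symmetric])
  finally show "cmt x z \<otimes> cmt y z \<otimes> (z \<otimes> (x \<otimes> y)) = x \<otimes> y \<otimes> z" by simp
qed (use assms in auto)

lemma P_pow: "z \<in> ppred G \<Longrightarrow> z [^] (n::nat) \<in> ppred G"
  using P_subgroup by (induction n) (auto intro: subgroup.one_closed subgroup.m_closed)

lemma half_cmt_in_P: "x \<in> carrier G \<Longrightarrow> y \<in> carrier G \<Longrightarrow> half_cmt x y \<in> ppred G"
  by (simp add: half_cmt_def P_pow cmt_in_P)

lemma half_cmt_closed [simp]: "x \<in> carrier G \<Longrightarrow> y \<in> carrier G \<Longrightarrow> half_cmt x y \<in> carrier G"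
  by (simp add: half_cmt_def)

lemma half_cmt_mult_left:
  assumes "x \<in> carrier G" "y \<in> carrier G" "z \<in> carrier G"
  shows "half_cmt (x \<otimes> y) z = half_cmt x z \<otimes> half_cmt y z"
  using assms pow_mult_distrib[OF P_central[OF cmt_in_P, of x z "cmt y z"]]
  unfolding half_cmt_def by (simp only: cmt_mult_left cmt_closed)

lemma half_cmt_inv:
  assumes "x \<in> carrier G" "y \<in> carrier G"
  shows "half_cmt y x = inv (half_cmt x y)"
  using assms by (simp add: half_cmt_def cmt_inv[of x y] nat_pow_inv)

lemma half_cmt_P: "z \<in> ppred G \<Longrightarrow> x \<in> carrier G \<Longrightarrow> half_cmt z x = \<one>"
  "z \<in> ppred G \<Longrightarrow> x \<in> carrier G \<Longrightarrow> half_cmt x z = \<one>"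
  by (simp_all add: half_cmt_def cmt_P)

lemma half_cmt_mult_right:
  assumes "x \<in> carrier G" "y \<in> carrier G" "z \<in> carrier G"
  shows "half_cmt z (x \<otimes> y) = half_cmt z x \<otimes> half_cmt z y"
proof -
  have "half_cmt z (x \<otimes> y) = inv (half_cmt x z \<otimes> half_cmt y z)"
    using assms half_cmt_inv[of "x \<otimes> y" z] by (simp add: half_cmt_mult_left)
  also have "\<dots> = half_cmt z y \<otimes> half_cmt z x"
    using assms half_cmt_inv[of x z] half_cmt_inv[of y z] by (simp add: inv_mult_group)
  finally show ?thesis using assms P_central[OF half_cmt_in_P, of z x "half_cmt z y"] by simp
qed

lemma odd_p: "odd p"
  using prime_p p_neq_2 prime_odd_nat prime_ge_2_nat by (metis order_le_imp_less_or_eq)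

lemma half_cmt_square:
  assumes "x \<in> carrier G" "y \<in> carrier G"
  shows "half_cmt x y \<otimes> half_cmt x y = cmt x y"
proof -
  have "Suc p div 2 + Suc p div 2 = Suc p" using odd_p by presburger
  then show ?thesis using assms exponent[of "cmt x y"] by (simp add: half_cmt_def nat_pow_mult)
qed

lemma inv_P: "z \<in> ppred G \<Longrightarrow> inv z \<in> ppred G"
  using P_subgroup by (rule subgroup.m_inv_closed)

text \<open>Bilinearity of \<open>half_cmt\<close> turns the corrections of either bracketing into
  the same three central factors. Commutativity holds because the correction is half of the
  commutator: \<open>x \<otimes> y\<close> and \<open>y \<otimes> x\<close> differ by its
  square.\<close>

lemma baer_sum_comm_group: "comm_group baer_sum"
proof (rule comm_groupI)
  fix x y z assume "x \<in> carrier baer_sum" "y \<in> carrier baer_sum" "z \<in> carrier baer_sum"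
  then have c: "x \<in> carrier G" "y \<in> carrier G" "z \<in> carrier G" by simp_all
  then have "x \<otimes>\<^bsub>baer_sum\<^esub> y \<otimes>\<^bsub>baer_sum\<^esub> z
     = x \<otimes> y \<otimes> inv (half_cmt x y) \<otimes> z \<otimes> inv (half_cmt x z \<otimes> half_cmt y z)"
    by (simp add: half_cmt_mult_left half_cmt_P inv_P half_cmt_in_P)
  also have "\<dots> = x \<otimes> (y \<otimes> z) \<otimes> (inv (half_cmt x y) \<otimes> inv (half_cmt x z) \<otimes> inv (half_cmt y z))"
  proof -
    note cen = P_central[OF inv_P[OF half_cmt_in_P]]
    have 1: "x \<otimes> y \<otimes> inv (half_cmt x y) \<otimes> z = x \<otimes> (y \<otimes> z) \<otimes> inv (half_cmt x y)"
      using c cen[of x y z] by (simp add: m_assoc)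
    have 2: "inv (half_cmt x z \<otimes> half_cmt y z) = inv (half_cmt x z) \<otimes> inv (half_cmt y z)"
      using c cen[of y z "inv (half_cmt x z)"] by (simp add: inv_mult_group)
    show ?thesis using c unfolding 1 2 by (simp add: m_assoc)
  qed
  also have "\<dots> = x \<otimes> (y \<otimes> z \<otimes> inv (half_cmt y z)) \<otimes> inv (half_cmt x y \<otimes> half_cmt x z)"
  proof -
    note cen = P_central[OF inv_P[OF half_cmt_in_P]]
    have 2: "inv (half_cmt x y \<otimes> half_cmt x z) = inv (half_cmt x y) \<otimes> inv (half_cmt x z)"
      using c cen[of x z "inv (half_cmt x y)"] by (simp add: inv_mult_group)
    show ?thesis using c cen[of y z "inv (half_cmt x y) \<otimes> inv (half_cmt x z)"] unfolding 2
      by (simp add: m_assoc)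
  qed
  also have "\<dots> = x \<otimes>\<^bsub>baer_sum\<^esub> (y \<otimes>\<^bsub>baer_sum\<^esub> z)"
    using c by (simp add: half_cmt_mult_right half_cmt_P inv_P half_cmt_in_P)
  finally show "x \<otimes>\<^bsub>baer_sum\<^esub> y \<otimes>\<^bsub>baer_sum\<^esub> z = x \<otimes>\<^bsub>baer_sum\<^esub> (y \<otimes>\<^bsub>baer_sum\<^esub> z)" .
next
  fix x y assume "x \<in> carrier baer_sum" "y \<in> carrier baer_sum"
  then have c: "x \<in> carrier G" "y \<in> carrier G" by simp_all
  have "x \<otimes> y = y \<otimes> x \<otimes> (half_cmt x y \<otimes> half_cmt x y)"
    using c cmt_swap[of x y] P_central[OF cmt_in_P, of x y "y \<otimes> x"] by (simp add: half_cmt_square)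
  then show "x \<otimes>\<^bsub>baer_sum\<^esub> y = y \<otimes>\<^bsub>baer_sum\<^esub> x"
    using c by (simp add: half_cmt_inv[of x y] m_assoc)
next
  fix x assume "x \<in> carrier baer_sum"
  then show "\<exists>y\<in>carrier baer_sum. y \<otimes>\<^bsub>baer_sum\<^esub> x = \<one>\<^bsub>baer_sum\<^esub>"
    by (intro bexI[of _ "inv x"]) (simp_all add: half_cmt_def cmt_def)
qed (simp_all add: half_cmt_P(1) subgroup.one_closed[OF P_subgroup])

lemma baer_sum_P: "x \<in> carrier G \<Longrightarrow> z \<in> ppred G \<Longrightarrow> x \<otimes>\<^bsub>baer_sum\<^esub> z = x \<otimes> z"
  by (simp add: half_cmt_P P_closed)

lemma inv_baer_sum: "x \<in> carrier G \<Longrightarrow> inv\<^bsub>baer_sum\<^esub> x = inv x"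
  by (rule group.inv_equality[OF comm_group.axioms(2)[OF baer_sum_comm_group]])
    (simp_all add: half_cmt_def cmt_def)

lemma half_cmt_in_subgroup:
  assumes S: "subgroup S G" and xy: "x \<in> S" "y \<in> S"
  shows "half_cmt x y \<in> S"
proof -
  interpret S: subgroup S G by fact
  have c: "cmt x y \<in> S" using xy by (simp add: cmt_def)
  have "cmt x y [^] (n::nat) \<in> S" for n by (induction n) (use c in auto)
  then show ?thesis by (simp add: half_cmt_def)
qed

lemma subgroup_baer_sum:
  assumes S: "subgroup S G"
  shows "subgroup S baer_sum"
proof -
  interpret S: subgroup S G by fact
  interpret V: comm_group baer_sum by (rule baer_sum_comm_group)
  show ?thesis
  proof (rule V.subgroupI)
    show "S \<noteq> {}" using S.one_closed by blast
  qed (use S.subset half_cmt_in_subgroup[OF S] in \<open>auto simp: inv_baer_sum\<close>)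
qed

lemma baer_sum_pow:
  assumes x: "x \<in> carrier G"
  shows "x [^]\<^bsub>baer_sum\<^esub> (n::nat) = x [^] n"
proof (induction n)
  case (Suc n)
  have "x [^] n \<otimes> x = x \<otimes> x [^] n" using x nat_pow_Suc2 by simp
  then have "cmt (x [^] n) x = \<one>" using x by (intro cmt_eqI) auto
  with Suc x show ?case by (simp add: half_cmt_def)
qed simp

lemma half_cmt_alternating: "alternating_form baer_sum p (ppred G) half_cmt"
proof -
  show ?thesis
  proof (intro alternating_form.intro alternating_form_axioms.intro elementary_abelian_pair.intro
      elementary_abelian_pair_axioms.intro baer_sum_comm_group prime_p p_neq_2)
    show "subgroup (ppred G) baer_sum" using P_subgroup by (rule subgroup_baer_sum)
    show "half_cmt x x = \<one>\<^bsub>baer_sum\<^esub>" if "x \<in> carrier baer_sum" for x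
      using that cmt_eqI[of x x \<one>] by (simp add: half_cmt_def)
    fix x y z assume "x \<in> carrier baer_sum" "y \<in> carrier baer_sum" "z \<in> carrier baer_sum"
    then have c: "x \<in> carrier G" "y \<in> carrier G" "z \<in> carrier G" by simp_all
    show "half_cmt (x \<otimes>\<^bsub>baer_sum\<^esub> y) z = half_cmt x z \<otimes>\<^bsub>baer_sum\<^esub> half_cmt y z"
      using c by (simp add: half_cmt_mult_left half_cmt_P inv_P half_cmt_in_P)
    show "half_cmt x (y \<otimes>\<^bsub>baer_sum\<^esub> z) = half_cmt x y \<otimes>\<^bsub>baer_sum\<^esub> half_cmt x z"
      using c by (simp add: half_cmt_mult_right half_cmt_P inv_P half_cmt_in_P)
  qed (auto simp: baer_sum_pow exponent half_cmt_in_P half_cmt_P)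
qed

sublocale V: alternating_form baer_sum p "ppred G" half_cmt
  by (rule half_cmt_alternating)

text \<open>The return trip of the correspondence: the product of \<open>G\<close> is that of
  \<open>V.baer_group\<close>, so an embedding of the latter is an embedding of
  \<open>G\<close>.\<close>

lemma mult_eq_baer_sum:
  assumes "x \<in> carrier G" "y \<in> carrier G"
  shows "x \<otimes> y = x \<otimes>\<^bsub>baer_sum\<^esub> y \<otimes>\<^bsub>baer_sum\<^esub> half_cmt x y"
  using assms by (subst baer_sum_P) (auto simp: half_cmt_in_P m_assoc)

text \<open>The product of \<open>G\<close> differs from the additive one by a value of the form, so
  an additive subgroup must absorb these values before it is a subgroup of \<open>G\<close>.\<close>

lemma subgroup_of_baer_sum_subgroup:
  assumes S: "subgroup S baer_sum" and half: "\<And>x y. x \<in> S \<Longrightarrow> y \<in> S \<Longrightarrow> half_cmt x y \<in> S"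
  shows "subgroup S G"
proof -
  interpret S: subgroup S baer_sum by fact
  have cl: "x \<in> carrier G" if "x \<in> S" for x using S.subset that by auto
  show ?thesis
  proof (rule subgroupI)
    show "inv x \<in> S" if "x \<in> S" for x using S.m_inv_closed[OF that] cl[OF that] inv_baer_sum by simp
    show "x \<otimes> y \<in> S" if "x \<in> S" "y \<in> S" for x y
      using that cl half S.m_closed mult_eq_baer_sum by presburger
  qed (use S.subset S.one_closed in auto)
qed

end

section \<open>Local finiteness\<close>

lemma (in comm_group) finite_generate_exponent:
  assumes "finite X" "X \<subseteq> carrier G" "0 < n" and exp: "\<And>x. x \<in> carrier G \<Longrightarrow> x [^] (n::nat) = \<one>"
  shows "finite (generate G X)"
  using assms(1,2)
proof (induction X)
  case empty then show ?case by (simp add: generate_empty)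
next
  case (insert x X)
  interpret H: subgroup "generate G X" G using insert by (intro generate_is_subgroup) auto
  \<comment> \<open>Adjoining \<open>x\<close> multiplies the size by at most \<open>n\<close>,
    because exponents of \<open>x\<close> matter only modulo \<open>n\<close>.\<close>
  define S where "S = (\<lambda>(h, k::nat). h \<otimes> x [^] k) ` (generate G X \<times> {..<n})"
  have x: "x \<in> carrier G" using insert by auto
  have pow_mod: "x [^] k = x [^] (k mod n)" for k :: nat
  proof -
    have "x [^] k = (x [^] n) [^] (k div n) \<otimes> x [^] (k mod n)"
      using x by (simp add: nat_pow_pow nat_pow_mult)
    then show ?thesis using x exp by simp
  qed
  have S_I: "h \<otimes> x [^] k \<in> S" if "h \<in> generate G X" for h and k :: nat
    using that pow_mod[of k] \<open>0 < n\<close> by (auto simp: S_def intro!: image_eqI[of _ _ "(h, k mod n)"])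
  have "subgroup S G"
  proof (rule subgroupI)
    show "S \<subseteq> carrier G" using x H.subset by (auto simp: S_def)
    show "S \<noteq> {}" using S_I H.one_closed by blast
    fix a assume "a \<in> S"
    then obtain h k where a: "a = h \<otimes> x [^] k" "h \<in> generate G X" "k < n" by (auto simp: S_def)
    have "inv (x [^] k) = x [^] (n - k)"
      using a x exp by (intro inv_equality) (auto simp: nat_pow_mult)
    then have "inv a = inv h \<otimes> x [^] (n - k)" using a x by (simp add: inv_mult)
    then show "inv a \<in> S" using S_I a by auto
    fix c assume "c \<in> S"
    then obtain h' and k' :: nat where c: "c = h' \<otimes> x [^] k'" "h' \<in> generate G X" by (auto simp: S_def)
    have "a \<otimes> c = (h \<otimes> h') \<otimes> x [^] (k + k')" using a c x by (simp add: nat_pow_mult[symmetric] m_ac)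
    then show "a \<otimes> c \<in> S" using S_I a c by auto
  qed
  moreover have "insert x X \<subseteq> S"
    using S_I[OF H.one_closed, of 1] S_I[of _ 0] x insert.prems generate.incl[of _ X G]
    by (auto simp: subset_iff)
  ultimately have "generate G (insert x X) \<subseteq> S" by (simp add: generate_subgroup_incl)
  moreover have "finite S" using insert by (simp add: S_def)
  ultimately show ?case by (rule finite_subset)
qed

text \<open>The additive span of \<open>X\<close> need not be closed under the form. Adding the
  values of the form on \<open>X\<close> is enough, because the form vanishes on its own values; the
  additive span of the enlarged set is finite and a subgroup of \<open>G\<close>.\<close>

lemma (in nil2_group) finite_generate:
  assumes "finite X" "X \<subseteq> carrier G"
  shows "finite (generate G X)"
proof -
  define Y where "Y = X \<union> (\<lambda>(x, y). half_cmt x y) ` (X \<times> X)"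
  define S where "S = generate baer_sum Y"
  have Y: "Y \<subseteq> carrier baer_sum" "finite Y" using assms by (auto simp: Y_def subset_iff)
  interpret S: subgroup S baer_sum unfolding S_def using Y by (intro V.generate_is_subgroup) auto
  have fin: "finite S" unfolding S_def
    using Y prime_gt_0_nat[OF prime_p] V.exponent by (intro V.finite_generate_exponent)
  have Scl: "x \<in> carrier G" if "x \<in> S" for x using S.subset that by auto
  have YY: "half_cmt x y \<in> S" if "x \<in> Y" "y \<in> Y" for x y
  proof (cases "x \<in> X \<and> y \<in> X")
    case True then show ?thesis by (auto simp: S_def Y_def intro: generate.incl)
  next
    case False
    then have "x \<in> ppred G \<or> y \<in> ppred G" using that assms
      by (auto simp: Y_def subset_iff half_cmt_in_P)
    then have "half_cmt x y = \<one>" using that Y half_cmt_P by auto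
    then show ?thesis using S.one_closed by simp
  qed
  \<comment> \<open>Bilinearity carries closure from the generators to the span, one argument at a
    time.\<close>
  have SY: "half_cmt x y \<in> S" if "x \<in> S" "y \<in> Y" for x y
  proof -
    have y: "y \<in> carrier baer_sum" using that Y by auto
    from that(1)[unfolded S_def] show ?thesis
    proof (induction rule: generate.induct)
      case (eng h1 h2)
      then have "h1 \<in> carrier baer_sum" "h2 \<in> carrier baer_sum"
        using V.generate_in_carrier Y by blast+
      with eng y show ?case by (simp only: V.form_mult_left S.m_closed)
    next
      case (inv h) then show ?case using y that(2) YY Y V.form_inv(1)[of h y] by (simp add: subset_iff)
    qed (use YY that y S.one_closed V.form_one_left in auto)
  qed
  have SS: "half_cmt x y \<in> S" if "x \<in> S" "y \<in> S" for x y
  proof -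
    have x: "x \<in> carrier baer_sum" using that Scl by auto
    from that(2)[unfolded S_def] show ?thesis
    proof (induction rule: generate.induct)
      case (eng h1 h2)
      then have "h1 \<in> carrier baer_sum" "h2 \<in> carrier baer_sum"
        using V.generate_in_carrier Y by blast+
      with eng x show ?case by (simp only: V.form_mult_right S.m_closed)
    next
      case (inv h) then show ?case using x that(1) SY Y V.form_inv(2)[of x h] by (simp add: subset_iff)
    qed (use SY that x S.one_closed V.form_one_right in auto)
  qed
  have "subgroup S G" by (rule subgroup_of_baer_sum_subgroup) (use SS S.subgroup_axioms in auto)
  moreover have "X \<subseteq> S" by (auto simp: S_def Y_def intro: generate.incl)
  ultimately show ?thesis using fin by (meson finite_subset generate_subgroup_incl)
qed

section \<open>Retractions preserving a subgroup\<close>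

text \<open>If \<open>p\<close> did not divide \<open>k\<close>, an inverse \<open>m\<close> of
  \<open>k\<close> modulo \<open>p\<close> would exhibit \<open>x\<close> as the \<open>m\<close>-th
  power of an element of \<open>T\<close>.\<close>

lemma (in group) pow_in_subgroup_prime_exponent:
  assumes "prime p" "x [^] p = \<one>" "x \<in> carrier G" "subgroup T G" "x [^] (k::nat) \<in> T" "x \<notin> T"
  shows "p dvd k"
proof (rule ccontr)
  assume "\<not> p dvd k"
  then obtain m y where m: "k * m = Suc (p * y)" using bezout_prime[OF \<open>prime p\<close>] by blast
  interpret T: subgroup T G by fact
  have "(x [^] k) [^] m = (x [^] p) [^] y \<otimes> x" using assms(3) by (simp add: nat_pow_pow m)
  then have "(x [^] k) [^] m = x" using assms by simp
  moreover have "(x [^] k) [^] m \<in> T" by (induction m) (use assms(5) in auto)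
  ultimately show False using assms by simp
qed

lemma set_multI: "h \<in> H \<Longrightarrow> k \<in> K \<Longrightarrow> h \<otimes>\<^bsub>G\<^esub> k \<in> H <#>\<^bsub>G\<^esub> K"
  by (auto simp: set_mult_def)

lemma (in comm_group) hom_on_set_mult:
  assumes S: "subgroup S G" and Q: "subgroup Q G"
    and g: "\<And>x y. x \<in> S \<Longrightarrow> y \<in> S \<Longrightarrow> g (x \<otimes> y) = g x \<otimes> g y" "\<And>x. x \<in> S \<Longrightarrow> g x \<in> carrier G"
    and h: "\<And>x y. x \<in> Q \<Longrightarrow> y \<in> Q \<Longrightarrow> h (x \<otimes> y) = h x \<otimes> h y" "\<And>x. x \<in> Q \<Longrightarrow> h x \<in> carrier G"
    and gh: "\<And>x. x \<in> S \<inter> Q \<Longrightarrow> g x = h x"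
  obtains f where "\<And>s q. s \<in> S \<Longrightarrow> q \<in> Q \<Longrightarrow> f (s \<otimes> q) = g s \<otimes> h q"
    and "f \<in> hom (G\<lparr>carrier := S <#> Q\<rparr>) G"
proof -
  interpret S: subgroup S G by fact
  interpret Q: subgroup Q G by fact
  define f where "f v = (SOME u. \<exists>s\<in>S. \<exists>q\<in>Q. v = s \<otimes> q \<and> u = g s \<otimes> h q)" for v
  have f: "f (s \<otimes> q) = g s \<otimes> h q" if sq: "s \<in> S" "q \<in> Q" for s q
  proof -
    have "\<exists>u. \<exists>s'\<in>S. \<exists>q'\<in>Q. s \<otimes> q = s' \<otimes> q' \<and> u = g s' \<otimes> h q'" using sq by blast
    from someI_ex[OF this, folded f_def]
    obtain s' q' where sq': "s' \<in> S" "q' \<in> Q" "s \<otimes> q = s' \<otimes> q'" "f (s \<otimes> q) = g s' \<otimes> h q'" by blast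
    \<comment> \<open>Two decompositions of one element differ by \<open>d\<close>, which lies in
      both \<open>S\<close> and \<open>Q\<close>. There \<open>g\<close> and \<open>h\<close> agree,
      so the value does not depend on the choice.\<close>
    define d where "d = inv s' \<otimes> s"
    have dq: "d \<otimes> q = q'" using sq sq'(1,2) by (simp add: d_def m_assoc sq'(3))
    have d: "d \<in> S" using sq sq' by (simp add: d_def)
    have "d = q' \<otimes> inv q" using inv_solve_right[of d q' q] dq d sq sq' by simp
    then have "d \<in> Q" using sq sq' by simp
    have "s = s' \<otimes> d" using sq sq' by (simp add: d_def)
    note d = d \<open>d \<in> Q\<close> this dq[symmetric]
    then have "g s \<otimes> h q = g s' \<otimes> h q'"
      using sq sq' g h gh[of d] by (simp add: m_assoc)
    then show ?thesis using sq' by simp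
  qed
  moreover have "f \<in> hom (G\<lparr>carrier := S <#> Q\<rparr>) G"
  proof (rule homI)
    fix x assume "x \<in> carrier (G\<lparr>carrier := S <#> Q\<rparr>)"
    then show "f x \<in> carrier G" using f g h by (auto simp: set_mult_def)
    fix y assume "y \<in> carrier (G\<lparr>carrier := S <#> Q\<rparr>)"
    with \<open>x \<in> _\<close> obtain s q s' q' where *: "s \<in> S" "q \<in> Q" "x = s \<otimes> q" "s' \<in> S" "q' \<in> Q" "y = s' \<otimes> q'"
      by (auto simp: set_mult_def)
    then have "x \<otimes> y = (s \<otimes> s') \<otimes> (q \<otimes> q')" by (simp add: m_ac)
    then have "f (x \<otimes> y) = g (s \<otimes> s') \<otimes> h (q \<otimes> q')" using * f by simp
    also have "\<dots> = f x \<otimes> f y" unfolding *(3,6) f[OF *(1,2)] f[OF *(4,5)]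
      using *(1,2,4,5) by (simp add: g h m_ac)
    finally show "f (x \<otimes>\<^bsub>G\<lparr>carrier := S <#> Q\<rparr>\<^esub> y) = f x \<otimes>\<^bsub>G\<^esub> f y" by simp
  qed
  ultimately show ?thesis using that by blast
qed

lemma (in group) subgroup_Union_chain:
  assumes "\<C> \<noteq> {}" "subset.chain {H. subgroup H G} \<C>"
  shows "subgroup (\<Union>\<C>) G"
proof (rule subgroupI)
  have sub: "subgroup H G" if "H \<in> \<C>" for H using assms that by (auto simp: subset.chain_def)
  show "\<Union>\<C> \<subseteq> carrier G" by (auto dest: subgroup.mem_carrier[OF sub])
  obtain H where "H \<in> \<C>" using assms(1) by auto
  then show "\<Union>\<C> \<noteq> {}" using subgroup.one_closed[OF sub] by auto
  show "inv a \<in> \<Union>\<C>" if "a \<in> \<Union>\<C>" for a using that by (auto intro: subgroup.m_inv_closed[OF sub])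
  fix a b assume "a \<in> \<Union>\<C>" "b \<in> \<Union>\<C>"
  then obtain H K where HK: "a \<in> H" "H \<in> \<C>" "b \<in> K" "K \<in> \<C>" by blast
  then have "H \<subseteq> K \<or> K \<subseteq> H" using assms(2) by (auto simp: subset_chain_def)
  then obtain L where "L \<in> \<C>" "a \<in> L" "b \<in> L" using HK by blast
  then show "a \<otimes> b \<in> \<Union>\<C>" using subgroup.m_closed[OF sub] by auto
qed

context elementary_abelian_pair
begin

lemma subgroup_adjoin:
  assumes Q: "subgroup Q V" and x: "x \<in> carrier V"
  shows "subgroup {q \<otimes> x [^] k | q (k::nat). q \<in> Q} V"
proof (rule subgroupI)
  interpret Q: subgroup Q V by fact
  show "{q \<otimes> x [^] k | q (k::nat). q \<in> Q} \<subseteq> carrier V" using x by auto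
  show "{q \<otimes> x [^] k | q (k::nat). q \<in> Q} \<noteq> {}" using Q.one_closed by blast
  fix a assume "a \<in> {q \<otimes> x [^] k | q (k::nat). q \<in> Q}"
  then obtain q k where a: "a = q \<otimes> x [^] (k::nat)" "q \<in> Q" by blast
  \<comment> \<open>Only natural exponents occur in the set, so the inverse of a power of
    \<open>x\<close> has to be found among such powers; exponent \<open>p\<close> provides
    it.\<close>
  have "x [^] (k * (p - 1)) \<otimes> x [^] k = \<one>"
  proof -
    have "k * (p - 1) + k = p * k" using prime_gt_0_nat[OF prime_p] by (cases p) auto
    then have "x [^] (k * (p - 1)) \<otimes> x [^] k = (x [^] p) [^] k"
      using x by (simp only: nat_pow_mult nat_pow_pow)
    then show ?thesis using x exponent by simp
  qed
  then have "inv (x [^] k) = x [^] (k * (p - 1))" using x by (intro inv_equality) auto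
  then have "inv a = inv q \<otimes> x [^] (k * (p - 1))" using a x by (simp add: inv_mult)
  then show "inv a \<in> {q \<otimes> x [^] k | q (k::nat). q \<in> Q}" using a by blast
  fix b assume "b \<in> {q \<otimes> x [^] k | q (k::nat). q \<in> Q}"
  then obtain r l where b: "b = r \<otimes> x [^] (l::nat)" "r \<in> Q" by blast
  have "a \<otimes> b = (q \<otimes> r) \<otimes> x [^] (k + l)" using a b x by (simp add: nat_pow_mult[symmetric] m_ac)
  then show "a \<otimes> b \<in> {q \<otimes> x [^] k | q (k::nat). q \<in> Q}" using a b by blast
qed

text \<open>A maximal candidate \<open>Q\<close> must satisfy \<open>S <#> Q = carrier V\<close>: otherwise adjoin an element outside
  \<open>S <#> Q\<close>, taken from \<open>P\<close> if possible, so that no new relation modulo \<open>P\<close> arises.\<close>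

lemma complement_exists:
  assumes S: "subgroup S V"
  obtains Q where "subgroup Q V" "S \<inter> Q = {\<one>}" "S <#> Q = carrier V"
    "\<And>s q. s \<in> S \<Longrightarrow> q \<in> Q \<Longrightarrow> s \<otimes> q \<in> P \<Longrightarrow> s \<in> P"
proof -
  interpret S: subgroup S V by fact
  interpret P: subgroup P V by (rule P_subgroup)
  \<comment> \<open>The last condition makes the projection onto \<open>S\<close> along
    \<open>Q\<close> map \<open>P\<close> into itself.\<close>
  define \<A> where "\<A> = {Q. subgroup Q V \<and> S \<inter> Q \<subseteq> {\<one>} \<and> (\<forall>s\<in>S. \<forall>q\<in>Q. s \<otimes> q \<in> P \<longrightarrow> s \<in> P)}"
  have "{\<one>} \<in> \<A>" by (auto simp: \<A>_def triv_subgroup)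
  moreover have "\<Union>\<C> \<in> \<A>" if "\<C> \<noteq> {}" "subset.chain \<A> \<C>" for \<C>
  proof -
    have "subset.chain {H. subgroup H V} \<C>" using that(2) by (auto simp: subset_chain_def \<A>_def)
    moreover have "\<C> \<subseteq> \<A>" using that(2) by (auto simp: subset_chain_def)
    ultimately show ?thesis using subgroup_Union_chain[of \<C>] that(1) by (auto simp: \<A>_def)
  qed
  ultimately obtain Q where QA: "Q \<in> \<A>" and max: "\<And>X. X \<in> \<A> \<Longrightarrow> Q \<subseteq> X \<Longrightarrow> X = Q"
    using subset_Zorn_nonempty[of \<A>] by blast
  have Q: "subgroup Q V" and SQ: "S \<inter> Q \<subseteq> {\<one>}"
    and SQP: "\<And>s q. s \<in> S \<Longrightarrow> q \<in> Q \<Longrightarrow> s \<otimes> q \<in> P \<Longrightarrow> s \<in> P"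
    using QA by (auto simp: \<A>_def)
  interpret Q: subgroup Q V by (rule Q)
  have T: "subgroup (S <#> Q) V" using S Q by (rule mult_subgroups)
  interpret T: subgroup "S <#> Q" V by (rule T)
  have "carrier V \<subseteq> S <#> Q"
  proof (rule ccontr)
    assume *: "\<not> carrier V \<subseteq> S <#> Q"
    obtain x where x: "x \<in> carrier V" "x \<notin> S <#> Q" "x \<in> P \<or> P \<subseteq> S <#> Q"
    proof (cases "P \<subseteq> S <#> Q")
      case True then show ?thesis using * that by blast
    next
      case False then show ?thesis using P_closed that by blast
    qed
    have x_pow: "x [^] k = \<one>" if "x [^] k \<in> S <#> Q" for k :: nat
    proof -
      have "p dvd k" using pow_in_subgroup_prime_exponent[OF prime_p exponent[OF x(1)] x(1) T that x(2)] .
      then show ?thesis using x exponent by (auto simp: nat_pow_pow[symmetric])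
    qed
    define Q' where "Q' = {q \<otimes> x [^] k | q (k::nat). q \<in> Q}"
    have mem: "q \<otimes> x [^] k \<in> Q'" if "q \<in> Q" for q and k :: nat using that by (auto simp: Q'_def)
    have "Q' \<in> \<A>" unfolding \<A>_def
    proof (intro CollectI conjI ballI impI)
      show "subgroup Q' V" unfolding Q'_def using Q x(1) by (rule subgroup_adjoin)
      show "S \<inter> Q' \<subseteq> {\<one>}"
      proof
        fix s assume "s \<in> S \<inter> Q'"
        then obtain q k where s: "s \<in> S" "s = q \<otimes> x [^] (k::nat)" "q \<in> Q" by (auto simp: Q'_def)
        then have "x [^] k = s \<otimes> inv q" using x by (simp add: m_assoc)
        moreover have "s \<otimes> inv q \<in> S <#> Q" using s by (intro set_multI) auto
        ultimately have "x [^] k \<in> S <#> Q" by (simp only:)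
        then have "s = q" using s x_pow by simp
        then show "s \<in> {\<one>}" using s SQ by auto
      qed
      fix s q' assume s: "s \<in> S" and q': "q' \<in> Q'" and sq: "s \<otimes> q' \<in> P"
      obtain q k where q: "q' = q \<otimes> x [^] (k::nat)" "q \<in> Q" using q' by (auto simp: Q'_def)
      have xk: "x [^] k = inv (s \<otimes> q) \<otimes> (s \<otimes> q')" using s q x by (simp add: inv_mult m_ac)
      \<comment> \<open>If \<open>x\<close> is in \<open>P\<close>, so is its power, and it can be
        divided off. Otherwise the choice of \<open>x\<close> puts \<open>P\<close> inside
        \<open>S <#> Q\<close>; then the power lies there too and is trivial by
        \<open>x_pow\<close>.\<close>
      have "s \<otimes> q \<in> P"
      proof (cases "x \<in> P")
        case True
        then have "x [^] k \<in> P" by (induction k) auto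
        then have "(s \<otimes> q') \<otimes> inv (x [^] k) \<in> P" using sq by auto
        then show ?thesis using q s x by (simp add: m_assoc)
      next
        case False
        then have "s \<otimes> q' \<in> S <#> Q" using x sq by auto
        moreover have "s \<otimes> q \<in> S <#> Q" using s q by (intro set_multI)
        ultimately have "x [^] k \<in> S <#> Q" unfolding xk by (blast intro: T.m_closed T.m_inv_closed)
        then have "q' = q" using x_pow q by simp
        then show ?thesis using sq by simp
      qed
      then show "s \<in> P" using SQP s q by blast
    qed
    moreover have "Q \<subseteq> Q'" using mem[of _ 0] Q.mem_carrier by fastforce
    ultimately have "Q' = Q" by (rule max)
    then have "x \<in> Q" using mem[OF Q.one_closed, of 1] x by simp
    then have "\<one> \<otimes> x \<in> S <#> Q" by (intro set_multI) auto
    then show False using x by simp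
  qed
  then have "S <#> Q = carrier V" using T.subset by blast
  moreover have "S \<inter> Q = {\<one>}" using SQ by auto
  ultimately show ?thesis using that Q SQP by blast
qed

text \<open>The projection along the complement from \<open>complement_exists\<close>; the last
  property of that complement keeps \<open>P\<close> invariant.\<close>

lemma retraction_exists:
  assumes S: "subgroup S V"
  obtains r where "r \<in> hom V V" "\<And>v. v \<in> carrier V \<Longrightarrow> r v \<in> S" "\<And>s. s \<in> S \<Longrightarrow> r s = s"
    "\<And>z. z \<in> P \<Longrightarrow> r z \<in> P"
proof -
  interpret S: subgroup S V by fact
  obtain Q where Q: "subgroup Q V" "S \<inter> Q = {\<one>}" "S <#> Q = carrier V"
    and SQP: "\<And>s q. s \<in> S \<Longrightarrow> q \<in> Q \<Longrightarrow> s \<otimes> q \<in> P \<Longrightarrow> s \<in> P"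
    using complement_exists[OF S] by metis
  obtain r where r: "\<And>s q. s \<in> S \<Longrightarrow> q \<in> Q \<Longrightarrow> r (s \<otimes> q) = s \<otimes> \<one>"
    and hom: "r \<in> hom (V\<lparr>carrier := S <#> Q\<rparr>) V"
    by (rule hom_on_set_mult[OF S Q(1), of "\<lambda>x. x" "\<lambda>_. \<one>"]) (use Q in auto)
  have sq: "\<exists>s\<in>S. \<exists>q\<in>Q. v = s \<otimes> q" if "v \<in> carrier V" for v
    using that unfolding Q(3)[symmetric] by (auto simp: set_mult_def)
  show ?thesis
  proof
    show "r \<in> hom V V" using hom unfolding Q(3) by simp
    show "r s = s" if "s \<in> S" for s using r[OF that subgroup.one_closed[OF Q(1)]] that by simp
    show "r v \<in> S" if "v \<in> carrier V" for v using sq[OF that] r by auto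
    show "r z \<in> P" if z: "z \<in> P" for z
    proof -
      obtain s q where "s \<in> S" "q \<in> Q" "z = s \<otimes> q" using sq P_closed[OF z] by blast
      then show ?thesis using r SQP z by simp
    qed
  qed
qed

text \<open>On \<open>A <#> B\<close> the map is the identity on \<open>A\<close> and
  \<open>\<rho>\<close> on \<open>B\<close>, well defined because they agree on the intersection. A
  retraction of \<open>V\<close> onto \<open>A <#> B\<close> that respects \<open>P\<close> extends
  it to \<open>V\<close>. The assumption \<open>indep\<close> is condition (2) of independence in
  additive form and serves to keep \<open>P\<close> invariant.\<close>

lemma retraction_extending:
  assumes A: "subgroup A V" and B: "subgroup B V"
    and \<rho>: "\<And>x y. x \<in> B \<Longrightarrow> y \<in> B \<Longrightarrow> \<rho> (x \<otimes> y) = \<rho> x \<otimes> \<rho> y" "\<And>x. x \<in> B \<Longrightarrow> \<rho> x \<in> A"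
      "\<And>x. x \<in> A \<inter> B \<Longrightarrow> \<rho> x = x" "\<And>x. x \<in> B \<inter> P \<Longrightarrow> \<rho> x \<in> P"
    and indep: "\<And>a x. a \<in> A \<Longrightarrow> x \<in> B \<Longrightarrow> a \<otimes> x \<in> P \<Longrightarrow> \<exists>d\<in>A \<inter> B. a \<otimes> inv d \<in> P"
  obtains \<alpha> where "\<alpha> \<in> hom V V" "\<And>v. v \<in> carrier V \<Longrightarrow> \<alpha> v \<in> A" "\<And>a. a \<in> A \<Longrightarrow> \<alpha> a = a"
    "\<And>x. x \<in> B \<Longrightarrow> \<alpha> x = \<rho> x" "\<And>z. z \<in> P \<Longrightarrow> \<alpha> z \<in> P"
proof -
  interpret A: subgroup A V by fact
  interpret B: subgroup B V by fact
  interpret P: subgroup P V by (rule P_subgroup)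
  have T: "subgroup (A <#> B) V" using A B by (rule mult_subgroups)
  obtain f where f: "\<And>a x. a \<in> A \<Longrightarrow> x \<in> B \<Longrightarrow> f (a \<otimes> x) = a \<otimes> \<rho> x"
    and f_hom: "f \<in> hom (V\<lparr>carrier := A <#> B\<rparr>) V"
    by (rule hom_on_set_mult[OF A B, of "\<lambda>x. x" \<rho>]) (use \<rho> in auto)
  obtain r where r: "r \<in> hom V V" "\<And>v. v \<in> carrier V \<Longrightarrow> r v \<in> A <#> B"
    "\<And>s. s \<in> A <#> B \<Longrightarrow> r s = s" "\<And>z. z \<in> P \<Longrightarrow> r z \<in> P"
    using retraction_exists[OF T] by metis
  have AT: "a \<in> A <#> B" "f a = a" if "a \<in> A" for a
  proof -
    have "\<rho> \<one> = \<one>" using \<rho>(3)[of \<one>] by simp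
    then show "a \<in> A <#> B" "f a = a"
      using set_multI[OF that B.one_closed, of V] f[OF that B.one_closed] that by auto
  qed
  have BT: "x \<in> A <#> B" "f x = \<rho> x" if "x \<in> B" for x
    using set_multI[OF A.one_closed that, of V] f[OF A.one_closed that] that \<rho>(2) by auto
  show ?thesis
  proof
    show "(\<lambda>v. f (r v)) \<in> hom V V"
      using r(1,2) f_hom by (auto simp: hom_def Pi_def)
    show "f (r v) \<in> A" if "v \<in> carrier V" for v
      using r(2)[OF that] f \<rho>(2) by (auto simp: set_mult_def)
    show "f (r a) = a" if "a \<in> A" for a using that AT r by simp
    show "f (r x) = \<rho> x" if "x \<in> B" for x using that BT r by simp
    show "f (r z) \<in> P" if z: "z \<in> P" for z
    proof -
      have "r z \<in> A <#> B" "r z \<in> P" using r z P_closed by auto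
      then obtain a x where ax: "a \<in> A" "x \<in> B" "r z = a \<otimes> x" by (auto simp: set_mult_def)
      then obtain d where d: "d \<in> A" "d \<in> B" "a \<otimes> inv d \<in> P" using indep \<open>r z \<in> P\<close> by auto
      \<comment> \<open>Correcting \<open>a\<close> by \<open>d\<close> moves the problem into
        \<open>B\<close>: \<open>d \<otimes> x\<close> lies in \<open>B\<close> and in
        \<open>P\<close>, where \<open>\<rho>\<close> is known to respect \<open>P\<close>, and the
        remaining factor \<open>a \<otimes> inv d\<close> is already in \<open>P\<close>.\<close>
      have "d \<otimes> x = inv (a \<otimes> inv d) \<otimes> (a \<otimes> x)" using ax d by (simp add: inv_mult m_assoc m_lcomm[of d a x])
      then have "d \<otimes> x \<in> P" using ax d \<open>r z \<in> P\<close> by auto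
      then have dx: "d \<otimes> x \<in> B \<inter> P" using ax d by auto
      have "a \<otimes> \<rho> x = (a \<otimes> inv d) \<otimes> \<rho> (d \<otimes> x)"
        using ax d \<rho>(1)[of d x] \<rho>(2)[of x] \<rho>(3)[of d] by (simp add: m_assoc)
      then have "a \<otimes> \<rho> x \<in> P" using d dx \<rho>(4) by auto
      then show ?thesis using ax f by simp
    qed
  qed
qed

end

section \<open>Amalgamation of three copies\<close>

text \<open>Three copies of \<open>V\<close> are amalgamated: the first two share \<open>A\<close>, the first and the third share
  \<open>B\<close>, and \<open>C\<close> in the second is glued to \<open>\<sigma> ` C\<close> in the third.\<close>

locale three_retractions = alternating_form V p P b for V (structure) and p P b +
  fixes A B C \<sigma> \<alpha>A \<alpha>B \<gamma>A \<gamma>C \<delta>B \<delta>C \<rho>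
  assumes \<sigma>: "\<sigma> \<in> hom V V" "\<And>z. z \<in> P \<Longrightarrow> \<sigma> z \<in> P"
    "\<And>x y. x \<in> carrier V \<Longrightarrow> y \<in> carrier V \<Longrightarrow> \<sigma> (b x y) = b (\<sigma> x) (\<sigma> y)"
    and subs: "A \<subseteq> carrier V" "B \<subseteq> carrier V" "C \<subseteq> carrier V"
    and form_mem: "\<And>x y. x \<in> A \<Longrightarrow> y \<in> A \<Longrightarrow> b x y \<in> A" "\<And>x y. x \<in> B \<Longrightarrow> y \<in> B \<Longrightarrow> b x y \<in> B"
      "\<And>x y. x \<in> C \<Longrightarrow> y \<in> C \<Longrightarrow> b x y \<in> C"
    and homs: "\<alpha>A \<in> hom V V" "\<alpha>B \<in> hom V V" "\<gamma>A \<in> hom V V" "\<gamma>C \<in> hom V V" "\<delta>B \<in> hom V V" "\<delta>C \<in> hom V V"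
    and P_pres: "\<And>z. z \<in> P \<Longrightarrow> \<alpha>A z \<in> P" "\<And>z. z \<in> P \<Longrightarrow> \<alpha>B z \<in> P" "\<And>z. z \<in> P \<Longrightarrow> \<gamma>A z \<in> P"
      "\<And>z. z \<in> P \<Longrightarrow> \<gamma>C z \<in> P" "\<And>z. z \<in> P \<Longrightarrow> \<delta>B z \<in> P" "\<And>z. z \<in> P \<Longrightarrow> \<delta>C z \<in> P"
    and range: "\<And>v. v \<in> carrier V \<Longrightarrow> \<alpha>A v \<in> A" "\<And>v. v \<in> carrier V \<Longrightarrow> \<alpha>B v \<in> B"
      "\<And>v. v \<in> carrier V \<Longrightarrow> \<gamma>A v \<in> A" "\<And>v. v \<in> carrier V \<Longrightarrow> \<gamma>C v \<in> C"
      "\<And>v. v \<in> carrier V \<Longrightarrow> \<delta>B v \<in> B" "\<And>v. v \<in> carrier V \<Longrightarrow> \<delta>C v \<in> C"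
    and \<rho>: "\<And>v. v \<in> carrier V \<Longrightarrow> \<rho> v \<in> A \<inter> B \<inter> C" "\<And>v. v \<in> A \<inter> B \<inter> C \<Longrightarrow> \<rho> v = v"
      "\<And>v. v \<in> A \<inter> B \<inter> C \<Longrightarrow> \<sigma> v = v"
    and on_A: "\<And>a. a \<in> A \<Longrightarrow> \<alpha>A a = a" "\<And>a. a \<in> A \<Longrightarrow> \<alpha>B a = \<rho> a"
      "\<And>a. a \<in> A \<Longrightarrow> \<gamma>A a = a" "\<And>a. a \<in> A \<Longrightarrow> \<gamma>C a = \<rho> a"
    and on_B: "\<And>x. x \<in> B \<Longrightarrow> \<alpha>A x = \<rho> x" "\<And>x. x \<in> B \<Longrightarrow> \<alpha>B x = x"
      "\<And>x. x \<in> B \<Longrightarrow> \<delta>B x = x" "\<And>x. x \<in> B \<Longrightarrow> \<delta>C x = \<rho> x"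
    and on_C: "\<And>c. c \<in> C \<Longrightarrow> \<gamma>A c = \<rho> c" "\<And>c. c \<in> C \<Longrightarrow> \<gamma>C c = c"
      "\<And>c. c \<in> C \<Longrightarrow> \<delta>B (\<sigma> c) = \<rho> c" "\<And>c. c \<in> C \<Longrightarrow> \<delta>C (\<sigma> c) = c"
begin

definition VVV :: "('a \<times> 'a \<times> 'a) monoid" where
  "VVV = V \<times>\<times> V \<times>\<times> V"

text \<open>Each coordinate of \<open>VVV\<close> belongs to one copy. An embedding is the identity
  in its own coordinate, hence injective; in the other two it retracts onto the subgroup shared with
  that copy. In \<open>embed_AC\<close> and \<open>embed_BC\<close> the maps \<open>\<sigma>\<close>
  and \<open>\<delta>C\<close> translate between \<open>C\<close> and its image.\<close>

definition embed_AB :: "'a \<Rightarrow> 'a \<times> 'a \<times> 'a" where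
  "embed_AB x = (x, \<alpha>A x, \<alpha>B x)"

definition embed_AC :: "'a \<Rightarrow> 'a \<times> 'a \<times> 'a" where
  "embed_AC y = (\<gamma>A y, y, \<sigma> (\<gamma>C y))"

definition embed_BC :: "'a \<Rightarrow> 'a \<times> 'a \<times> 'a" where
  "embed_BC z = (\<delta>B z, \<delta>C z, z)"

text \<open>Inclusion-exclusion over the three copies, the shared subgroups \<open>A\<close>, \<open>B\<close>, \<open>C\<close> and their
  intersection: on the image of each embedding, all but one of the seven summands cancel.\<close>

definition amalgam_form :: "'a \<times> 'a \<times> 'a \<Rightarrow> 'a \<times> 'a \<times> 'a \<Rightarrow> 'a \<times> 'a \<times> 'a" where
  "amalgam_form = (\<lambda>(x, y, z) (x', y', z').
     (embed_AB (b x x') \<otimes>\<^bsub>VVV\<^esub> inv\<^bsub>VVV\<^esub> embed_AB (b (\<alpha>A x) (\<alpha>A x')) \<otimes>\<^bsub>VVV\<^esub> inv\<^bsub>VVV\<^esub> embed_AB (b (\<alpha>B x) (\<alpha>B x')))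
     \<otimes>\<^bsub>VVV\<^esub> (embed_AC (b y y') \<otimes>\<^bsub>VVV\<^esub> inv\<^bsub>VVV\<^esub> embed_AC (b (\<gamma>C y) (\<gamma>C y')))
     \<otimes>\<^bsub>VVV\<^esub> embed_BC (b z z') \<otimes>\<^bsub>VVV\<^esub> embed_AB (b (\<gamma>C (\<alpha>A x)) (\<gamma>C (\<alpha>A x'))))"

lemma VVV_group: "comm_group VVV"
proof -
  have "group VVV" unfolding VVV_def by (intro DirProd_group is_group)
  then show ?thesis unfolding VVV_def
    by (rule group.group_comm_groupI) (auto simp: m_comm)
qed

sublocale VVV: comm_group VVV by (rule VVV_group)

lemma carrier_VVV [simp]: "carrier VVV = carrier V \<times> carrier V \<times> carrier V"
  by (simp add: VVV_def)

lemma hom_apply: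
  assumes "f \<in> hom V V"
  shows "\<And>x. x \<in> carrier V \<Longrightarrow> f x \<in> carrier V"
    "\<And>x y. x \<in> carrier V \<Longrightarrow> y \<in> carrier V \<Longrightarrow> f (x \<otimes> y) = f x \<otimes> f y"
    "f \<one> = \<one>"
  using assms hom_one[OF assms is_group is_group] by (auto simp: hom_def)

lemmas closed [simp] = hom_apply(1)[OF \<sigma>(1)] homs[THEN hom_apply(1)]
lemmas mult [simp] = hom_apply(2)[OF \<sigma>(1)] homs[THEN hom_apply(2)]

lemma hom_embed: "embed_AB \<in> hom V VVV" "embed_AC \<in> hom V VVV" "embed_BC \<in> hom V VVV"
  by (auto intro!: homI simp: embed_AB_def embed_AC_def embed_BC_def) (simp_all add: VVV_def)

lemma embed_closed [simp]: "x \<in> carrier V \<Longrightarrow> embed_AB x \<in> carrier VVV"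
   "x \<in> carrier V \<Longrightarrow> embed_AC x \<in> carrier VVV" "x \<in> carrier V \<Longrightarrow> embed_BC x \<in> carrier VVV"
  using hom_embed[THEN hom_in_carrier] by blast+

lemma embed_mult:
  assumes "x \<in> carrier V" "y \<in> carrier V"
  shows "embed_AB (x \<otimes> y) = embed_AB x \<otimes>\<^bsub>VVV\<^esub> embed_AB y"
    "embed_AC (x \<otimes> y) = embed_AC x \<otimes>\<^bsub>VVV\<^esub> embed_AC y"
    "embed_BC (x \<otimes> y) = embed_BC x \<otimes>\<^bsub>VVV\<^esub> embed_BC y"
  using hom_mult[OF hom_embed(1) assms] hom_mult[OF hom_embed(2) assms] hom_mult[OF hom_embed(3) assms] by auto

lemma embed_one: "embed_AB \<one> = \<one>\<^bsub>VVV\<^esub>" "embed_AC \<one> = \<one>\<^bsub>VVV\<^esub>" "embed_BC \<one> = \<one>\<^bsub>VVV\<^esub>"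
  using hom_embed[THEN hom_one] VVV.is_group is_group by blast+

lemma memD: "x \<in> A \<Longrightarrow> x \<in> carrier V" "x \<in> B \<Longrightarrow> x \<in> carrier V" "x \<in> C \<Longrightarrow> x \<in> carrier V"
  using subs by auto

lemma \<rho>_mem: "v \<in> carrier V \<Longrightarrow> \<rho> v \<in> A" "v \<in> carrier V \<Longrightarrow> \<rho> v \<in> B" "v \<in> carrier V \<Longrightarrow> \<rho> v \<in> C"
  "v \<in> carrier V \<Longrightarrow> \<rho> v \<in> carrier V"
  using \<rho>(1) subs by auto

lemma \<rho>_idem: "v \<in> carrier V \<Longrightarrow> \<rho> (\<rho> v) = \<rho> v" "v \<in> carrier V \<Longrightarrow> \<sigma> (\<rho> v) = \<rho> v"
  using \<rho> by auto

lemma embed_A: "a \<in> A \<Longrightarrow> embed_AC a = embed_AB a"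
  by (simp add: embed_AB_def embed_AC_def on_A \<rho>_idem memD)

lemma embed_B: "x \<in> B \<Longrightarrow> embed_BC x = embed_AB x"
  by (simp add: embed_AB_def embed_BC_def on_B)

lemma embed_C: "c \<in> C \<Longrightarrow> embed_BC (\<sigma> c) = embed_AC c"
  by (simp add: embed_AC_def embed_BC_def on_C)

text \<open>The first coordinate of \<open>embed_AC c\<close> is \<open>\<rho> c\<close>, an element
  of the common intersection. In this way the amalgam records that \<open>C\<close> is independent
  from the first copy modulo \<open>P\<close>.\<close>

lemma embed_AC_eq_AB:
  assumes "c \<in> C" "x \<in> carrier V" "z1 \<in> P" "z2 \<in> P" "z3 \<in> P" "embed_AC c = embed_AB x \<otimes>\<^bsub>VVV\<^esub> (z1, z2, z3)"
  shows "\<rho> c = x \<otimes> z1"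
  using assms(1,6) by (auto simp: embed_AC_def embed_AB_def on_C VVV_def)

lemma PPP_subgroup: "subgroup (P \<times> P \<times> P) VVV"
  unfolding VVV_def by (intro DirProd_subgroups DirProd_group is_group P_subgroup)

text \<open>One direction holds because the retractions and \<open>\<sigma>\<close> respect
  \<open>P\<close>, the other because one coordinate is \<open>x\<close> itself.\<close>

lemma embed_PPP:
  assumes "x \<in> carrier V"
  shows "embed_AB x \<in> P \<times> P \<times> P \<longleftrightarrow> x \<in> P" "embed_AC x \<in> P \<times> P \<times> P \<longleftrightarrow> x \<in> P"
    "embed_BC x \<in> P \<times> P \<times> P \<longleftrightarrow> x \<in> P"
  by (auto simp: embed_AB_def embed_AC_def embed_BC_def P_pres \<sigma>)

lemma form_closedV: "x \<in> carrier V \<Longrightarrow> y \<in> carrier V \<Longrightarrow> b x y \<in> carrier V" by simp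

text \<open>Each summand applies an additive map to a value of \<open>b\<close> on additive images
  of one coordinate. Bilinearity, alternation and vanishing on \<open>P\<close> are therefore
  inherited summand by summand, whatever the signs.\<close>

lemma amalgam_alternating: "alternating_form VVV p (P \<times> P \<times> P) amalgam_form"
proof (intro alternating_form.intro alternating_form_axioms.intro elementary_abelian_pair.intro
      elementary_abelian_pair_axioms.intro VVV_group prime_p p_neq_2 PPP_subgroup)
  interpret PPP: subgroup "P \<times> P \<times> P" VVV by (rule PPP_subgroup)
  show "amalgam_form u u' = \<one>\<^bsub>VVV\<^esub>" if "u \<in> P \<times> P \<times> P" "u' \<in> carrier VVV" for u u'
  proof -
    obtain x y z x' y' z' where "u = (x, y, z)" "u' = (x', y', z')" by (metis prod_cases3)
    then show ?thesis using that
      by (simp add: amalgam_form_def form_P_left embed_one P_pres) (simp flip: carrier_VVV)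
  qed
  fix u assume u: "u \<in> carrier VVV"
  then obtain x y z where xyz: "u = (x, y, z)" "x \<in> carrier V" "y \<in> carrier V" "z \<in> carrier V" by auto
  have "u [^]\<^bsub>VVV\<^esub> n = (x [^] n, y [^] n, z [^] n)" for n :: nat
    by (induction n) (auto simp: xyz VVV_def)
  then show "u [^]\<^bsub>VVV\<^esub> p = \<one>\<^bsub>VVV\<^esub>" using xyz exponent by (simp add: VVV_def)
  show "amalgam_form u u = \<one>\<^bsub>VVV\<^esub>"
    using xyz by (simp add: amalgam_form_def form_self embed_one del: carrier_VVV)
  fix u' assume u': "u' \<in> carrier VVV"
  then obtain x' y' z' where xyz': "u' = (x', y', z')" "x' \<in> carrier V" "y' \<in> carrier V" "z' \<in> carrier V" by auto
  have bP: "embed_AB (b s t) \<in> P \<times> P \<times> P" "embed_AC (b s t) \<in> P \<times> P \<times> P" "embed_BC (b s t) \<in> P \<times> P \<times> P"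
    if "s \<in> carrier V" "t \<in> carrier V" for s t
    using that by (simp_all only: embed_PPP form_closedV form_in_P)
  show "amalgam_form u u' \<in> P \<times> P \<times> P"
    using xyz xyz' unfolding amalgam_form_def by (simp only: prod.case)
      (intro PPP.m_closed PPP.m_inv_closed bP closed; simp)
  fix u'' assume u'': "u'' \<in> carrier VVV"
  then obtain x'' y'' z'' where xyz'': "u'' = (x'', y'', z'')" "x'' \<in> carrier V" "y'' \<in> carrier V" "z'' \<in> carrier V" by auto
  have prod: "u \<otimes>\<^bsub>VVV\<^esub> u' = (x \<otimes> x', y \<otimes> y', z \<otimes> z')" "u' \<otimes>\<^bsub>VVV\<^esub> u'' = (x' \<otimes> x'', y' \<otimes> y'', z' \<otimes> z'')"
    using xyz xyz' xyz'' by (simp_all add: VVV_def)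
  show "amalgam_form (u \<otimes>\<^bsub>VVV\<^esub> u') u'' = amalgam_form u u'' \<otimes>\<^bsub>VVV\<^esub> amalgam_form u' u''"
    unfolding prod unfolding xyz(1) xyz'(1) xyz''(1) using xyz(2-) xyz'(2-) xyz''(2-)
    by (simp add: amalgam_form_def form_mult_left embed_mult VVV.inv_mult del: carrier_VVV) (simp only: VVV.m_ac VVV.m_closed VVV.inv_closed embed_closed form_closedV closed)
  show "amalgam_form u (u' \<otimes>\<^bsub>VVV\<^esub> u'') = amalgam_form u u' \<otimes>\<^bsub>VVV\<^esub> amalgam_form u u''"
    unfolding prod unfolding xyz(1) xyz'(1) xyz''(1) using xyz(2-) xyz'(2-) xyz''(2-)
    by (simp add: amalgam_form_def form_mult_right embed_mult VVV.inv_mult del: carrier_VVV) (simp only: VVV.m_ac VVV.m_closed VVV.inv_closed embed_closed form_closedV closed)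
qed

sublocale amalgam: alternating_form VVV p "P \<times> P \<times> P" amalgam_form
  by (rule amalgam_alternating)

lemma form_D: "\<lbrakk>x \<in> carrier V; y \<in> carrier V\<rbrakk> \<Longrightarrow> embed_AC (b (\<rho> x) (\<rho> y)) = embed_AB (b (\<rho> x) (\<rho> y))"
  by (simp add: embed_A form_mem \<rho>_mem)

text \<open>On the first image the other two coordinates are \<open>\<alpha>A x\<close> and
  \<open>\<alpha>B x\<close>. There the embeddings agree by \<open>embed_A\<close> and
  \<open>embed_B\<close>, so these summands cancel the corrections for \<open>A\<close> and
  \<open>B\<close>; the correction for \<open>C\<close> cancels the summand for the intersection,
  since \<open>\<gamma>C\<close> is \<open>\<rho>\<close> on \<open>A\<close>. The other two images
  work alike, with \<open>embed_C\<close> for the gluing along \<open>C\<close>.\<close>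

lemma amalgam_form_embed:
  assumes "x \<in> carrier V" "y \<in> carrier V"
  shows "amalgam_form (embed_AB x) (embed_AB y) = embed_AB (b x y)"
    "amalgam_form (embed_AC x) (embed_AC y) = embed_AC (b x y)"
    "amalgam_form (embed_BC x) (embed_BC y) = embed_BC (b x y)"
proof -
  note r = range[OF assms(1)] range[OF assms(2)]
  let ?e = "\<lambda>f. embed_AB (b (f x) (f y))"
  show "amalgam_form (embed_AB x) (embed_AB y) = embed_AB (b x y)"
  proof -
    have "amalgam_form (embed_AB x) (embed_AB y) =
     (embed_AB (b x y) \<otimes>\<^bsub>VVV\<^esub> inv\<^bsub>VVV\<^esub> ?e \<alpha>A \<otimes>\<^bsub>VVV\<^esub> inv\<^bsub>VVV\<^esub> ?e \<alpha>B)
     \<otimes>\<^bsub>VVV\<^esub> (?e \<alpha>A \<otimes>\<^bsub>VVV\<^esub> inv\<^bsub>VVV\<^esub> ?e (\<lambda>x. \<rho> (\<alpha>A x)))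
     \<otimes>\<^bsub>VVV\<^esub> ?e \<alpha>B \<otimes>\<^bsub>VVV\<^esub> ?e (\<lambda>x. \<rho> (\<alpha>A x))"
      using assms r by (simp add: amalgam_form_def embed_AB_def[of x] embed_AB_def[of y] on_A embed_A embed_B form_mem form_D)
    also have "\<dots> = embed_AB (b x y)"
      using assms r by (simp add: VVV.m_ac \<rho>_mem del: carrier_VVV)
    finally show ?thesis .
  qed
  show "amalgam_form (embed_AC x) (embed_AC y) = embed_AC (b x y)"
  proof -
    have "amalgam_form (embed_AC x) (embed_AC y) =
     (?e \<gamma>A \<otimes>\<^bsub>VVV\<^esub> inv\<^bsub>VVV\<^esub> ?e \<gamma>A \<otimes>\<^bsub>VVV\<^esub> inv\<^bsub>VVV\<^esub> ?e (\<lambda>x. \<rho> (\<gamma>A x)))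
     \<otimes>\<^bsub>VVV\<^esub> (embed_AC (b x y) \<otimes>\<^bsub>VVV\<^esub> inv\<^bsub>VVV\<^esub> embed_AC (b (\<gamma>C x) (\<gamma>C y)))
     \<otimes>\<^bsub>VVV\<^esub> embed_AC (b (\<gamma>C x) (\<gamma>C y)) \<otimes>\<^bsub>VVV\<^esub> ?e (\<lambda>x. \<rho> (\<gamma>A x))"
      using assms r by (simp add: amalgam_form_def embed_AC_def[of x] embed_AC_def[of y] on_A embed_A embed_C[symmetric] \<sigma>(3) form_mem)
    also have "\<dots> = embed_AC (b x y)"
      using assms r by (simp add: VVV.m_ac \<rho>_mem del: carrier_VVV)
    finally show ?thesis .
  qed
  show "amalgam_form (embed_BC x) (embed_BC y) = embed_BC (b x y)"
  proof -
    have "amalgam_form (embed_BC x) (embed_BC y) =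
     (?e \<delta>B \<otimes>\<^bsub>VVV\<^esub> inv\<^bsub>VVV\<^esub> ?e (\<lambda>x. \<rho> (\<delta>B x)) \<otimes>\<^bsub>VVV\<^esub> inv\<^bsub>VVV\<^esub> ?e \<delta>B)
     \<otimes>\<^bsub>VVV\<^esub> (embed_AC (b (\<delta>C x) (\<delta>C y)) \<otimes>\<^bsub>VVV\<^esub> inv\<^bsub>VVV\<^esub> embed_AC (b (\<delta>C x) (\<delta>C y)))
     \<otimes>\<^bsub>VVV\<^esub> embed_BC (b x y) \<otimes>\<^bsub>VVV\<^esub> ?e (\<lambda>x. \<rho> (\<delta>B x))"
      using assms r by (simp add: amalgam_form_def embed_BC_def[of x] embed_BC_def[of y] on_A on_B on_C embed_A form_mem \<rho>_mem \<rho>_idem)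
    also have "\<dots> = embed_BC (b x y)"
      using assms r by (simp add: VVV.m_ac \<rho>_mem del: carrier_VVV)
    finally show ?thesis .
  qed
qed

lemma lp_embeddings:
  "lp_embedding baer_group amalgam.baer_group embed_AB"
  "lp_embedding baer_group amalgam.baer_group embed_AC"
  "lp_embedding baer_group amalgam.baer_group embed_BC"
proof -
  show "lp_embedding baer_group amalgam.baer_group embed_AB"
    unfolding lp_embedding_def by (auto intro!: homI simp: amalgam_form_embed embed_mult embed_PPP simp del: carrier_VVV)
       (auto simp: inj_on_def embed_AB_def)
  show "lp_embedding baer_group amalgam.baer_group embed_AC"
    unfolding lp_embedding_def by (auto intro!: homI simp: amalgam_form_embed embed_mult embed_PPP simp del: carrier_VVV)
       (auto simp: inj_on_def embed_AC_def)
  show "lp_embedding baer_group amalgam.baer_group embed_BC"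
    unfolding lp_embedding_def by (auto intro!: homI simp: amalgam_form_embed embed_mult embed_PPP simp del: carrier_VVV)
       (auto simp: inj_on_def embed_BC_def)
qed

end

section \<open>From the independence conditions to the retractions, and back to groups\<close>

lemma (in nil2_group) half_cmt_hom:
  assumes f: "f \<in> hom G G" and x: "x \<in> carrier G" "y \<in> carrier G"
  shows "f (half_cmt x y) = half_cmt (f x) (f y)"
proof -
  interpret f: group_hom G G f using f by (simp add: group_hom_def group_hom_axioms_def)
  show ?thesis using x by (simp add: half_cmt_def cmt_def f.hom_nat_pow)
qed

lemma (in nil2_group) hom_baer_sum:
  assumes f: "f \<in> hom G G"
  shows "f \<in> hom baer_sum baer_sum"
proof -
  interpret f: group_hom G G f using f by (simp add: group_hom_def group_hom_axioms_def)
  show ?thesis by (rule homI) (simp_all add: half_cmt_hom[OF f])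
qed

text \<open>The two differences differ by a value of \<open>half_cmt\<close>. Thus condition (2),
  stated with the group product, can be used in the additive group.\<close>

lemma (in nil2_group) baer_sum_diff_in_P:
  assumes "x \<in> carrier G" "y \<in> carrier G"
  shows "x \<otimes>\<^bsub>baer_sum\<^esub> inv\<^bsub>baer_sum\<^esub> y \<in> ppred G \<longleftrightarrow> x \<otimes> inv y \<in> ppred G"
proof -
  interpret P: subgroup "ppred G" G by (rule P_subgroup)
  let ?h = "half_cmt x (inv y)"
  have h: "?h \<in> ppred G" using assms by (simp add: half_cmt_in_P)
  have *: "x \<otimes>\<^bsub>baer_sum\<^esub> inv\<^bsub>baer_sum\<^esub> y = x \<otimes> inv y \<otimes> inv ?h"
    using assms by (simp add: inv_baer_sum)
  show ?thesis
  proof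
    assume "x \<otimes>\<^bsub>baer_sum\<^esub> inv\<^bsub>baer_sum\<^esub> y \<in> ppred G"
    then have "x \<otimes> inv y \<otimes> inv ?h \<otimes> ?h \<in> ppred G" using h by (simp only: * P.m_closed)
    then show "x \<otimes> inv y \<in> ppred G" using assms h by (simp add: m_assoc)
  qed (use h * in auto)
qed

text \<open>The last two clauses are the two halves of the independence of the new \<open>C\<close>
  from \<open>A\<close> and \<open>B\<close> together: \<open>f\<close> embeds all of
  \<open>G\<close>, in particular the subgroup generated by \<open>A\<close> and \<open>B\<close>.
  They are read off from the coordinates of the triple sum.\<close>

lemma (in nil2_group) three_amalgamation:
  assumes A: "subgroup A G" and B: "subgroup B G" and C: "subgroup C G" and D: "subgroup D G"
    and \<sigma>: "\<sigma> \<in> lp_iso G G" "\<And>d. d \<in> D \<Longrightarrow> \<sigma> d = d"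
    and inter: "A \<inter> B = D" "A \<inter> C = D" "B \<inter> \<sigma> ` C = D"
    and mod_P: "\<And>a x. a \<in> A \<Longrightarrow> x \<in> B \<Longrightarrow> a \<otimes> inv x \<in> ppred G \<Longrightarrow> \<exists>d\<in>D. a \<otimes> inv d \<in> ppred G"
      "\<And>a x. a \<in> A \<Longrightarrow> x \<in> C \<Longrightarrow> a \<otimes> inv x \<in> ppred G \<Longrightarrow> \<exists>d\<in>D. a \<otimes> inv d \<in> ppred G"
      "\<And>a x. a \<in> B \<Longrightarrow> x \<in> \<sigma> ` C \<Longrightarrow> a \<otimes> inv x \<in> ppred G \<Longrightarrow> \<exists>d\<in>D. a \<otimes> inv d \<in> ppred G"
  obtains N :: "('a \<times> 'a \<times> 'a) lp_struct" and f g h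
  where "nil2_group N p" "lp_embedding G N f" "lp_embedding G N g" "lp_embedding G N h"
    "\<And>a. a \<in> A \<Longrightarrow> f a = g a" "\<And>x. x \<in> B \<Longrightarrow> f x = h x" "\<And>c. c \<in> C \<Longrightarrow> g c = h (\<sigma> c)"
    "\<And>c x. c \<in> C \<Longrightarrow> x \<in> carrier G \<Longrightarrow> g c = f x \<Longrightarrow> c \<in> D"
    "\<And>c x z. c \<in> C \<Longrightarrow> x \<in> carrier G \<Longrightarrow> z \<in> ppred N \<Longrightarrow> g c = f x \<otimes>\<^bsub>N\<^esub> z \<Longrightarrow> \<exists>d\<in>D. inv x \<otimes> d \<in> ppred G"
proof -
  interpret A: subgroup A G by fact
  interpret B: subgroup B G by fact
  interpret C: subgroup C G by fact
  interpret D: subgroup D G by fact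
  note mem = A.mem_carrier B.mem_carrier C.mem_carrier D.mem_carrier
  \<comment> \<open>The inverse automorphism brings maps onto the image of \<open>C\<close> back to
    \<open>C\<close>.\<close>
  define \<tau> where "\<tau> = inv_into (carrier G) \<sigma>"
  have \<tau>: "\<tau> \<in> lp_iso G G" unfolding \<tau>_def using is_group \<sigma>(1) by (rule lp_iso_inv_into)
  have hom: "\<sigma> \<in> hom G G" "\<tau> \<in> hom G G"
    and P_iff: "\<And>x. x \<in> carrier G \<Longrightarrow> \<sigma> x \<in> ppred G \<longleftrightarrow> x \<in> ppred G"
      "\<And>x. x \<in> carrier G \<Longrightarrow> \<tau> x \<in> ppred G \<longleftrightarrow> x \<in> ppred G"
    and bij: "bij_betw \<sigma> (carrier G) (carrier G)"
    using \<sigma>(1) \<tau> by (auto simp: lp_iso_def iso_def)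
  note homV = hom[THEN hom_baer_sum]
  have \<sigma>_closed: "\<And>x. x \<in> carrier G \<Longrightarrow> \<sigma> x \<in> carrier G" "\<And>x. x \<in> carrier G \<Longrightarrow> \<tau> x \<in> carrier G"
    using hom by (auto simp: hom_def)
  have \<tau>\<sigma>: "\<tau> (\<sigma> x) = x" if "x \<in> carrier G" for x
    using that bij by (simp add: \<tau>_def bij_betw_inv_into_left)
  have \<tau>D: "\<tau> d = d" if "d \<in> D" for d using \<tau>\<sigma>[of d] \<sigma>(2) that mem by simp
  interpret \<sigma>: group_hom G G \<sigma> using hom by (simp add: group_hom_def group_hom_axioms_def)
  have \<sigma>C: "subgroup (\<sigma> ` C) G" using C by (rule \<sigma>.subgroup_img_is_subgroup)
  define I where "I S T \<longleftrightarrow>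
    (\<forall>a\<in>S. \<forall>x\<in>T. a \<otimes> inv x \<in> ppred G \<longrightarrow> (\<exists>d\<in>D. a \<otimes> inv d \<in> ppred G))" for S T
  have ID: "\<exists>d\<in>D. a \<otimes> inv d \<in> ppred G"
    if "I S T" "a \<in> S" "x \<in> T" "a \<otimes> inv x \<in> ppred G" for S T a x
    using that by (auto simp: I_def)
  have diff: "\<exists>d\<in>S \<inter> T. a \<otimes>\<^bsub>baer_sum\<^esub> inv\<^bsub>baer_sum\<^esub> d \<in> ppred G"
    if "subgroup S G" "subgroup T G" "S \<inter> T = D" "a \<in> S" "x \<in> T"
      and ax: "a \<otimes>\<^bsub>baer_sum\<^esub> x \<in> ppred G"
      and *: "I S T"
    for S T a x
  proof -
    have mem': "a \<in> carrier G" "x \<in> carrier G"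
      using subgroup.mem_carrier[OF that(1,4)] subgroup.mem_carrier[OF that(2,5)] .
    have "a \<otimes>\<^bsub>baer_sum\<^esub> inv\<^bsub>baer_sum\<^esub> (inv x) \<in> ppred G" using ax mem' by (simp add: inv_baer_sum)
    then have "a \<otimes> inv (inv x) \<in> ppred G" using mem' by (subst (asm) baer_sum_diff_in_P) auto
    from ID[OF * that(4) subgroup.m_inv_closed[OF that(2,5)] this]
    obtain d where "d \<in> D" "a \<otimes> inv d \<in> ppred G" by blast
    then show ?thesis using baer_sum_diff_in_P[OF mem'(1) mem(4)] unfolding that(3) by blast
  qed
  \<comment> \<open>The witness is close to the element of \<open>S\<close>; the two given elements
    agree modulo \<open>P\<close>, so it is close to the element of \<open>T\<close> as
    well.\<close>
  have swap: "I T S" if ST: "subgroup S G" "subgroup T G" and IST: "I S T" for S T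
    unfolding I_def
  proof (intro ballI impI)
    fix a x assume ax: "a \<in> T" "x \<in> S" "a \<otimes> inv x \<in> ppred G"
    interpret P: subgroup "ppred G" G by (rule P_subgroup)
    have mem': "a \<in> carrier G" "x \<in> carrier G"
      using subgroup.mem_carrier[OF ST(2) ax(1)] subgroup.mem_carrier[OF ST(1) ax(2)] .
    have "x \<otimes> inv a \<in> ppred G" using P.m_inv_closed[OF ax(3)] mem' by (simp add: inv_mult_group)
    from ID[OF IST ax(2,1) this] obtain d where d: "d \<in> D" "x \<otimes> inv d \<in> ppred G" by blast
    have "(a \<otimes> inv x) \<otimes> (x \<otimes> inv d) \<in> ppred G" using ax(3) d(2) by (rule P.m_closed)
    moreover have "(a \<otimes> inv x) \<otimes> (x \<otimes> inv d) = a \<otimes> inv d" using mem' mem(4)[OF d(1)] by (simp add: m_assoc)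
    ultimately show "\<exists>d\<in>D. a \<otimes> inv d \<in> ppred G" using d(1) by auto
  qed
  have inter': "B \<inter> A = D" "C \<inter> A = D" "\<sigma> ` C \<inter> B = D" using inter by auto
  have mods: "I A B" "I A C" "I B (\<sigma> ` C)" using mod_P by (auto simp: I_def)
  note V_sub = A[THEN subgroup_baer_sum] B[THEN subgroup_baer_sum] C[THEN subgroup_baer_sum]
    D[THEN subgroup_baer_sum] \<sigma>C[THEN subgroup_baer_sum]
  \<comment> \<open>One retraction onto \<open>D\<close> is fixed here, and all later maps are built
    from it; unrelated choices would spoil the cancellation in \<open>amalgam_form\<close>.\<close>
  obtain \<rho> where \<rho>: "\<rho> \<in> hom baer_sum baer_sum" "\<And>v. v \<in> carrier G \<Longrightarrow> \<rho> v \<in> D" "\<And>d. d \<in> D \<Longrightarrow> \<rho> d = d"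
    "\<And>z. z \<in> ppred G \<Longrightarrow> \<rho> z \<in> ppred G"
    using V.retraction_exists[OF V_sub(4)] by auto
  have \<rho>_mult: "\<rho> (x \<otimes>\<^bsub>baer_sum\<^esub> y) = \<rho> x \<otimes>\<^bsub>baer_sum\<^esub> \<rho> y" if "x \<in> carrier G" "y \<in> carrier G" for x y
    using hom_mult[OF \<rho>(1)] that by auto
  have ext: "\<exists>\<alpha>. \<alpha> \<in> hom baer_sum baer_sum \<and> (\<forall>v\<in>carrier G. \<alpha> v \<in> S) \<and> (\<forall>a\<in>S. \<alpha> a = a)
      \<and> (\<forall>x\<in>T. \<alpha> x = \<rho> x) \<and> (\<forall>z\<in>ppred G. \<alpha> z \<in> ppred G)"
    if S: "subgroup S G" and T: "subgroup T G" and "S \<inter> T = D"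
      and *: "I S T" for S T
  proof (rule V.retraction_extending[OF S[THEN subgroup_baer_sum] T[THEN subgroup_baer_sum], of \<rho>])
    note mem' = subgroup.mem_carrier[OF S] subgroup.mem_carrier[OF T]
    show "\<rho> (x \<otimes>\<^bsub>baer_sum\<^esub> y) = \<rho> x \<otimes>\<^bsub>baer_sum\<^esub> \<rho> y" if "x \<in> T" "y \<in> T" for x y
      using \<rho>_mult mem' that by blast
    show "\<exists>d\<in>S \<inter> T. a \<otimes>\<^bsub>baer_sum\<^esub> inv\<^bsub>baer_sum\<^esub> d \<in> ppred G"
      if "a \<in> S" "x \<in> T" "a \<otimes>\<^bsub>baer_sum\<^esub> x \<in> ppred G" for a x
      by (rule diff[OF S T \<open>S \<inter> T = D\<close> that *])
  qed (use \<rho> \<open>S \<inter> T = D\<close> subgroup.mem_carrier[OF T] in auto)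
  obtain \<alpha>A where \<alpha>A: "\<alpha>A \<in> hom baer_sum baer_sum" "\<forall>v\<in>carrier G. \<alpha>A v \<in> A" "\<forall>a\<in>A. \<alpha>A a = a"
      "\<forall>x\<in>B. \<alpha>A x = \<rho> x" "\<forall>z\<in>ppred G. \<alpha>A z \<in> ppred G"
    using ext[OF A B inter(1) mods(1)] by blast
  obtain \<alpha>B where \<alpha>B: "\<alpha>B \<in> hom baer_sum baer_sum" "\<forall>v\<in>carrier G. \<alpha>B v \<in> B" "\<forall>a\<in>B. \<alpha>B a = a"
      "\<forall>x\<in>A. \<alpha>B x = \<rho> x" "\<forall>z\<in>ppred G. \<alpha>B z \<in> ppred G"
    using ext[OF B A inter'(1) swap[OF A B mods(1)]] by blast
  obtain \<gamma>A where \<gamma>A: "\<gamma>A \<in> hom baer_sum baer_sum" "\<forall>v\<in>carrier G. \<gamma>A v \<in> A" "\<forall>a\<in>A. \<gamma>A a = a"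
      "\<forall>x\<in>C. \<gamma>A x = \<rho> x" "\<forall>z\<in>ppred G. \<gamma>A z \<in> ppred G"
    using ext[OF A C inter(2) mods(2)] by blast
  obtain \<gamma>C where \<gamma>C: "\<gamma>C \<in> hom baer_sum baer_sum" "\<forall>v\<in>carrier G. \<gamma>C v \<in> C" "\<forall>a\<in>C. \<gamma>C a = a"
      "\<forall>x\<in>A. \<gamma>C x = \<rho> x" "\<forall>z\<in>ppred G. \<gamma>C z \<in> ppred G"
    using ext[OF C A inter'(2) swap[OF A C mods(2)]] by blast
  obtain \<delta> where \<delta>: "\<delta> \<in> hom baer_sum baer_sum" "\<forall>v\<in>carrier G. \<delta> v \<in> \<sigma> ` C" "\<forall>a\<in>\<sigma> ` C. \<delta> a = a"
      "\<forall>x\<in>B. \<delta> x = \<rho> x" "\<forall>z\<in>ppred G. \<delta> z \<in> ppred G"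
    using ext[OF \<sigma>C B inter'(3) swap[OF B \<sigma>C mods(3)]] by blast
  have \<tau>C: "\<tau> v \<in> C" if "v \<in> \<sigma> ` C" for v using that \<tau>\<sigma>[OF mem(3)] by auto
  \<comment> \<open>On the image of \<open>C\<close> the prescribed map is \<open>\<rho>\<close>
    after \<open>\<tau>\<close>, not \<open>\<rho>\<close> itself: the element
    \<open>\<sigma> c\<close> of the third copy is glued to \<open>c\<close> in the second, and
    \<open>\<rho>\<close> has to be applied to \<open>c\<close>.\<close>
  obtain \<delta>B where \<delta>B: "\<delta>B \<in> hom baer_sum baer_sum" "\<And>v. v \<in> carrier baer_sum \<Longrightarrow> \<delta>B v \<in> B"
    "\<And>a. a \<in> B \<Longrightarrow> \<delta>B a = a" "\<And>x. x \<in> \<sigma> ` C \<Longrightarrow> \<delta>B x = \<rho> (\<tau> x)" "\<And>z. z \<in> ppred G \<Longrightarrow> \<delta>B z \<in> ppred G"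
  proof (rule V.retraction_extending[OF V_sub(2,5), of "\<lambda>x. \<rho> (\<tau> x)"])
    show "\<rho> (\<tau> (x \<otimes>\<^bsub>baer_sum\<^esub> y)) = \<rho> (\<tau> x) \<otimes>\<^bsub>baer_sum\<^esub> \<rho> (\<tau> y)" if "x \<in> \<sigma> ` C" "y \<in> \<sigma> ` C" for x y
      using hom_mult[OF homV(2), of x y] \<rho>_mult[of "\<tau> x" "\<tau> y"] subgroup.mem_carrier[OF \<sigma>C] that
      by (simp add: \<sigma>_closed del: baer_sum_simps(2))
    show "\<exists>d\<in>B \<inter> \<sigma> ` C. a \<otimes>\<^bsub>baer_sum\<^esub> inv\<^bsub>baer_sum\<^esub> d \<in> ppred G"
      if "a \<in> B" "x \<in> \<sigma> ` C" "a \<otimes>\<^bsub>baer_sum\<^esub> x \<in> ppred G" for a x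
      by (rule diff[OF B \<sigma>C inter(3) that mods(3)])
    show "\<rho> (\<tau> x) \<in> B" if "x \<in> \<sigma> ` C" for x using \<rho>(2)[OF mem(3)[OF \<tau>C[OF that]]] inter(1) by auto
    show "\<rho> (\<tau> x) = x" if "x \<in> B \<inter> \<sigma> ` C" for x using that inter(3) \<tau>D \<rho>(3) by auto
    show "\<rho> (\<tau> x) \<in> ppred G" if "x \<in> \<sigma> ` C \<inter> ppred G" for x
      using that P_iff(2) P_closed \<rho>(4) by auto
  qed (rule that)
  interpret R: three_retractions baer_sum p "ppred G" half_cmt A B C \<sigma> \<alpha>A \<alpha>B \<gamma>A \<gamma>C \<delta>B "\<lambda>v. \<tau> (\<delta> v)" \<rho>
  proof (intro three_retractions.intro half_cmt_alternating three_retractions_axioms.intro)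
    show "(\<lambda>v. \<tau> (\<delta> v)) \<in> hom baer_sum baer_sum"
      using Group.hom_compose[OF \<delta>(1) homV(2)] by (simp add: o_def)
    show "\<sigma> (half_cmt x y) = half_cmt (\<sigma> x) (\<sigma> y)" if "x \<in> carrier baer_sum" "y \<in> carrier baer_sum" for x y
      using half_cmt_hom[OF hom(1)] that by simp
    have ABC: "A \<inter> B \<inter> C = D" using inter by auto
    show "\<rho> v \<in> A \<inter> B \<inter> C" if "v \<in> carrier baer_sum" for v
      unfolding ABC using \<rho>(2) that by simp
    show "\<rho> v = v" "\<sigma> v = v" if "v \<in> A \<inter> B \<inter> C" for v using that \<rho>(3) \<sigma>(2) unfolding ABC by auto
    show "\<tau> (\<delta> x) = \<rho> x" if "x \<in> B" for x using \<delta>(4) that \<tau>D \<rho>(2) mem by auto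
    show "\<tau> (\<delta> (\<sigma> c)) = c" "\<delta>B (\<sigma> c) = \<rho> c" if "c \<in> C" for c using \<delta>(3) that \<delta>B(4) \<tau>\<sigma> mem by auto
    show "\<tau> (\<delta> z) \<in> ppred G" if "z \<in> ppred G" for z
      using that \<delta>(5) P_iff(2) P_closed by auto
    show "\<tau> (\<delta> v) \<in> C" if "v \<in> carrier baer_sum" for v using that \<delta>(2) \<tau>C by simp
    show "\<sigma> z \<in> ppred G" if "z \<in> ppred G" for z using that P_iff(1) P_closed by auto
    show "half_cmt x y \<in> A" if "x \<in> A" "y \<in> A" for x y using half_cmt_in_subgroup[OF A that] .
    show "half_cmt x y \<in> B" if "x \<in> B" "y \<in> B" for x y using half_cmt_in_subgroup[OF B that] .
    show "half_cmt x y \<in> C" if "x \<in> C" "y \<in> C" for x y using half_cmt_in_subgroup[OF C that] .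
  qed (use \<alpha>A \<alpha>B \<gamma>A \<gamma>C \<delta>B homV mem in auto)
  have emb: "lp_embedding G N f" if "lp_embedding V.baer_group N f" for N :: "('a \<times> 'a \<times> 'a) lp_struct" and f
  proof -
    have "f (x \<otimes> y) = f x \<otimes>\<^bsub>N\<^esub> f y" if "x \<in> carrier G" "y \<in> carrier G" for x y
      using hom_mult[of f V.baer_group N x y] that \<open>lp_embedding V.baer_group N f\<close> mult_eq_baer_sum[OF that]
      by (simp add: lp_embedding_def del: baer_sum_simps(2))
    then show ?thesis using that by (auto simp: lp_embedding_def hom_def)
  qed
  show ?thesis
  proof (rule that[of R.amalgam.baer_group R.embed_AB R.embed_AC R.embed_BC])
    show "nil2_group R.amalgam.baer_group p" by (rule R.amalgam.nil2_baer_group)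
    fix c x assume c: "c \<in> C" and x: "x \<in> carrier G"
    show "c \<in> D" if "R.embed_AC c = R.embed_AB x"
    proof -
      \<comment> \<open>The first coordinates give \<open>x = \<rho> c\<close>, so \<open>x\<close>
        is in \<open>D\<close>; the second coordinates give \<open>c = \<alpha>A x\<close>, and
        \<open>\<alpha>A\<close> fixes \<open>D\<close>.\<close>
      have "R.embed_AC c = (\<rho> c, c, \<sigma> c)" using R.on_C(1,2)[OF c] by (simp add: R.embed_AC_def)
      moreover have "R.embed_AB x = (x, \<alpha>A x, \<alpha>B x)" by (simp add: R.embed_AB_def)
      ultimately have "\<rho> c = x" "c = \<alpha>A x" using that by (metis Pair_inject)+
      moreover have "\<rho> c \<in> D" using \<rho>(2) c mem by auto
      ultimately show ?thesis using \<alpha>A(3) inter by auto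
    qed
    fix z assume "z \<in> ppred R.amalgam.baer_group" and eq: "R.embed_AC c = R.embed_AB x \<otimes>\<^bsub>R.amalgam.baer_group\<^esub> z"
    then have z: "z \<in> ppred G \<times> ppred G \<times> ppred G" by simp
    then obtain z1 z2 z3 where zz: "z = (z1, z2, z3)" "z1 \<in> ppred G" "z2 \<in> ppred G" "z3 \<in> ppred G" by auto
    have e: "R.embed_AB x \<in> carrier R.VVV" using x by (intro R.embed_closed) simp
    have "R.embed_AC c = R.embed_AB x \<otimes>\<^bsub>R.VVV\<^esub> z"
      using eq z e R.amalgam.form_P_right[OF e z] R.amalgam.P_closed[OF z] R.VVV.m_closed R.VVV.r_one
      by (simp del: R.carrier_VVV)
    then have "\<rho> c = x \<otimes>\<^bsub>baer_sum\<^esub> z1" using R.embed_AC_eq_AB[OF c _ zz(2-4)] x zz(1) by simp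
    then have "\<rho> c = x \<otimes> z1" using baer_sum_P x zz by simp
    then have "inv x \<otimes> \<rho> c = z1" using x zz P_closed by simp
    then show "\<exists>d\<in>D. inv x \<otimes> d \<in> ppred G" using \<rho>(2)[OF mem(3)[OF c]] zz(2) by auto
  qed (use R.lp_embeddings[THEN emb] R.embed_A R.embed_B R.embed_C in auto)
qed

section \<open>Partial isomorphisms\<close>

lemma term_val_cong: "(\<And>n. n \<in> term_vars t \<Longrightarrow> v n = w n) \<Longrightarrow> term_val M v t = term_val M w t"
  by (induction t) auto

lemma sat_cong: "(\<And>n. n \<in> free_vars \<phi> \<Longrightarrow> v n = w n) \<Longrightarrow> sat M v \<phi> = sat M w \<phi>"
proof (induction \<phi> arbitrary: v w)
  case (Eq s t)
  then have "term_val M v s = term_val M w s" "term_val M v t = term_val M w t"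
    by (auto intro!: term_val_cong)
  then show ?case by simp
next
  case (Pred t)
  then have "term_val M v t = term_val M w t" by (auto intro!: term_val_cong)
  then show ?case by simp
next
  case (Neg \<phi>)
  have "sat M v \<phi> = sat M w \<phi>" by (rule Neg.IH) (use Neg.prems in auto)
  then show ?case by simp
next
  case (Conj \<phi> \<psi>)
  have "sat M v \<phi> = sat M w \<phi>" by (rule Conj.IH(1)) (use Conj.prems in auto)
  moreover have "sat M v \<psi> = sat M w \<psi>" by (rule Conj.IH(2)) (use Conj.prems in auto)
  ultimately show ?case by simp
next
  case (All n \<phi>)
  have "sat M (v(n := a)) \<phi> = sat M (w(n := a)) \<phi>" for a
    by (rule All.IH) (use All.prems in auto)
  then show ?case by simp
qed

lemma finite_term_vars: "finite (term_vars t)" by (induction t) auto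

lemma finite_free_vars: "finite (free_vars \<phi>)"
  by (induction \<phi>) (auto simp: finite_term_vars)

text \<open>An isomorphism between substructures is represented by its graph, a subgroup of the product.\<close>

definition partial_iso :: "'a lp_struct \<Rightarrow> 'b lp_struct \<Rightarrow> ('a \<times> 'b) set \<Rightarrow> bool" where
  "partial_iso N M S \<longleftrightarrow> subgroup S (N \<times>\<times> M) \<and>
     (\<forall>(x, y)\<in>S. (x = \<one>\<^bsub>N\<^esub> \<longleftrightarrow> y = \<one>\<^bsub>M\<^esub>) \<and> (x \<in> ppred N \<longleftrightarrow> y \<in> ppred M))"

lemma partial_isoD:
  assumes "partial_iso N M S"
  shows "subgroup S (N \<times>\<times> M)" "S \<subseteq> carrier N \<times> carrier M"
    "(x, y) \<in> S \<Longrightarrow> x = \<one>\<^bsub>N\<^esub> \<longleftrightarrow> y = \<one>\<^bsub>M\<^esub>" "(x, y) \<in> S \<Longrightarrow> x \<in> ppred N \<longleftrightarrow> y \<in> ppred M"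
    "(x, y) \<in> S \<Longrightarrow> x \<in> carrier N" "(x, y) \<in> S \<Longrightarrow> y \<in> carrier M"
  using assms subgroup.subset[of S "N \<times>\<times> M"] by (auto simp: partial_iso_def)

lemma partial_iso_mult:
  assumes "partial_iso N M S" "(x, y) \<in> S" "(x', y') \<in> S"
  shows "(x \<otimes>\<^bsub>N\<^esub> x', y \<otimes>\<^bsub>M\<^esub> y') \<in> S"
  using subgroup.m_closed[OF partial_isoD(1)[OF assms(1)] assms(2,3)] by simp

lemma partial_iso_one: "partial_iso N M S \<Longrightarrow> (\<one>\<^bsub>N\<^esub>, \<one>\<^bsub>M\<^esub>) \<in> S"
  using subgroup.one_closed[OF partial_isoD(1)] by fastforce

lemma partial_iso_inv:
  assumes "group N" "group M" "partial_iso N M S" "(x, y) \<in> S"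
  shows "(inv\<^bsub>N\<^esub> x, inv\<^bsub>M\<^esub> y) \<in> S"
  using subgroup.m_inv_closed[OF partial_isoD(1)[OF assms(3)] assms(4)] partial_isoD(5,6)[OF assms(3,4)]
    inv_DirProd[OF assms(1,2)] by simp

lemma partial_isoI:
  assumes "group N" "group M" "S \<subseteq> carrier N \<times> carrier M" "(\<one>\<^bsub>N\<^esub>, \<one>\<^bsub>M\<^esub>) \<in> S"
    and "\<And>x y x' y'. (x, y) \<in> S \<Longrightarrow> (x', y') \<in> S \<Longrightarrow> (x \<otimes>\<^bsub>N\<^esub> x', y \<otimes>\<^bsub>M\<^esub> y') \<in> S"
    and "\<And>x y. (x, y) \<in> S \<Longrightarrow> (inv\<^bsub>N\<^esub> x, inv\<^bsub>M\<^esub> y) \<in> S"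
    and "\<And>x y. (x, y) \<in> S \<Longrightarrow> (x = \<one>\<^bsub>N\<^esub> \<longleftrightarrow> y = \<one>\<^bsub>M\<^esub>)" "\<And>x y. (x, y) \<in> S \<Longrightarrow> (x \<in> ppred N \<longleftrightarrow> y \<in> ppred M)"
  shows "partial_iso N M S"
proof -
  interpret NM: group "N \<times>\<times> M" using assms(1,2) by (rule DirProd_group)
  have "inv\<^bsub>N \<times>\<times> M\<^esub> u \<in> S" if "u \<in> S" for u
    using that assms(3,6) by (cases u) (auto simp: inv_DirProd[OF assms(1,2)])
  moreover have "u \<otimes>\<^bsub>N \<times>\<times> M\<^esub> v \<in> S" if "u \<in> S" "v \<in> S" for u v
    using that assms(5) by (cases u; cases v) auto
  ultimately have "subgroup S (N \<times>\<times> M)"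
    using assms(3,4) by (intro NM.subgroupI) auto
  then show ?thesis using assms(7,8) by (auto simp: partial_iso_def)
qed

lemma partial_iso_subgroup: "partial_iso N M S \<Longrightarrow> subgroup T (N \<times>\<times> M) \<Longrightarrow> T \<subseteq> S \<Longrightarrow> partial_iso N M T"
  by (auto simp: partial_iso_def)

text \<open>The quotient of two pairs with equal first entries starts with the neutral element, so
  the clause on neutral elements forces the second entries to coincide.\<close>

lemma partial_iso_unique_right:
  assumes "group N" "group M" "partial_iso N M S" "(x, y) \<in> S" "(x, y') \<in> S"
  shows "y = y'"
proof -
  interpret N: group N by fact
  interpret M: group M by fact
  note c = partial_isoD(5,6)[OF assms(3)]
  have "(x \<otimes>\<^bsub>N\<^esub> inv\<^bsub>N\<^esub> x, y \<otimes>\<^bsub>M\<^esub> inv\<^bsub>M\<^esub> y') \<in> S"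
    using assms by (intro partial_iso_mult partial_iso_inv)
  then have "y \<otimes>\<^bsub>M\<^esub> inv\<^bsub>M\<^esub> y' = \<one>\<^bsub>M\<^esub>" using partial_isoD(3)[OF assms(3)] c[OF assms(4)] by fastforce
  then show ?thesis using c(2)[OF assms(4)] c(2)[OF assms(5)] M.inv_equality M.inv_inv by fastforce
qed

lemma partial_iso_converse:
  assumes "group N" "group M" "partial_iso N M S"
  shows "partial_iso M N (S\<inverse>)"
  by (rule partial_isoI)
    (use assms partial_isoD[OF assms(3)] partial_iso_mult[OF assms(3)] partial_iso_inv[OF assms]
        partial_iso_one[OF assms(3)] in auto)

lemma partial_iso_unique_left:
  assumes "group N" "group M" "partial_iso N M S" "(x, y) \<in> S" "(x', y) \<in> S"
  shows "x = x'"
  using partial_iso_unique_right[OF assms(2,1) partial_iso_converse[OF assms(1-3)]] assms(4,5) by blast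

lemma partial_iso_relcomp:
  assumes "group L" "group N" "group M" "partial_iso L N R" "partial_iso N M S"
  shows "partial_iso L M (R O S)"
proof (rule partial_isoI)
  note R = partial_isoD[OF assms(4)] and S = partial_isoD[OF assms(5)]
  show "R O S \<subseteq> carrier L \<times> carrier M" using R S by auto
  show "(\<one>\<^bsub>L\<^esub>, \<one>\<^bsub>M\<^esub>) \<in> R O S"
    using partial_iso_one[OF assms(4)] partial_iso_one[OF assms(5)] by (rule relcompI)
  show "(x \<otimes>\<^bsub>L\<^esub> x', y \<otimes>\<^bsub>M\<^esub> y') \<in> R O S" if *: "(x, y) \<in> R O S" "(x', y') \<in> R O S" for x y x' y'
  proof -
    obtain z z' where "(x, z) \<in> R" "(z, y) \<in> S" "(x', z') \<in> R" "(z', y') \<in> S" using * by blast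
    then show ?thesis using partial_iso_mult[OF assms(4)] partial_iso_mult[OF assms(5)] by (meson relcompI)
  qed
  show "(inv\<^bsub>L\<^esub> x, inv\<^bsub>M\<^esub> y) \<in> R O S" if *: "(x, y) \<in> R O S" for x y
  proof -
    obtain z where "(x, z) \<in> R" "(z, y) \<in> S" using * by blast
    then show ?thesis using partial_iso_inv[OF assms(1,2,4)] partial_iso_inv[OF assms(2,3,5)] by (meson relcompI)
  qed
  show "(x = \<one>\<^bsub>L\<^esub>) = (y = \<one>\<^bsub>M\<^esub>)" "(x \<in> ppred L) = (y \<in> ppred M)" if "(x, y) \<in> R O S" for x y
    using that R(3,4) S(3,4) by blast+
qed (use assms in auto)

lemma lp_embedding_closed: "lp_embedding N M f \<Longrightarrow> x \<in> carrier N \<Longrightarrow> f x \<in> carrier M"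
  by (auto simp: lp_embedding_def hom_def)

lemma lp_embedding_one:
  assumes "group N" "group M" "lp_embedding N M f"
  shows "f \<one>\<^bsub>N\<^esub> = \<one>\<^bsub>M\<^esub>"
  using assms by (intro hom_one) (auto simp: lp_embedding_def)

lemma lp_embedding_inv:
  assumes "group N" "group M" "lp_embedding N M f" "x \<in> carrier N"
  shows "f (inv\<^bsub>N\<^esub> x) = inv\<^bsub>M\<^esub> (f x)"
  using group_hom.hom_inv[of N M f x] assms by (simp add: lp_embedding_def group_hom_def group_hom_axioms_def)

lemma lp_embedding_mult:
  assumes "lp_embedding N M f" "x \<in> carrier N" "y \<in> carrier N"
  shows "f (x \<otimes>\<^bsub>N\<^esub> y) = f x \<otimes>\<^bsub>M\<^esub> f y"
  using assms by (auto simp: lp_embedding_def hom_def)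

lemma partial_iso_graph:
  assumes "group N" "group M" "lp_embedding N M f"
  shows "partial_iso N M {(x, f x) | x. x \<in> carrier N}"
proof (rule partial_isoI)
  interpret N: group N by fact
  note f = lp_embedding_closed[OF assms(3)] lp_embedding_one[OF assms] lp_embedding_inv[OF assms] lp_embedding_mult[OF assms(3)]
  show "{(x, f x) | x. x \<in> carrier N} \<subseteq> carrier N \<times> carrier M" using f by auto
  show "(\<one>\<^bsub>N\<^esub>, \<one>\<^bsub>M\<^esub>) \<in> {(x, f x) | x. x \<in> carrier N}" using f by auto
  fix x y assume xy: "(x, y) \<in> {(x, f x) | x. x \<in> carrier N}"
  then show "(inv\<^bsub>N\<^esub> x, inv\<^bsub>M\<^esub> y) \<in> {(x, f x) | x. x \<in> carrier N}" using f by auto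
  show "(x = \<one>\<^bsub>N\<^esub>) = (y = \<one>\<^bsub>M\<^esub>)" using xy f(2) assms(3)
    by (auto simp: lp_embedding_def dest: inj_onD[of f _ x "\<one>\<^bsub>N\<^esub>"])
  show "(x \<in> ppred N) = (y \<in> ppred M)" using xy assms(3) by (auto simp: lp_embedding_def)
  fix x' y' assume "(x', y') \<in> {(x, f x) | x. x \<in> carrier N}"
  then show "(x \<otimes>\<^bsub>N\<^esub> x', y \<otimes>\<^bsub>M\<^esub> y') \<in> {(x, f x) | x. x \<in> carrier N}" using xy f by auto
qed (use assms in auto)

section \<open>Terms and quantifier-free formulas under partial isomorphisms\<close>

lemma partial_iso_term_val:
  assumes "group N" "group M" "partial_iso N M S" "\<And>n. n \<in> term_vars t \<Longrightarrow> \<sigma> n \<in> S"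
  shows "(term_val N (\<lambda>n. fst (\<sigma> n)) t, term_val M (\<lambda>n. snd (\<sigma> n)) t) \<in> S"
  using assms(4)
  by (induction t) (auto intro: partial_iso_mult[OF assms(3)] partial_iso_one[OF assms(3)] partial_iso_inv[OF assms(1-3)])

primrec quantifier_free :: "lp_form \<Rightarrow> bool" where
  "quantifier_free (Eq s t) = True"
| "quantifier_free (Pred t) = True"
| "quantifier_free (Neg \<phi>) = quantifier_free \<phi>"
| "quantifier_free (Conj \<phi> \<psi>) = (quantifier_free \<phi> \<and> quantifier_free \<psi>)"
| "quantifier_free (All n \<phi>) = False"

lemma partial_iso_sat_Eq:
  assumes "group N" "group M" "partial_iso N M S" "\<And>n. n \<in> term_vars s \<union> term_vars t \<Longrightarrow> \<sigma> n \<in> S"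
  shows "sat N (\<lambda>n. fst (\<sigma> n)) (Eq s t) \<longleftrightarrow> sat M (\<lambda>n. snd (\<sigma> n)) (Eq s t)"
  using partial_iso_term_val[OF assms(1-3), of s \<sigma>] partial_iso_term_val[OF assms(1-3), of t \<sigma>] assms(4)
    partial_iso_unique_right[OF assms(1-3)] partial_iso_unique_left[OF assms(1-3)]
  by (metis UnCI sat.simps(1))

lemma partial_iso_sat_Pred:
  assumes "group N" "group M" "partial_iso N M S" "\<And>n. n \<in> term_vars t \<Longrightarrow> \<sigma> n \<in> S"
  shows "sat N (\<lambda>n. fst (\<sigma> n)) (Pred t) \<longleftrightarrow> sat M (\<lambda>n. snd (\<sigma> n)) (Pred t)"
  using partial_iso_term_val[OF assms] partial_isoD(4)[OF assms(3)] by simp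

lemma partial_iso_sat_quantifier_free:
  assumes "group N" "group M" "partial_iso N M S"
  shows "quantifier_free \<phi> \<Longrightarrow> (\<And>n. n \<in> free_vars \<phi> \<Longrightarrow> \<sigma> n \<in> S) \<Longrightarrow>
    sat N (\<lambda>n. fst (\<sigma> n)) \<phi> \<longleftrightarrow> sat M (\<lambda>n. snd (\<sigma> n)) \<phi>"
proof (induction \<phi>)
  case (Eq s t) then show ?case by (intro partial_iso_sat_Eq[OF assms]) auto
next
  case (Pred t) then show ?case by (intro partial_iso_sat_Pred[OF assms]) auto
qed auto

primrec rename_vars :: "(nat \<Rightarrow> nat) \<Rightarrow> lp_term \<Rightarrow> lp_term" where
  "rename_vars f (Var n) = Var (f n)"
| "rename_vars f One = One"
| "rename_vars f (Mult s t) = Mult (rename_vars f s) (rename_vars f t)"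
| "rename_vars f (Inv t) = Inv (rename_vars f t)"

lemma term_vars_rename_vars: "term_vars (rename_vars f t) = f ` term_vars t"
  by (induction t) auto

lemma term_val_rename_vars: "term_val M v (rename_vars f t) = term_val M (\<lambda>n. v (f n)) t"
  by (induction t) auto

text \<open>A single term produces both coordinates, which turns statements about a generated
  relation into statements about formulas.\<close>

lemma generate_DirProd_term_val:
  assumes "group N" "group M" "R \<subseteq> carrier N \<times> carrier M" "u \<in> generate (N \<times>\<times> M) R"
  shows "\<exists>t \<sigma>. (\<forall>n\<in>term_vars t. \<sigma> n \<in> R) \<and>
    u = (term_val N (\<lambda>n. fst (\<sigma> n)) t, term_val M (\<lambda>n. snd (\<sigma> n)) t)"
  using assms(4)
proof (induction rule: generate.induct)
  case one then show ?case by (intro exI[of _ One]) auto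
next
  case (incl h) then show ?case by (intro exI[of _ "Var 0"] exI[of _ "\<lambda>_. h"]) auto
next
  case (inv h) then show ?case using assms(3)
    by (intro exI[of _ "Inv (Var 0)"] exI[of _ "\<lambda>_. h"]) (cases h; auto simp: inv_DirProd[OF assms(1,2)])
next
  case (eng h1 h2)
  then obtain t1 \<sigma>1 t2 \<sigma>2 where
    1: "\<forall>n\<in>term_vars t1. \<sigma>1 n \<in> R" "h1 = (term_val N (\<lambda>n. fst (\<sigma>1 n)) t1, term_val M (\<lambda>n. snd (\<sigma>1 n)) t1)" and
    2: "\<forall>n\<in>term_vars t2. \<sigma>2 n \<in> R" "h2 = (term_val N (\<lambda>n. fst (\<sigma>2 n)) t2, term_val M (\<lambda>n. snd (\<sigma>2 n)) t2)"
    by metis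
  \<comment> \<open>Even variables serve the first term and odd ones the second, so the two
    assignments do not collide.\<close>
  let ?\<sigma> = "\<lambda>n. if even n then \<sigma>1 (n div 2) else \<sigma>2 (n div 2)"
  show ?case
    by (intro exI[of _ "Mult (rename_vars (\<lambda>n. 2 * n) t1) (rename_vars (\<lambda>n. Suc (2 * n)) t2)"] exI[of _ ?\<sigma>])
      (use 1 2 in \<open>auto simp: term_vars_rename_vars term_val_rename_vars\<close>)
qed

text \<open>A criterion in terms of atomic formulas with parameters from \<open>R\<close>; it
  converts a realised quantifier-free type into a partial isomorphism.\<close>

lemma partial_iso_generateI:
  assumes "group N" "group M" "R \<subseteq> carrier N \<times> carrier M"
    and "\<And>t \<sigma>. (\<forall>n\<in>term_vars t. \<sigma> n \<in> R) \<Longrightarrow>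
      (term_val N (\<lambda>n. fst (\<sigma> n)) t = \<one>\<^bsub>N\<^esub> \<longleftrightarrow> term_val M (\<lambda>n. snd (\<sigma> n)) t = \<one>\<^bsub>M\<^esub>) \<and>
      (term_val N (\<lambda>n. fst (\<sigma> n)) t \<in> ppred N \<longleftrightarrow> term_val M (\<lambda>n. snd (\<sigma> n)) t \<in> ppred M)"
  shows "partial_iso N M (generate (N \<times>\<times> M) R)"
  unfolding partial_iso_def
proof (intro conjI ballI)
  interpret NM: group "N \<times>\<times> M" using assms(1,2) by (rule DirProd_group)
  show "subgroup (generate (N \<times>\<times> M) R) (N \<times>\<times> M)" using assms(3) by (intro NM.generate_is_subgroup) simp
  fix u assume "u \<in> generate (N \<times>\<times> M) R"
  from generate_DirProd_term_val[OF assms(1-3) this] assms(4)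
  show "case u of (x, y) \<Rightarrow> (x = \<one>\<^bsub>N\<^esub> \<longleftrightarrow> y = \<one>\<^bsub>M\<^esub>) \<and> (x \<in> ppred N \<longleftrightarrow> y \<in> ppred M)" by auto
qed

lemma finite_generate_DirProd:
  assumes N: "nil2_group N p" and M: "nil2_group M p" and R: "finite R" "R \<subseteq> carrier N \<times> carrier M"
  shows "finite (generate (N \<times>\<times> M) R)"
proof -
  interpret N: nil2_group N p by fact
  interpret M: nil2_group M p by fact
  interpret NM: group "N \<times>\<times> M" by (intro DirProd_group N.is_group M.is_group)
  let ?X = "fst ` R" and ?Y = "snd ` R"
  have XY: "?X \<subseteq> carrier N" "?Y \<subseteq> carrier M" using R(2) by auto
  have "subgroup (generate N ?X \<times> generate M ?Y) (N \<times>\<times> M)"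
    by (intro DirProd_subgroups N.is_group M.is_group N.generate_is_subgroup M.generate_is_subgroup XY)
  moreover have "R \<subseteq> generate N ?X \<times> generate M ?Y" by (force intro: generate.incl)
  ultimately have "generate (N \<times>\<times> M) R \<subseteq> generate N ?X \<times> generate M ?Y"
    by (intro NM.generate_subgroup_incl)
  moreover have "finite (generate N ?X \<times> generate M ?Y)"
    using N.finite_generate M.finite_generate XY R(1) by auto
  ultimately show ?thesis by (rule finite_subset)
qed

section \<open>Finite extensions and elementary maps\<close>

lemma lp_iso_imp_embedding: "f \<in> lp_iso N M \<Longrightarrow> lp_embedding N M f"
  by (auto simp: lp_iso_def lp_embedding_def iso_def bij_betw_def)

text \<open>The axioms are universal, so an injective homomorphism that reflects the predicate pulls
  them back.\<close>

lemma nil2_group_lp_embedding: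
  assumes "nil2_group M p" "group N" "ppred N \<subseteq> carrier N" "lp_embedding N M f"
  shows "nil2_group N p"
proof -
  interpret M: nil2_group M p by fact
  interpret N: group N by fact
  interpret PM: subgroup "ppred M" M by (rule M.P_subgroup)
  note f = lp_embedding_closed[OF assms(4)] lp_embedding_one[OF N.is_group M.is_group assms(4)]
    lp_embedding_inv[OF N.is_group M.is_group assms(4)] lp_embedding_mult[OF assms(4)]
  have inj: "x = y" if "f x = f y" "x \<in> carrier N" "y \<in> carrier N" for x y
    using assms(4) that by (auto simp: lp_embedding_def dest: inj_onD)
  have P: "f x \<in> ppred M \<longleftrightarrow> x \<in> ppred N" if "x \<in> carrier N" for x
    using assms(4) that by (auto simp: lp_embedding_def)
  have cl: "x \<in> carrier N" if "x \<in> ppred N" for x using that assms(3) by auto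
  have pow: "f (x [^]\<^bsub>N\<^esub> n) = f x [^]\<^bsub>M\<^esub> n" if "x \<in> carrier N" for x and n :: nat
    by (induction n) (use that f in auto)
  show ?thesis
  proof (intro nil2_group.intro nil2_group_axioms.intro N.is_group M.prime_p M.p_neq_2)
    show "x [^]\<^bsub>N\<^esub> p = \<one>\<^bsub>N\<^esub>" if "x \<in> carrier N" for x
      using that pow f M.exponent by (intro inj) auto
    show "subgroup (ppred N) N"
    proof (rule N.subgroupI)
      show "ppred N \<noteq> {}" using P[of "\<one>\<^bsub>N\<^esub>"] f by auto
      show "inv\<^bsub>N\<^esub> x \<in> ppred N" if "x \<in> ppred N" for x
        using that P[of x] P[of "inv\<^bsub>N\<^esub> x"] cl f by auto
      show "x \<otimes>\<^bsub>N\<^esub> y \<in> ppred N" if "x \<in> ppred N" "y \<in> ppred N" for x y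
        using that P[of x] P[of y] P[of "x \<otimes>\<^bsub>N\<^esub> y"] cl f by auto
    qed (use assms(3) in auto)
    show "x \<otimes>\<^bsub>N\<^esub> y \<otimes>\<^bsub>N\<^esub> inv\<^bsub>N\<^esub> x \<otimes>\<^bsub>N\<^esub> inv\<^bsub>N\<^esub> y \<in> ppred N" if "x \<in> carrier N" "y \<in> carrier N" for x y
      using that P[of "x \<otimes>\<^bsub>N\<^esub> y \<otimes>\<^bsub>N\<^esub> inv\<^bsub>N\<^esub> x \<otimes>\<^bsub>N\<^esub> inv\<^bsub>N\<^esub> y"] M.commutator_in_P[of "f x" "f y"] f by auto
    show "z \<otimes>\<^bsub>N\<^esub> x = x \<otimes>\<^bsub>N\<^esub> z" if "z \<in> ppred N" "x \<in> carrier N" for z x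
      using that P[of z] M.P_central[of "f z" "f x"] f cl by (intro inj) auto
  qed
qed

section \<open>Substructures and copies on the natural numbers\<close>

definition lp_restrict :: "'a lp_struct \<Rightarrow> 'a set \<Rightarrow> 'a lp_struct" where
  "lp_restrict N F = N\<lparr>carrier := F, ppred := F \<inter> ppred N\<rparr>"

lemma lp_generated_eq: "lp_generated N X = lp_restrict N (generate N X)"
  by (simp add: lp_generated_def lp_restrict_def)

lemma lp_restrict_simps [simp]: "carrier (lp_restrict N F) = F" "ppred (lp_restrict N F) = F \<inter> ppred N"
  "x \<otimes>\<^bsub>lp_restrict N F\<^esub> y = x \<otimes>\<^bsub>N\<^esub> y" "\<one>\<^bsub>lp_restrict N F\<^esub> = \<one>\<^bsub>N\<^esub>"
  by (simp_all add: lp_restrict_def)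

lemma group_lp_restrict:
  assumes "group N" "subgroup F N"
  shows "group (lp_restrict N F)"
proof -
  interpret N: group N by fact
  interpret F: subgroup F N by fact
  show ?thesis
  proof (rule groupI)
    show "\<exists>y\<in>carrier (lp_restrict N F). y \<otimes>\<^bsub>lp_restrict N F\<^esub> x = \<one>\<^bsub>lp_restrict N F\<^esub>"
      if "x \<in> carrier (lp_restrict N F)" for x
      using that by (intro bexI[of _ "inv\<^bsub>N\<^esub> x"]) auto
  qed (auto simp: N.m_assoc)
qed

lemma inv_lp_restrict:
  assumes "group N" "subgroup F N" "x \<in> F"
  shows "inv\<^bsub>lp_restrict N F\<^esub> x = inv\<^bsub>N\<^esub> x"
proof -
  interpret N: group N by fact
  interpret F: subgroup F N by fact
  show ?thesis
    by (rule group.inv_equality[OF group_lp_restrict[OF assms(1,2)]]) (use assms(3) in auto)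
qed

lemma partial_iso_lp_restrict:
  assumes "group N" "group M" "subgroup F N" "fst ` S \<subseteq> F"
  shows "partial_iso (lp_restrict N F) M S \<longleftrightarrow> partial_iso N M S"
proof -
  have K: "group (lp_restrict N F)" using assms(1,3) by (rule group_lp_restrict)
  have F: "x \<in> F" "x \<in> carrier N" if "(x, y) \<in> S" for x y
    using that assms(4) subgroup.subset[OF assms(3)] by force+
  have inv: "inv\<^bsub>lp_restrict N F\<^esub> x = inv\<^bsub>N\<^esub> x" if "(x, y) \<in> S" for x y
    using inv_lp_restrict[OF assms(1,3) F(1)[OF that]] .
  show ?thesis
  proof
    assume S: "partial_iso (lp_restrict N F) M S"
    show "partial_iso N M S"
      by (rule partial_isoI[OF assms(1,2)])
        (use partial_isoD[OF S] partial_iso_one[OF S] partial_iso_mult[OF S] partial_iso_inv[OF K assms(2) S] inv F in auto)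
  next
    assume S: "partial_iso N M S"
    show "partial_iso (lp_restrict N F) M S"
      by (rule partial_isoI[OF K assms(2)])
        (use partial_isoD[OF S] partial_iso_one[OF S] partial_iso_mult[OF S] partial_iso_inv[OF assms(1,2) S] inv F in auto)
  qed
qed

lemma lp_embedding_lp_restrict:
  assumes "F \<subseteq> carrier N" "lp_embedding N M f"
  shows "lp_embedding (lp_restrict N F) M f"
  using assms by (auto simp: lp_embedding_def hom_def subset_iff Pi_iff intro: inj_on_subset)

lemma lp_embedding_id: "lp_embedding N N (\<lambda>x. x)"
  by (auto simp: lp_embedding_def hom_def)

lemma lp_embedding_comp:
  assumes "lp_embedding L N f" "lp_embedding N M g"
  shows "lp_embedding L M (\<lambda>x. g (f x))"
  using assms by (auto simp: lp_embedding_def hom_def inj_on_def Pi_def)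

text \<open>Transport of structure along an injection. \<open>KP\<close> and \<open>age\<close>
  contain only structures on the natural numbers, so finite or countable substructures over other
  types are moved there before the class can be applied to them.\<close>

definition lp_copy :: "('a \<Rightarrow> 'b) \<Rightarrow> 'a lp_struct \<Rightarrow> 'b lp_struct" where
  "lp_copy j N = (let i = inv_into (carrier N) j in
     \<lparr>carrier = j ` carrier N, monoid.mult = (\<lambda>x y. j (i x \<otimes>\<^bsub>N\<^esub> i y)), one = j \<one>\<^bsub>N\<^esub>, ppred = j ` ppred N\<rparr>)"

lemma lp_copy_iso:
  assumes N: "group N" "ppred N \<subseteq> carrier N" and j: "inj_on j (carrier N)"
  shows "group (lp_copy j N)" "j \<in> lp_iso N (lp_copy j N)" "ppred (lp_copy j N) \<subseteq> carrier (lp_copy j N)"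
    "carrier (lp_copy j N) = j ` carrier N"
proof -
  interpret N: group N by fact
  have mult: "j x \<otimes>\<^bsub>lp_copy j N\<^esub> j y = j (x \<otimes>\<^bsub>N\<^esub> y)" if "x \<in> carrier N" "y \<in> carrier N" for x y
    using that j by (simp add: lp_copy_def Let_def)
  have s: "carrier (lp_copy j N) = j ` carrier N" "ppred (lp_copy j N) = j ` ppred N" "\<one>\<^bsub>lp_copy j N\<^esub> = j \<one>\<^bsub>N\<^esub>"
    by (simp_all add: lp_copy_def Let_def)
  show "group (lp_copy j N)"
  proof (rule groupI)
    show "\<exists>y\<in>carrier (lp_copy j N). y \<otimes>\<^bsub>lp_copy j N\<^esub> x = \<one>\<^bsub>lp_copy j N\<^esub>" if "x \<in> carrier (lp_copy j N)" for x
    proof -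
      obtain x' where "x' \<in> carrier N" "x = j x'" using \<open>x \<in> carrier (lp_copy j N)\<close> s by auto
      then show ?thesis by (intro bexI[of _ "j (inv\<^bsub>N\<^esub> x')"]) (simp_all add: mult s)
    qed
  qed (auto simp: s mult N.m_assoc)
  show "j \<in> lp_iso N (lp_copy j N)"
    using j N(2) by (auto simp: lp_iso_def iso_def hom_def mult s bij_betw_def dest: inj_onD)
  show "ppred (lp_copy j N) \<subseteq> carrier (lp_copy j N)" using s N(2) by auto
qed (simp add: lp_copy_def Let_def)

lemma nil2_group_lp_copy:
  assumes "nil2_group N p" "inj_on j (carrier N)"
  shows "nil2_group (lp_copy j N) p"
proof -
  interpret N: nil2_group N p by fact
  have P: "ppred N \<subseteq> carrier N" using N.P_closed by auto
  show ?thesis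
    by (rule nil2_group_lp_embedding[OF assms(1)])
      (use lp_copy_iso[OF N.is_group P assms(2)] lp_iso_inv_into[OF N.is_group] lp_iso_imp_embedding in blast)+
qed

section \<open>The Fraisse class compared with the axioms of \<open>nil2_group\<close>\<close>

lemma KP_imp_nil2_group:
  assumes "prime p" "p \<noteq> 2" "H \<in> KP p"
  shows "nil2_group H p"
proof -
  have H: "group H" "ppred H \<lhd> H" "ppred H \<subseteq> center H" "comm_subgroup H (carrier H) (carrier H) \<subseteq> ppred H"
    "\<And>x. x \<in> carrier H \<Longrightarrow> x [^]\<^bsub>H\<^esub> p = \<one>\<^bsub>H\<^esub>"
    using assms(3) by (auto simp: KP_def)
  show ?thesis
  proof (intro nil2_group.intro nil2_group_axioms.intro assms(1,2) H)
    show "subgroup (ppred H) H" using H(2) by (rule normal_imp_subgroup)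
    show "x \<otimes>\<^bsub>H\<^esub> y \<otimes>\<^bsub>H\<^esub> inv\<^bsub>H\<^esub> x \<otimes>\<^bsub>H\<^esub> inv\<^bsub>H\<^esub> y \<in> ppred H" if "x \<in> carrier H" "y \<in> carrier H" for x y
      using H(4) that unfolding comm_subgroup_def by (blast intro: generate.incl)
    show "z \<otimes>\<^bsub>H\<^esub> x = x \<otimes>\<^bsub>H\<^esub> z" if "z \<in> ppred H" "x \<in> carrier H" for z x
      using H(3) that by (auto simp: center_def)
  qed
qed

text \<open>For the nilpotency class: the derived subgroup lies in the central subgroup
  \<open>ppred H\<close>, so all its commutators with elements of \<open>H\<close> are
  trivial.\<close>

lemma finite_nil2_group_in_KP:
  fixes H :: "nat lp_struct"
  assumes "nil2_group H p" "finite (carrier H)"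
  shows "H \<in> KP p"
proof -
  interpret H: nil2_group H p by fact
  let ?K = "comm_subgroup H (carrier H) (carrier H)"
  have K: "?K \<subseteq> ppred H" unfolding comm_subgroup_def
    by (rule H.generate_subgroup_incl[OF _ H.P_subgroup]) (auto intro: H.commutator_in_P)
  have "{h \<otimes>\<^bsub>H\<^esub> k \<otimes>\<^bsub>H\<^esub> inv\<^bsub>H\<^esub> h \<otimes>\<^bsub>H\<^esub> inv\<^bsub>H\<^esub> k | h k. h \<in> ?K \<and> k \<in> carrier H} \<subseteq> {\<one>\<^bsub>H\<^esub>}"
  proof clarify
    fix h k assume "h \<in> ?K" "k \<in> carrier H"
    then have "H.cmt h k = \<one>\<^bsub>H\<^esub>" using K by (intro H.cmt_P) auto
    then show "h \<otimes>\<^bsub>H\<^esub> k \<otimes>\<^bsub>H\<^esub> inv\<^bsub>H\<^esub> h \<otimes>\<^bsub>H\<^esub> inv\<^bsub>H\<^esub> k = \<one>\<^bsub>H\<^esub>" by (simp add: H.cmt_def)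
  qed
  then have "comm_subgroup H ?K (carrier H) \<subseteq> {\<one>\<^bsub>H\<^esub>}"
    unfolding comm_subgroup_def[of H ?K] by (rule H.generate_subgroup_incl[OF _ H.triv_subgroup])
  moreover have "\<one>\<^bsub>H\<^esub> \<in> comm_subgroup H ?K (carrier H)"
    unfolding comm_subgroup_def[of H ?K] by (rule generate.one)
  ultimately have "nilpotent_class_le H 2" by (auto simp: nilpotent_class_le_def numeral_2_eq_2)
  moreover have "ppred H \<lhd> H" by (rule H.P_normal)
  ultimately show ?thesis
    using assms(2) H.is_group H.exponent K H.P_central H.P_closed by (auto simp: KP_def center_def)
qed

text \<open>The extension property in a form that passes to models of the theory: it concerns one
  finite \<open>H\<close> at a time. Here \<open>H\<close> lives on the natural numbers, since a
  locale assumption does not range over types; \<open>one_point_extension\<close> removes this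
  restriction.\<close>

locale extension_closed = nil2_group M p for M :: "'m lp_struct" (structure) and p +
  assumes extension: "H \<in> KP p \<Longrightarrow> partial_iso H M S \<Longrightarrow> \<exists>w. lp_embedding H M w \<and> (\<forall>(x, y)\<in>S. w x = y)"
begin

text \<open>By local finiteness \<open>a\<close> and the domain of \<open>S\<close> generate a
  finite substructure. Its copy on the natural numbers is in \<open>KP p\<close>, and the extension
  property embeds that copy compatibly with \<open>S\<close>.\<close>

lemma one_point_extension:
  fixes N :: "'n lp_struct"
  assumes N: "nil2_group N p" and S: "partial_iso N M S" "finite S" and a: "a \<in> carrier N"
  obtains S' y where "partial_iso N M S'" "finite S'" "S \<subseteq> S'" "(a, y) \<in> S'"
proof -
  interpret N: nil2_group N p by fact
  let ?X = "insert a (fst ` S)"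
  define F where "F = generate N ?X"
  have X: "?X \<subseteq> carrier N" "finite ?X" using a S partial_isoD(2)[OF S(1)] by auto
  have XF: "?X \<subseteq> F" unfolding F_def by (blast intro: generate.incl)
  have F: "subgroup F N" "finite F" unfolding F_def
    using X N.generate_is_subgroup N.finite_generate by auto
  have Fc: "F \<subseteq> carrier N" using F(1) by (rule subgroup.subset)
  let ?K = "lp_restrict N F"
  have K: "nil2_group ?K p"
    by (rule nil2_group_lp_embedding[OF N]) (use group_lp_restrict[OF N.is_group F(1)]
      lp_embedding_lp_restrict[OF Fc lp_embedding_id] in auto)
  interpret K: nil2_group ?K p by (rule K)
  obtain j :: "'n \<Rightarrow> nat" where j: "inj_on j (carrier ?K)" using F(2) finite_imp_inj_to_nat_seg by fastforce
  let ?H = "lp_copy j ?K"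
  have H: "nil2_group ?H p" using K j by (rule nil2_group_lp_copy)
  note iso = lp_copy_iso[OF K.is_group _ j]
  have HK: "?H \<in> KP p" using H iso(4) F(2) by (intro finite_nil2_group_in_KP) auto
  interpret H: nil2_group ?H p by (rule H)
  have jemb: "lp_embedding ?K ?H j" using iso(2) by (intro lp_iso_imp_embedding) auto
  have SK: "partial_iso ?K M S"
    using partial_iso_lp_restrict[OF N.is_group is_group F(1)] S(1) XF by auto
  let ?J = "{(x, j x) | x. x \<in> carrier ?K}"
  have J: "partial_iso ?K ?H ?J" using K.is_group H.is_group jemb by (rule partial_iso_graph)
  have "partial_iso ?H M (?J\<inverse> O S)"
    by (rule partial_iso_relcomp[OF H.is_group K.is_group is_group partial_iso_converse[OF K.is_group H.is_group J] SK])
  from extension[OF HK this] obtain w where w: "lp_embedding ?H M w" "\<forall>(x, y)\<in>?J\<inverse> O S. w x = y" by blast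
  have wj: "lp_embedding ?K M (\<lambda>x. w (j x))" using jemb w(1) by (rule lp_embedding_comp)
  let ?S = "{(x, w (j x)) | x. x \<in> carrier ?K}"
  have S': "partial_iso ?K M ?S" using K.is_group is_group wj by (rule partial_iso_graph)
  show ?thesis
  proof
    show "partial_iso N M ?S"
    proof -
      have "fst ` ?S \<subseteq> F" by auto
      from partial_iso_lp_restrict[OF N.is_group is_group F(1) this] S' show ?thesis by (rule iffD1)
    qed
    show "finite ?S" using F(2) by (auto simp: setcompr_eq_image)
    show "(a, w (j a)) \<in> ?S" using XF by auto
    show "S \<subseteq> ?S"
    proof clarify
      fix x y assume xy: "(x, y) \<in> S"
      then have "x \<in> F" using XF by force
      then have "(j x, y) \<in> ?J\<inverse> O S" using xy by auto
      then show "\<exists>x'. (x, y) = (x', w (j x')) \<and> x' \<in> carrier ?K" using w(2) \<open>x \<in> F\<close> by auto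
    qed
  qed
qed

text \<open>Back and forth along the quantifiers. This is the quantifier elimination behind the
  equalities of types for the new tuple.\<close>

theorem partial_iso_elementary:
  assumes "partial_iso M M S" "\<And>n. n \<in> free_vars \<phi> \<Longrightarrow> \<sigma> n \<in> S"
  shows "sat M (\<lambda>n. fst (\<sigma> n)) \<phi> \<longleftrightarrow> sat M (\<lambda>n. snd (\<sigma> n)) \<phi>"
  using assms
proof (induction \<phi> arbitrary: S \<sigma>)
  case (Eq s t) then show ?case by (intro partial_iso_sat_Eq[OF is_group is_group Eq(1)]) auto
next
  case (Pred t) then show ?case by (intro partial_iso_sat_Pred[OF is_group is_group Pred(1)]) auto
next
  case (Neg \<phi>) then show ?case using Neg.IH[OF Neg.prems(1), of \<sigma>] by simp
next
  case (Conj \<phi> \<psi>) then show ?case using Conj.IH(1)[OF Conj.prems(1), of \<sigma>] Conj.IH(2)[OF Conj.prems(1), of \<sigma>] by simp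
next
  case (All n \<phi>)
  \<comment> \<open>\<open>S\<close> may be infinite, but a formula has finitely many free
    variables: the relation generated by their values is finite, as
    \<open>one_point_extension\<close> requires.\<close>
  define S0 where "S0 = generate (M \<times>\<times> M) (\<sigma> ` (free_vars \<phi> - {n}))"
  have sub: "\<sigma> ` (free_vars \<phi> - {n}) \<subseteq> S" using All.prems(2) by (simp add: image_subset_iff)
  interpret MM: group "M \<times>\<times> M" by (intro DirProd_group is_group)
  note S = partial_isoD[OF All.prems(1)]
  have S0: "partial_iso M M S0" unfolding S0_def
    by (rule partial_iso_subgroup[OF All.prems(1)])
      (use S(1,2) sub MM.generate_is_subgroup MM.generate_subgroup_incl in auto)
  have fin: "finite S0" unfolding S0_def
    by (rule finite_generate_DirProd[OF nil2_group_axioms nil2_group_axioms])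
      (use finite_free_vars sub S(2) in auto)
  have step: "sat M (\<lambda>k. snd ((\<sigma>(n := (a, y))) k)) \<phi> \<longleftrightarrow> sat M (\<lambda>k. fst ((\<sigma>(n := (a, y))) k)) \<phi>"
    if "partial_iso M M S'" "S0 \<subseteq> S'" "(a, y) \<in> S'" for S' a y
    by (rule All.IH[symmetric, OF that(1)]) (use that in \<open>auto simp: S0_def intro: generate.incl\<close>)
  have upd: "(\<lambda>k. fst ((\<sigma>(n := (a, y))) k)) = (\<lambda>k. fst (\<sigma> k))(n := a)"
     "(\<lambda>k. snd ((\<sigma>(n := (a, y))) k)) = (\<lambda>k. snd (\<sigma> k))(n := y)" for a y by auto
  have 1: "\<exists>y\<in>carrier M. sat M ((\<lambda>k. snd (\<sigma> k))(n := y)) \<phi> \<longleftrightarrow> sat M ((\<lambda>k. fst (\<sigma> k))(n := a)) \<phi>"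
    if a: "a \<in> carrier M" for a
  proof -
    obtain S' y where S': "partial_iso M M S'" "S0 \<subseteq> S'" "(a, y) \<in> S'"
      using one_point_extension[OF nil2_group_axioms S0 fin a] by metis
    then show ?thesis using step[OF S'] partial_isoD(6)[OF S'(1,3)] unfolding upd by blast
  qed
  \<comment> \<open>The back direction is the forth direction for the converse relation.\<close>
  have 2: "\<exists>a\<in>carrier M. sat M ((\<lambda>k. snd (\<sigma> k))(n := y)) \<phi> \<longleftrightarrow> sat M ((\<lambda>k. fst (\<sigma> k))(n := a)) \<phi>"
    if y: "y \<in> carrier M" for y
  proof -
    have "partial_iso M M (S0\<inverse>)" "finite (S0\<inverse>)"
      using partial_iso_converse[OF is_group is_group S0] fin by auto
    then obtain S' a where S': "partial_iso M M S'" "S0\<inverse> \<subseteq> S'" "(y, a) \<in> S'"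
      using one_point_extension[OF nil2_group_axioms _ _ y] by metis
    have S'': "partial_iso M M (S'\<inverse>)" "S0 \<subseteq> S'\<inverse>" "(a, y) \<in> S'\<inverse>"
      using partial_iso_converse[OF is_group is_group S'(1)] S' by auto
    then show ?thesis using step[OF S''] partial_isoD(6)[OF S'(1,3)] unfolding upd by blast
  qed
  show ?case using 1 2 by (simp; blast)
qed

lemma tp_eqI:
  assumes S: "partial_iso M M S" and "\<And>i. i \<in> I \<Longrightarrow> (c i, c' i) \<in> S" "\<And>e. e \<in> E \<Longrightarrow> (e, e) \<in> S"
  shows "tp M I c E = tp M I c' E"
proof -
  have "satisfies M c (\<phi>, \<tau>) \<longleftrightarrow> satisfies M c' (\<phi>, \<tau>)" if "(\<phi>, \<tau>) \<in> form_over I E" for \<phi> \<tau>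
  proof -
    let ?\<sigma> = "\<lambda>n. (case_sum c id (\<tau> n), case_sum c' id (\<tau> n))"
    have "?\<sigma> n \<in> S" if "n \<in> free_vars \<phi>" for n
    proof -
      have "\<tau> n \<in> I <+> E" using that \<open>(\<phi>, \<tau>) \<in> form_over I E\<close> by (auto simp: form_over_def)
      then show ?thesis using assms by auto
    qed
    from partial_iso_elementary[OF S this] show ?thesis by (simp add: satisfies_def)
  qed
  then show ?thesis by (auto simp: tp_def)
qed

end

section \<open>Transfer from the Fraisse limit\<close>

lemma sat_foldr_All:
  "sat M v (foldr All ns \<phi>) \<longleftrightarrow>
    (\<forall>w. (\<forall>n. n \<notin> set ns \<longrightarrow> w n = v n) \<longrightarrow> (\<forall>n\<in>set ns. w n \<in> carrier M) \<longrightarrow> sat M w \<phi>)"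
proof (induction ns arbitrary: v)
  case Nil
  have "w = v" if "\<forall>n. w n = v n" for w :: "nat \<Rightarrow> 'a" using that by auto
  then show ?case by auto
next
  case (Cons n ns)
  show ?case
  proof
    assume L: "sat M v (foldr All (n # ns) \<phi>)"
    show "\<forall>w. (\<forall>k. k \<notin> set (n # ns) \<longrightarrow> w k = v k) \<longrightarrow> (\<forall>k\<in>set (n # ns). w k \<in> carrier M) \<longrightarrow> sat M w \<phi>"
    proof (intro allI impI)
      fix w assume w: "\<forall>k. k \<notin> set (n # ns) \<longrightarrow> w k = v k" "\<forall>k\<in>set (n # ns). w k \<in> carrier M"
      then have "sat M (v(n := w n)) (foldr All ns \<phi>)" using L by simp
      then show "sat M w \<phi>" unfolding Cons.IH using w by (elim allE[of _ w]) auto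
    qed
  next
    assume R: "\<forall>w. (\<forall>k. k \<notin> set (n # ns) \<longrightarrow> w k = v k) \<longrightarrow> (\<forall>k\<in>set (n # ns). w k \<in> carrier M) \<longrightarrow> sat M w \<phi>"
    have "sat M (v(n := a)) (foldr All ns \<phi>)" if "a \<in> carrier M" for a
      unfolding Cons.IH
    proof (intro allI impI)
      fix w assume w: "\<forall>k. k \<notin> set ns \<longrightarrow> w k = (v(n := a)) k" "\<forall>k\<in>set ns. w k \<in> carrier M"
      have "w n \<in> carrier M" using w that by (cases "n \<in> set ns") auto
      then show "sat M w \<phi>" using R w by (elim allE[of _ w]) auto
    qed
    then show "sat M v (foldr All (n # ns) \<phi>)" by simp
  qed
qed

lemma free_vars_foldr_All: "free_vars (foldr All ns \<phi>) = free_vars \<phi> - set ns"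
  by (induction ns) auto

lemma sat_foldr_Conj: "sat M v (foldr Conj \<phi>s (Eq One One)) \<longleftrightarrow> (\<forall>\<phi>\<in>set \<phi>s. sat M v \<phi>)"
  by (induction \<phi>s) auto

text \<open>In the diagram of a finite structure on natural numbers, the element \<open>h\<close> is named by the
  variable \<open>Var h\<close>.\<close>

definition diagram :: "nat lp_struct \<Rightarrow> nat list \<Rightarrow> lp_form" where
  "diagram H hs = foldr Conj
     (map (\<lambda>(h, k). Eq (Mult (Var h) (Var k)) (Var (h \<otimes>\<^bsub>H\<^esub> k))) (List.product hs hs) @
      map (\<lambda>h. if h \<in> ppred H then Pred (Var h) else Neg (Pred (Var h))) hs @
      map (\<lambda>h. if h = \<one>\<^bsub>H\<^esub> then Eq (Var h) One else Neg (Eq (Var h) One)) hs)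
     (Eq One One)"

lemma sat_diagram:
  "sat M v (diagram H hs) \<longleftrightarrow> (\<forall>h\<in>set hs. \<forall>k\<in>set hs. v h \<otimes>\<^bsub>M\<^esub> v k = v (h \<otimes>\<^bsub>H\<^esub> k)) \<and>
     (\<forall>h\<in>set hs. v h \<in> ppred M \<longleftrightarrow> h \<in> ppred H) \<and> (\<forall>h\<in>set hs. v h = \<one>\<^bsub>M\<^esub> \<longleftrightarrow> h = \<one>\<^bsub>H\<^esub>)"
proof -
  have "sat M v (if h \<in> ppred H then Pred (Var h) else Neg (Pred (Var h))) \<longleftrightarrow> (v h \<in> ppred M \<longleftrightarrow> h \<in> ppred H)"
    "sat M v (if h = \<one>\<^bsub>H\<^esub> then Eq (Var h) One else Neg (Eq (Var h) One)) \<longleftrightarrow> (v h = \<one>\<^bsub>M\<^esub> \<longleftrightarrow> h = \<one>\<^bsub>H\<^esub>)" for h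
    by auto
  then show ?thesis unfolding diagram_def sat_foldr_Conj set_append ball_Un set_map ball_simps
    by (simp add: case_prod_beta)
qed

lemma diagram_partial_iso:
  assumes "group H" "group M" "subgroup (set hs) H" "partial_iso H M S" "\<And>h. h \<in> set hs \<Longrightarrow> (h, v h) \<in> S"
  shows "sat M v (diagram H hs)"
proof -
  have "v h \<otimes>\<^bsub>M\<^esub> v k = v (h \<otimes>\<^bsub>H\<^esub> k)" if "h \<in> set hs" "k \<in> set hs" for h k
    using partial_iso_mult[OF assms(4) assms(5)[OF that(1)] assms(5)[OF that(2)]]
      assms(5)[OF subgroup.m_closed[OF assms(3) that]] by (rule partial_iso_unique_right[OF assms(1,2,4)])
  then show ?thesis unfolding sat_diagram using assms(5) partial_isoD(3,4)[OF assms(4)] by blast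
qed

text \<open>Products are preserved and only the neutral element goes to the neutral element, which
  for groups already gives injectivity. Hence the diagram contains no inequations besides those with
  the neutral element.\<close>

lemma diagram_lp_embedding:
  assumes "group H" "group M" "set hs = carrier H" "\<And>h. h \<in> carrier H \<Longrightarrow> v h \<in> carrier M"
  shows "sat M v (diagram H hs) \<longleftrightarrow> lp_embedding H M v"
proof
  assume "lp_embedding H M v"
  note v = lp_embedding_mult[OF this] lp_embedding_one[OF assms(1,2) this] this[unfolded lp_embedding_def]
  have "\<one>\<^bsub>H\<^esub> \<in> carrier H" using assms(1) by (simp add: group.is_monoid)
  then have "v h = \<one>\<^bsub>M\<^esub> \<longleftrightarrow> h = \<one>\<^bsub>H\<^esub>" if "h \<in> carrier H" for h
    using v that by (metis inj_onD)
  then show "sat M v (diagram H hs)" unfolding sat_diagram assms(3) using v by auto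
next
  assume "sat M v (diagram H hs)"
  then have v: "\<And>h k. h \<in> carrier H \<Longrightarrow> k \<in> carrier H \<Longrightarrow> v (h \<otimes>\<^bsub>H\<^esub> k) = v h \<otimes>\<^bsub>M\<^esub> v k"
    "\<And>h. h \<in> carrier H \<Longrightarrow> v h \<in> ppred M \<longleftrightarrow> h \<in> ppred H" "\<And>h. h \<in> carrier H \<Longrightarrow> v h = \<one>\<^bsub>M\<^esub> \<longleftrightarrow> h = \<one>\<^bsub>H\<^esub>"
    unfolding sat_diagram assms(3) by auto
  have hom: "v \<in> hom H M" using v(1) assms(4) by (intro homI) auto
  interpret v: group_hom H M v using assms(1,2) hom by (simp add: group_hom_def group_hom_axioms_def)
  have "inj_on v (carrier H)" unfolding v.inj_on_one_iff using v(3) by auto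
  then show "lp_embedding H M v" using hom v(2) by (auto simp: lp_embedding_def)
qed

text \<open>With only \<open>Neg\<close>, \<open>Conj\<close> and \<open>All\<close> available, this
  encodes an implication with an existential conclusion: values for \<open>fs\<close> that satisfy
  its diagram can be completed to values for \<open>hs\<close> that satisfy the full diagram. The
  variables naming elements of \<open>fs\<close> stay free.\<close>

definition extension_formula :: "nat lp_struct \<Rightarrow> nat list \<Rightarrow> nat list \<Rightarrow> lp_form" where
  "extension_formula H fs hs = Neg (Conj (diagram H fs)
     (foldr All (filter (\<lambda>h. h \<notin> set fs) hs) (Neg (diagram H hs))))"

lemma sat_extension_formula:
  assumes "group H" "group M" "set hs = carrier H" "set fs \<subseteq> carrier H" "range v \<subseteq> carrier M"
  shows "sat M v (extension_formula H fs hs) \<longleftrightarrow>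
    (sat M v (diagram H fs) \<longrightarrow> (\<exists>w. lp_embedding H M w \<and> (\<forall>n\<in>set fs. w n = v n)))"
proof -
  have "\<not> sat M v (foldr All (filter (\<lambda>h. h \<notin> set fs) hs) (Neg (diagram H hs))) \<longleftrightarrow>
     (\<exists>w. lp_embedding H M w \<and> (\<forall>n\<in>set fs. w n = v n))" (is "?L \<longleftrightarrow> ?R")
  proof
    assume ?L
    then obtain w where w: "\<forall>n. n \<notin> carrier H - set fs \<longrightarrow> w n = v n"
      "\<forall>n\<in>carrier H - set fs. w n \<in> carrier M" "sat M w (diagram H hs)"
      unfolding sat_foldr_All using assms(3) by auto
    have "w h \<in> carrier M" if "h \<in> carrier H" for h
      using that assms(5) w(1,2) by (cases "h \<in> set fs") auto
    then have "lp_embedding H M w" using w(3) diagram_lp_embedding[OF assms(1-3)] by blast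
    then show ?R using w by (intro exI[of _ w]) auto
  next
    assume ?R
    then obtain w where w: "lp_embedding H M w" "\<forall>n\<in>set fs. w n = v n" by blast
    \<comment> \<open>An embedding is arbitrary off the carrier of \<open>H\<close>, whereas the
      quantifiers only change variables naming elements of \<open>H\<close>; elsewhere the valuation
      has to remain \<open>v\<close>.\<close>
    define w' where "w' n = (if n \<in> carrier H then w n else v n)" for n
    have "lp_embedding H M w'" using w(1) assms(1)
      by (auto simp: lp_embedding_def w'_def hom_def inj_on_def Pi_iff group.is_monoid monoid.m_closed)
    moreover have cl: "w' h \<in> carrier M" if "h \<in> carrier H" for h
      using that lp_embedding_closed[OF w(1)] by (simp add: w'_def)
    ultimately have "sat M w' (diagram H hs)" using diagram_lp_embedding[OF assms(1-3)] by blast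
    moreover have "\<forall>n. n \<notin> carrier H - set fs \<longrightarrow> w' n = v n" using w(2) by (auto simp: w'_def)
    ultimately show ?L unfolding sat_foldr_All using cl assms(3) by auto
  qed
  then show ?thesis by (auto simp: extension_formula_def)
qed

lemma models_foldr_All: "models M (foldr All ns \<phi>) \<longleftrightarrow> models M \<phi>"
proof
  assume L: "models M (foldr All ns \<phi>)"
  show "models M \<phi>" unfolding models_def
  proof (intro allI impI)
    fix v :: "nat \<Rightarrow> 'a" assume v: "range v \<subseteq> carrier M"
    then have "sat M v (foldr All ns \<phi>)" using L by (simp add: models_def)
    then show "sat M v \<phi>" unfolding sat_foldr_All using v by auto
  qed
next
  assume R: "models M \<phi>"
  show "models M (foldr All ns \<phi>)" unfolding models_def sat_foldr_All
  proof (intro allI impI)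
    fix v w :: "nat \<Rightarrow> 'a"
    assume "range v \<subseteq> carrier M" "\<forall>n. n \<notin> set ns \<longrightarrow> w n = v n" "\<forall>n\<in>set ns. w n \<in> carrier M"
    then have "w n \<in> carrier M" for n by (cases "n \<in> set ns") auto
    then show "sat M w \<phi>" using R by (auto simp: models_def)
  qed
qed

text \<open>\<open>Th\<close> consists of sentences only, so a formula with free variables is
  transferred through its universal closure.\<close>

lemma model_of_Th_models:
  assumes "model_of M (Th G)" "models G \<phi>"
  shows "models M \<phi>"
proof -
  let ?ns = "sorted_list_of_set (free_vars \<phi>)"
  have "free_vars (foldr All ?ns \<phi>) = {}"
    using finite_free_vars[of \<phi>] by (simp add: free_vars_foldr_All)
  then have "foldr All ?ns \<phi> \<in> Th G" using assms(2) by (simp add: Th_def models_foldr_All)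
  then have "models M (foldr All ?ns \<phi>)" using assms(1) by (auto simp: model_of_def)
  then show ?thesis by (simp add: models_foldr_All)
qed

section \<open>Axioms and extension property of the Fraisse limit itself\<close>

lemma subgroup_DirProd_Domain:
  assumes "group H" "group M" "subgroup S (H \<times>\<times> M)"
  shows "subgroup (fst ` S) H" "subgroup (snd ` S) M"
proof -
  have "fst \<in> hom (H \<times>\<times> M) H" "snd \<in> hom (H \<times>\<times> M) M" by (auto simp: hom_def)
  then have "group_hom (H \<times>\<times> M) H fst" "group_hom (H \<times>\<times> M) M snd"
    using assms(1,2) DirProd_group[OF assms(1,2)] by (auto simp: group_hom_def group_hom_axioms_def)
  then show "subgroup (fst ` S) H" "subgroup (snd ` S) M"
    using group_hom.subgroup_img_is_subgroup assms(3) by blast+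
qed

lemma fraisse_limit_finite_substructure:
  assumes "prime p" "p \<noteq> 2" and G: "fraisse_limit (KP p) G" and X: "finite X" "X \<subseteq> carrier G"
  shows "nil2_group (lp_generated G X) p"
proof -
  have "group G" "countable (carrier G)" "age G = KP p" using G by (auto simp: fraisse_limit_def lp_group_def)
  interpret G: group G by fact
  let ?K = "lp_generated G X"
  have sub: "subgroup (generate G X) G" using X(2) by (rule G.generate_is_subgroup)
  have K: "group ?K" unfolding lp_generated_eq using G.is_group sub by (rule group_lp_restrict)
  have "countable (carrier ?K)"
    using \<open>countable (carrier G)\<close> subgroup.subset[OF sub] by (auto simp: lp_generated_def intro: countable_subset)
  \<comment> \<open>Countability of \<open>G\<close> supplies the copy; finiteness of the generated
    substructure becomes known only through the age.\<close>
  then obtain j :: "_ \<Rightarrow> nat" where j: "inj_on j (carrier ?K)" by (auto simp: countable_def)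
  have PK: "ppred ?K \<subseteq> carrier ?K" by (simp add: lp_generated_def)
  note copy = lp_copy_iso[OF K PK j]
  let ?H = "lp_copy j ?K"
  have "inv_into (carrier ?K) j \<in> lp_iso ?H ?K" using K copy(2) by (rule lp_iso_inv_into)
  then have "?H \<in> age G" using copy(1,3) X by (auto simp: age_def lp_group_def)
  then have "nil2_group ?H p" using \<open>age G = KP p\<close> KP_imp_nil2_group assms(1,2) by blast
  then show ?thesis using K PK lp_iso_imp_embedding[OF copy(2)] by (rule nil2_group_lp_embedding)
qed

text \<open>Each axiom speaks about at most two elements, so it can be checked in the substructure
  that they generate.\<close>

lemma fraisse_limit_nil2_group:
  assumes "prime p" "p \<noteq> 2" and G: "fraisse_limit (KP p) G"
  shows "nil2_group G p"
proof -
  have "group G" "ppred G \<subseteq> carrier G" using G by (auto simp: fraisse_limit_def lp_group_def)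
  interpret G: group G by fact
  let ?K = "\<lambda>x y. lp_generated G {x, y}"
  have K: "nil2_group (?K x y) p" if "x \<in> carrier G" "y \<in> carrier G" for x y
    using fraisse_limit_finite_substructure[OF assms, of "{x, y}"] that by simp
  have sub: "subgroup (generate G {x, y}) G" if "x \<in> carrier G" "y \<in> carrier G" for x y
    using that by (intro G.generate_is_subgroup) auto
  have mem: "x \<in> carrier (?K x y)" "y \<in> carrier (?K x y)" for x y
    by (auto simp: lp_generated_def intro: generate.incl)
  have simps: "z \<otimes>\<^bsub>?K x y\<^esub> w = z \<otimes>\<^bsub>G\<^esub> w" "\<one>\<^bsub>?K x y\<^esub> = \<one>\<^bsub>G\<^esub>" "ppred (?K x y) = carrier (?K x y) \<inter> ppred G" for x y z w
    by (auto simp: lp_generated_def)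
  have pow: "z [^]\<^bsub>?K x y\<^esub> n = z [^]\<^bsub>G\<^esub> n" for x y z and n :: nat
    by (induction n) (auto simp: simps nat_pow_def)
  have inv: "inv\<^bsub>?K x y\<^esub> z = inv\<^bsub>G\<^esub> z" if "x \<in> carrier G" "y \<in> carrier G" "z \<in> carrier (?K x y)" for x y z
  proof -
    interpret K: nil2_group "?K x y" p using that(1,2) by (rule K)
    interpret sub: subgroup "generate G {x, y}" G using that(1,2) by (rule sub)
    have z: "z \<in> generate G {x, y}" using that by (simp add: lp_generated_def)
    then have "inv\<^bsub>G\<^esub> z \<in> carrier (?K x y)" by (simp add: lp_generated_def)
    then show ?thesis using z that(3) by (intro K.inv_equality) (simp_all add: simps)
  qed
  show ?thesis
  proof (intro nil2_group.intro nil2_group_axioms.intro G.is_group assms(1,2))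
    show "x [^]\<^bsub>G\<^esub> p = \<one>\<^bsub>G\<^esub>" if "x \<in> carrier G" for x
      using nil2_group.exponent[OF K[OF that that] mem(1)] by (simp only: pow simps)
    show "x \<otimes>\<^bsub>G\<^esub> y \<otimes>\<^bsub>G\<^esub> inv\<^bsub>G\<^esub> x \<otimes>\<^bsub>G\<^esub> inv\<^bsub>G\<^esub> y \<in> ppred G" if "x \<in> carrier G" "y \<in> carrier G" for x y
      using nil2_group.commutator_in_P[OF K[OF that] mem] inv[OF that] mem by (simp add: simps)
    show "z \<otimes>\<^bsub>G\<^esub> x = x \<otimes>\<^bsub>G\<^esub> z" if "z \<in> ppred G" "x \<in> carrier G" for z x
    proof -
      have "z \<in> carrier G" using that \<open>ppred G \<subseteq> carrier G\<close> by auto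
      then show ?thesis
        using nil2_group.P_central[OF K[OF _ that(2)], of z z x] mem[where x=z and y=x] that(1) by (simp add: simps)
    qed
    show "subgroup (ppred G) G"
    proof (rule G.subgroupI)
      fix x assume x: "x \<in> ppred G"
      then have xc: "x \<in> carrier G" using \<open>ppred G \<subseteq> carrier G\<close> by auto
      have "inv\<^bsub>?K x x\<^esub> x \<in> ppred (?K x x)"
        using mem x by (intro nil2_group.inv_P[OF K[OF xc xc]]) (simp only: simps IntI)
      then show "inv\<^bsub>G\<^esub> x \<in> ppred G" unfolding inv[OF xc xc mem(1)] simps by blast
      fix y assume y: "y \<in> ppred G"
      then have yc: "y \<in> carrier G" using \<open>ppred G \<subseteq> carrier G\<close> by auto
      show "x \<otimes>\<^bsub>G\<^esub> y \<in> ppred G"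
        using subgroup.m_closed[OF nil2_group.P_subgroup[OF K[OF xc yc]], of x y] mem[where x=x and y=y] x y
        by (simp add: simps)
    next
      have "\<one>\<^bsub>G\<^esub> \<in> ppred (?K \<one>\<^bsub>G\<^esub> \<one>\<^bsub>G\<^esub>)"
        using subgroup.one_closed[OF nil2_group.P_subgroup[OF K[OF G.one_closed G.one_closed]]] by (simp only: simps)
      then show "ppred G \<noteq> {}" unfolding simps by blast
    qed (use \<open>ppred G \<subseteq> carrier G\<close> in auto)
  qed
qed

text \<open>The age provides an embedding \<open>e\<close> of \<open>H\<close> that knows nothing of
  \<open>S\<close>; ultrahomogeneity provides an automorphism that corrects it on the domain of
  \<open>S\<close>.\<close>

lemma fraisse_limit_extension:
  assumes "prime p" "p \<noteq> 2" and G: "fraisse_limit (KP p) G" and H: "H \<in> KP p" and S: "partial_iso H G S"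
  shows "\<exists>w. lp_embedding H G w \<and> (\<forall>(x, y)\<in>S. w x = y)"
proof -
  interpret G: nil2_group G p using assms(1-3) by (rule fraisse_limit_nil2_group)
  interpret H: nil2_group H p using assms(1,2) H by (rule KP_imp_nil2_group)
  have ultra: "ultrahomogeneous G" and "H \<in> age G" using G H by (auto simp: fraisse_limit_def)
  then obtain X e where X: "finite X" "X \<subseteq> carrier G" and e: "e \<in> lp_iso H (lp_generated G X)"
    by (auto simp: age_def)
  have gX: "generate G X \<subseteq> carrier G" using X(2) G.generate_in_carrier by blast
  have eG: "lp_embedding H G e"
    using lp_iso_imp_embedding[OF e] gX by (auto simp: lp_embedding_def lp_generated_def hom_def)
  let ?E = "{(x, e x) | x. x \<in> carrier H}"
  have E: "partial_iso H G ?E" using H.is_group G.is_group eG by (rule partial_iso_graph)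
  \<comment> \<open>The extension problem moved into \<open>G\<close> along \<open>e\<close>: each
    pair \<open>(x, y)\<close> of \<open>S\<close> becomes \<open>(e x, y)\<close>.\<close>
  define R where "R = ?E\<inverse> O S"
  have T: "partial_iso G G R" unfolding R_def
    by (rule partial_iso_relcomp[OF G.is_group H.is_group G.is_group partial_iso_converse[OF H.is_group G.is_group E] S])
  note D = partial_isoD[OF T]
  have "finite (carrier H)" using H by (auto simp: KP_def)
  moreover have "R \<subseteq> (\<lambda>(x, y). (e x, y)) ` S" by (auto simp: R_def)
  moreover have "finite S"
  proof (rule inj_on_finite)
    show "inj_on fst S" using partial_iso_unique_right[OF H.is_group G.is_group S] by (auto simp: inj_on_def)
    show "fst ` S \<subseteq> carrier H" using partial_isoD(2)[OF S] by auto
  qed fact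
  ultimately have fin: "finite R" using finite_surj by blast
  let ?X = "fst ` R" and ?Y = "snd ` R"
  note XY = subgroup_DirProd_Domain[OF G.is_group G.is_group D(1)]
  \<comment> \<open>Domain and range are subgroups already, so ultrahomogeneity can be applied with
    the finite sets themselves as generators.\<close>
  have gen: "generate G ?X = ?X" "generate G ?Y = ?Y"
    using G.generate_subgroup_incl[OF subset_refl XY(1)] G.generate_subgroup_incl[OF subset_refl XY(2)]
    by (auto intro: generate.incl)
  define h where "h x = (THE y. (x, y) \<in> R)" for x
  have h: "h x = y" if "(x, y) \<in> R" for x y
    unfolding h_def using that partial_iso_unique_right[OF G.is_group G.is_group T] by blast
  have hT: "(x, h x) \<in> R" if "x \<in> ?X" for x using that h by force
  have "h \<in> lp_iso (lp_generated G ?X) (lp_generated G ?Y)"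
    unfolding lp_iso_def iso_def mem_Collect_eq
  proof (intro conjI ballI)
    show "h \<in> hom (lp_generated G ?X) (lp_generated G ?Y)"
    proof (rule homI; unfold lp_generated_def gen; simp)
      show "h x \<in> ?Y" if "x \<in> ?X" for x using hT[OF that] by force
      show "h (x \<otimes>\<^bsub>G\<^esub> y) = h x \<otimes>\<^bsub>G\<^esub> h y" if "x \<in> ?X" "y \<in> ?X" for x y
        using hT[OF that(1)] hT[OF that(2)] partial_iso_mult[OF T] h by blast
    qed
    have "inj_on h ?X"
      using hT partial_iso_unique_left[OF G.is_group G.is_group T] by (metis inj_onI)
    moreover have "h ` ?X = ?Y" using hT h by force
    ultimately show "bij_betw h (carrier (lp_generated G ?X)) (carrier (lp_generated G ?Y))"
      by (simp add: lp_generated_def gen bij_betw_def)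
    show "(x \<in> ppred (lp_generated G ?X)) = (h x \<in> ppred (lp_generated G ?Y))"
      if x: "x \<in> carrier (lp_generated G ?X)" for x
    proof -
      have "x \<in> ?X" using x by (simp only: lp_generated_eq gen lp_restrict_simps)
      then show ?thesis using D(4)[OF hT] hT[of x] by (force simp: lp_generated_eq gen)
    qed
  qed
  then obtain g where g: "g \<in> lp_iso G G" "\<And>x. x \<in> ?X \<Longrightarrow> g x = h x"
  proof -
    have "finite ?X" "finite ?Y" "?X \<subseteq> carrier G" "?Y \<subseteq> carrier G" using fin D(2) by auto
    from ultra[unfolded ultrahomogeneous_def, rule_format, OF this \<open>h \<in> _\<close>] that show ?thesis
      unfolding gen by blast
  qed
  have "lp_embedding H G (\<lambda>x. g (e x))" using eG lp_iso_imp_embedding[OF g(1)] by (rule lp_embedding_comp)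
  moreover have "g (e x) = y" if "(x, y) \<in> S" for x y
  proof -
    have xy: "(e x, y) \<in> R" using that partial_isoD(5)[OF S] by (auto simp: R_def)
    then have "e x \<in> ?X" by force
    then show ?thesis using g(2) h[OF xy] by simp
  qed
  ultimately show ?thesis by blast
qed

section \<open>Passing to models of the theory\<close>

primrec term_pow :: "lp_term \<Rightarrow> nat \<Rightarrow> lp_term" where
  "term_pow t 0 = One"
| "term_pow t (Suc n) = Mult (term_pow t n) t"

lemma term_val_term_pow: "term_val M v (term_pow t n) = term_val M v t [^]\<^bsub>M\<^esub> n"
  by (induction n) (auto simp: nat_pow_def)

text \<open>Every axiom is a formula in at most two variables, transferred separately and evaluated
  at a valuation with at most two values.\<close>

lemma model_of_Th_nil2_group:
  assumes G: "nil2_group G p" and M: "model_of M (Th G)"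
  shows "nil2_group M p"
proof -
  interpret G: nil2_group G p by fact
  have "group M" "ppred M \<subseteq> carrier M" using M by (auto simp: model_of_def lp_group_def)
  interpret M: group M by fact
  note transfer = model_of_Th_models[OF M, unfolded models_def]
  define val where "val x y = (\<lambda>n::nat. if n = 0 then x else y)" for x y :: 'b
  have val: "range (val x y) \<subseteq> carrier M" if "x \<in> carrier M" "y \<in> carrier M" for x y
    using that by (auto simp: val_def)
  have val_simps: "val x y 0 = x" "val x y (Suc 0) = y" for x y by (simp_all add: val_def)
  interpret PG: subgroup "ppred G" G by (rule G.P_subgroup)
  have P: "x \<in> carrier M" if "x \<in> ppred M" for x using that \<open>ppred M \<subseteq> carrier M\<close> by auto
  show ?thesis
  proof (intro nil2_group.intro nil2_group_axioms.intro M.is_group G.prime_p G.p_neq_2)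
    have *: "models G (Eq (term_pow (Var 0) p) One)"
      by (auto simp: models_def term_val_term_pow G.exponent range_subsetD)
    show "x [^]\<^bsub>M\<^esub> p = \<one>\<^bsub>M\<^esub>" if "x \<in> carrier M" for x
      using transfer[OF *[unfolded models_def], rule_format, OF val[OF that that]] by (simp add: term_val_term_pow val_simps)
    have *: "models G (Pred (Mult (Mult (Mult (Var 0) (Var 1)) (Inv (Var 0))) (Inv (Var 1))))"
      by (auto simp: models_def range_subsetD intro: G.commutator_in_P)
    show "x \<otimes>\<^bsub>M\<^esub> y \<otimes>\<^bsub>M\<^esub> inv\<^bsub>M\<^esub> x \<otimes>\<^bsub>M\<^esub> inv\<^bsub>M\<^esub> y \<in> ppred M" if "x \<in> carrier M" "y \<in> carrier M" for x y
      using transfer[OF *[unfolded models_def], rule_format, OF val[OF that]] by (simp add: val_simps)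
    have *: "models G (Neg (Conj (Pred (Var 0)) (Neg (Eq (Mult (Var 0) (Var 1)) (Mult (Var 1) (Var 0))))))"
      by (auto simp: models_def range_subsetD intro: G.P_central)
    show "z \<otimes>\<^bsub>M\<^esub> x = x \<otimes>\<^bsub>M\<^esub> z" if "z \<in> ppred M" "x \<in> carrier M" for z x
      using transfer[OF *[unfolded models_def], rule_format, OF val[OF P[OF that(1)] that(2)]] that(1) by (simp add: val_simps)
    show "subgroup (ppred M) M"
    proof (rule M.subgroupI)
      have *: "models G (Pred One)" by (auto simp: models_def)
      show "ppred M \<noteq> {}"
        using transfer[OF *[unfolded models_def], rule_format, OF val[OF M.one_closed M.one_closed]] by auto
      have *: "models G (Neg (Conj (Pred (Var 0)) (Neg (Pred (Inv (Var 0))))))"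
        by (auto simp: models_def)
      show "inv\<^bsub>M\<^esub> x \<in> ppred M" if "x \<in> ppred M" for x
        using transfer[OF *[unfolded models_def], rule_format, OF val[OF P[OF that] P[OF that]]] that by (simp add: val_simps)
      have *: "models G (Neg (Conj (Conj (Pred (Var 0)) (Pred (Var 1))) (Neg (Pred (Mult (Var 0) (Var 1))))))"
        by (auto simp: models_def)
      show "x \<otimes>\<^bsub>M\<^esub> y \<in> ppred M" if "x \<in> ppred M" "y \<in> ppred M" for x y
        using transfer[OF *[unfolded models_def], rule_format, OF val[OF P[OF that(1)] P[OF that(2)]]] that by (simp add: val_simps)
    qed fact
  qed
qed

text \<open>Since \<open>H\<close> is finite, the extension property for \<open>H\<close> and a
  fixed domain is one formula. It holds in \<open>G\<close> by ultrahomogeneity, hence in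
  \<open>M\<close>.\<close>

theorem fraisse_limit_model_extension_closed:
  assumes p: "prime p" "p \<noteq> 2" and G: "fraisse_limit (KP p) G" and M: "model_of M (Th G)"
  shows "extension_closed M p"
proof -
  interpret G: nil2_group G p using p G by (rule fraisse_limit_nil2_group)
  interpret M: nil2_group M p using G.nil2_group_axioms M by (rule model_of_Th_nil2_group)
  show ?thesis
  proof (intro extension_closed.intro extension_closed_axioms.intro M.nil2_group_axioms)
    fix H S assume H: "H \<in> KP p" and S: "partial_iso H M S"
    interpret H: nil2_group H p using p H by (rule KP_imp_nil2_group)
    have fin: "finite (carrier H)" using H by (auto simp: KP_def)
    note D = partial_isoD[OF S]
    have F: "subgroup (fst ` S) H" "fst ` S \<subseteq> carrier H"
      using subgroup_DirProd_Domain(1)[OF H.is_group M.is_group D(1)] D(2) by auto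
    let ?fs = "sorted_list_of_set (fst ` S)" and ?hs = "sorted_list_of_set (carrier H)"
    have finF: "finite (fst ` S)" using F(2) fin by (rule finite_subset)
    have fs: "set ?fs = fst ` S" "set ?hs = carrier H" using finF fin by simp_all
    have fsH: "set ?fs \<subseteq> carrier H" unfolding fs by (rule F(2))
    note sat_ext = sat_extension_formula[OF H.is_group _ fs(2) fsH]
    have "models G (extension_formula H ?fs ?hs)"
      unfolding models_def
    proof (intro allI impI)
      fix v :: "nat \<Rightarrow> 'a" assume v: "range v \<subseteq> carrier G"
      show "sat G v (extension_formula H ?fs ?hs)"
        unfolding sat_ext[OF G.is_group v]
      proof
        assume d: "sat G v (diagram H ?fs)"
        \<comment> \<open>A valuation satisfying the diagram of the domain is an embedding of that
          subgroup of \<open>H\<close>, hence the graph of a partial isomorphism from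
          \<open>H\<close> to \<open>G\<close>.\<close>
        let ?K = "lp_restrict H (fst ` S)"
        have K: "group ?K" using H.is_group F(1) by (rule group_lp_restrict)
        have "sat G v (diagram ?K ?fs)"
          using d fs(1) unfolding sat_diagram by auto
        then have "lp_embedding ?K G v"
          using diagram_lp_embedding[OF K G.is_group, of ?fs v] fs(1) v by auto
        from partial_iso_graph[OF K G.is_group this]
        have *: "partial_iso ?K G {(x, v x) | x. x \<in> fst ` S}" by simp
        have "fst ` {(x, v x) | x. x \<in> fst ` S} \<subseteq> fst ` S" by force
        from partial_iso_lp_restrict[OF H.is_group G.is_group F(1) this] *
        have "partial_iso H G {(x, v x) | x. x \<in> fst ` S}" by (rule iffD1)
        from fraisse_limit_extension[OF p G H this]
        obtain w where w: "lp_embedding H G w" "\<forall>(x, y)\<in>{(x, v x) | x. x \<in> fst ` S}. w x = y" by blast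
        have "w n = v n" if "n \<in> fst ` S" for n
          using bspec[OF w(2), of "(n, v n)"] that by simp
        with w(1) show "\<exists>w. lp_embedding H G w \<and> (\<forall>n\<in>set ?fs. w n = v n)" unfolding fs(1) by blast
      qed
    qed
    then have "models M (extension_formula H ?fs ?hs)" by (rule model_of_Th_models[OF M])
    \<comment> \<open>Off the domain of \<open>S\<close> the valuation takes the neutral element, so
      that its range stays in the carrier.\<close>
    define v where "v n = (if n \<in> fst ` S then THE y. (n, y) \<in> S else \<one>\<^bsub>M\<^esub>)" for n
    have v: "v x = y" if "(x, y) \<in> S" for x y
    proof -
      have "(THE y. (x, y) \<in> S) = y"
        using that partial_iso_unique_right[OF H.is_group M.is_group S] by blast
      then show ?thesis using that by (force simp: v_def)
    qed
    have vS: "(x, v x) \<in> S" if "x \<in> fst ` S" for x using that v by force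
    have "range v \<subseteq> carrier M"
    proof clarify
      fix n show "v n \<in> carrier M"
        using vS[of n] D(6)[of n "v n"] by (cases "n \<in> fst ` S") (auto simp: v_def)
    qed
    moreover have "sat M v (diagram H ?fs)"
      by (rule diagram_partial_iso[OF H.is_group M.is_group _ S]) (use F(1) vS fs(1) in simp_all)
    ultimately obtain w where w: "lp_embedding H M w" "\<forall>n\<in>fst ` S. w n = v n"
      using \<open>models M _\<close> sat_ext[OF M.is_group] unfolding models_def fs(1) by blast
    show "\<exists>w. lp_embedding H M w \<and> (\<forall>(x, y)\<in>S. w x = y)"
      using w v by (intro exI[of _ w]) force
  qed
qed

section \<open>Saturation and the centre\<close>

lemma (in group) generate_Union_chain:
  assumes "\<C> \<noteq> {}" "subset.chain \<A> \<C>" "x \<in> generate G (\<Union>\<C>)"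
  shows "\<exists>R\<in>\<C>. x \<in> generate G R"
  using assms(3)
proof (induction rule: generate.induct)
  case one then show ?case using assms(1) generate.one by blast
next
  case (incl h) then show ?case by (auto intro: generate.incl)
next
  case (inv h) then show ?case by (auto intro: generate.inv)
next
  case (eng h1 h2)
  then obtain R1 R2 where R: "R1 \<in> \<C>" "h1 \<in> generate G R1" "R2 \<in> \<C>" "h2 \<in> generate G R2" by blast
  then have "R1 \<subseteq> R2 \<or> R2 \<subseteq> R1" using assms(2) by (auto simp: subset_chain_def)
  then show ?case
  proof
    assume "R1 \<subseteq> R2"
    then have "h1 \<in> generate G R2" using R(2) mono_generate by blast
    then show ?thesis using R by (auto intro: generate.eng)
  next
    assume "R2 \<subseteq> R1"
    then have "h2 \<in> generate G R1" using R(4) mono_generate by blast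
    then show ?thesis using R by (auto intro: generate.eng)
  qed
qed

text \<open>The determinant of the first two coordinates, placed in the third. Its Baer group is the
  Heisenberg group of order \<open>p\<close> cubed for odd \<open>p\<close>, with the third
  coordinate as predicate and centre.\<close>

definition heisenberg_form :: "nat \<Rightarrow> int \<times> int \<times> int \<Rightarrow> int \<times> int \<times> int \<Rightarrow> int \<times> int \<times> int" where
  "heisenberg_form p = (\<lambda>(a, b, c) (a', b', c'). (0, 0, (a * b' - a' * b) mod int p))"

lemma heisenberg_alternating:
  assumes p: "prime p" "p \<noteq> 2"
  defines "Z \<equiv> integer_mod_group p"
  shows "alternating_form (Z \<times>\<times> Z \<times>\<times> Z) p ({0} \<times> {0} \<times> carrier Z) (heisenberg_form p)"
proof -
  have p0: "0 < p" using p(1) by (rule prime_gt_0_nat)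
  have Zc: "carrier Z = {0..<int p}" using p0 by (simp add: Z_def carrier_integer_mod_group)
  have Z: "group Z" "comm_group Z" "\<one>\<^bsub>Z\<^esub> = 0" by (simp_all add: Z_def abelian_integer_mod_group)
  interpret V: group "Z \<times>\<times> Z \<times>\<times> Z" by (intro DirProd_group Z(1))
  show ?thesis
  proof (intro alternating_form.intro alternating_form_axioms.intro elementary_abelian_pair.intro
      elementary_abelian_pair_axioms.intro p)
    show "comm_group (Z \<times>\<times> Z \<times>\<times> Z)"
      by (rule V.group_comm_groupI) (auto simp: Z_def add.commute)
    show "x [^]\<^bsub>Z \<times>\<times> Z \<times>\<times> Z\<^esub> p = \<one>\<^bsub>Z \<times>\<times> Z \<times>\<times> Z\<^esub>" if xV: "x \<in> carrier (Z \<times>\<times> Z \<times>\<times> Z)" for x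
    proof -
      obtain a b c where x: "x = (a, b, c)" "a \<in> carrier Z" "b \<in> carrier Z" "c \<in> carrier Z" using xV by auto
      have "x [^]\<^bsub>Z \<times>\<times> Z \<times>\<times> Z\<^esub> n = (a [^]\<^bsub>Z\<^esub> n, b [^]\<^bsub>Z\<^esub> n, c [^]\<^bsub>Z\<^esub> n)" for n :: nat
        by (induction n) (auto simp: x)
      then show ?thesis using x(2-) p0 by (simp add: Z_def)
    qed
    show "subgroup ({0} \<times> {0} \<times> carrier Z) (Z \<times>\<times> Z \<times>\<times> Z)"
      using Z(1) group.triv_subgroup[OF Z(1)] group.subgroup_self[OF Z(1)]
      by (intro DirProd_subgroups DirProd_group) (simp_all add: Z(3))
    have mod: "((x mod m) * c - d * (y mod m)) mod m = (x * c - d * y) mod m"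
      "(c * (y mod m) - (x mod m) * d) mod m = (c * y - x * d) mod m" for x y c d m :: int
      by (intro mod_diff_cong mod_mult_cong refl mod_mod_trivial)+
    show "heisenberg_form p (x \<otimes>\<^bsub>Z \<times>\<times> Z \<times>\<times> Z\<^esub> y) z = heisenberg_form p x z \<otimes>\<^bsub>Z \<times>\<times> Z \<times>\<times> Z\<^esub> heisenberg_form p y z"
      "heisenberg_form p z (x \<otimes>\<^bsub>Z \<times>\<times> Z \<times>\<times> Z\<^esub> y) = heisenberg_form p z x \<otimes>\<^bsub>Z \<times>\<times> Z \<times>\<times> Z\<^esub> heisenberg_form p z y"
      for x y z
      by (cases x; cases y; cases z; simp add: heisenberg_form_def Z_def mod mod_add_eq; simp add: algebra_simps)+
  qed (auto simp: heisenberg_form_def Zc Z(3) p0)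
qed

context extension_closed
begin

text \<open>The image of \<open>x\<close> has to realise the quantifier-free type of
  \<open>x\<close> over the domain of \<open>R\<close>, rewritten with the images under
  \<open>R\<close> as parameters. Finitely many of its formulas have finitely many parameters, so
  \<open>one_point_extension\<close> satisfies them, and saturation realises the whole type.\<close>

lemma saturated_one_point_extension:
  fixes N :: "'n lp_struct" and \<kappa> :: "'k rel"
  assumes N: "nil2_group N p" and sat: "saturated \<kappa> M"
    and R: "R \<subseteq> carrier N \<times> carrier M" "partial_iso N M (generate (N \<times>\<times> M) R)" "small \<kappa> (snd ` R)"
    and x: "x \<in> carrier N"
  obtains a where "a \<in> carrier M" "partial_iso N M (generate (N \<times>\<times> M) (insert (x, a) R))"
proof -
  interpret N: nil2_group N p by fact
  interpret NM: group "N \<times>\<times> M" by (intro DirProd_group is_group N.is_group)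
  let ?E = "snd ` R"
  \<comment> \<open>Parameters of formulas are elements of \<open>M\<close>; \<open>g\<close>
    recovers the elements of \<open>N\<close> that they stand for, which are unique because
    \<open>R\<close> generates a partial isomorphism.\<close>
  define g where "g e = (SOME y. (y, e) \<in> R)" for e
  have g: "(g e, e) \<in> R" if "e \<in> ?E" for e
    using that unfolding g_def by (auto intro: someI)
  have g_eq: "g e = y" if "(y, e) \<in> R" for y e
    using partial_iso_unique_left[OF N.is_group is_group R(2) generate.incl[OF that] generate.incl[OF g[of e]]] that by force
  define S where "S = {(\<phi>, \<tau>) \<in> form_over {()} ?E. quantifier_free \<phi> \<and> sat N (\<lambda>n. case_sum (\<lambda>_. x) g (\<tau> n)) \<phi>}"
  have ER: "?E \<subseteq> carrier M" using R(1) by auto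
  have "\<exists>a\<in>carrier M. \<forall>\<psi>\<in>F. satisfies M (\<lambda>_. a) \<psi>" if F: "F \<subseteq> S" "finite F" for F
  proof -
    define E0 where "E0 = (\<Union>(\<phi>, \<tau>)\<in>F. {e. Inr e \<in> \<tau> ` free_vars \<phi>})"
    have "finite {e. Inr e \<in> \<tau> ` free_vars \<phi>}" for \<phi> and \<tau> :: "nat \<Rightarrow> unit + 'm"
      using finite_vimageI[of "\<tau> ` free_vars \<phi>" Inr] finite_free_vars by (simp add: vimage_def)
    then have fin: "finite E0" using F(2) by (auto simp: E0_def)
    have E0: "E0 \<subseteq> ?E" using F(1) by (force simp: E0_def S_def form_over_def)
    let ?R = "(\<lambda>e. (g e, e)) ` E0"
    have R0: "?R \<subseteq> R" using g E0 by blast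
    have R0c: "?R \<subseteq> carrier N \<times> carrier M" using R0 R(1) by (rule order_trans)
    have p1: "partial_iso N M (generate (N \<times>\<times> M) ?R)"
      by (rule partial_iso_subgroup[OF R(2)]) (use NM.generate_is_subgroup R0c NM.mono_generate[OF R0] in auto)
    have p2: "finite (generate (N \<times>\<times> M) ?R)"
      using finite_generate_DirProd[OF N nil2_group_axioms] fin R0c by blast
    obtain S' a where S': "partial_iso N M S'" "generate (N \<times>\<times> M) ?R \<subseteq> S'" "(x, a) \<in> S'"
      by (rule one_point_extension[OF N p1 p2 x])
    have *: "satisfies M (\<lambda>_. a) (\<phi>, \<tau>)" if "(\<phi>, \<tau>) \<in> F" for \<phi> \<tau>
    proof -
      have \<phi>: "quantifier_free \<phi>" "sat N (\<lambda>n. case_sum (\<lambda>_. x) g (\<tau> n)) \<phi>" "\<tau> ` free_vars \<phi> \<subseteq> {()} <+> ?E"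
        using F(1) that by (auto simp: S_def form_over_def)
      let ?\<sigma> = "\<lambda>n. (case_sum (\<lambda>_. x) g (\<tau> n), case_sum (\<lambda>_. a) id (\<tau> n))"
      have "?\<sigma> n \<in> S'" if n: "n \<in> free_vars \<phi>" for n
      proof (cases "\<tau> n")
        case (Inl u) then show ?thesis using S'(3) by simp
      next
        case (Inr e)
        then have "Inr e \<in> \<tau> ` free_vars \<phi>" using n by (metis imageI)
        then have "e \<in> E0" using \<open>(\<phi>, \<tau>) \<in> F\<close> by (auto simp: E0_def)
        then have "(g e, e) \<in> generate (N \<times>\<times> M) ?R" by (auto intro: generate.incl)
        then show ?thesis using S'(2) Inr by auto
      qed
      from partial_iso_sat_quantifier_free[OF N.is_group is_group S'(1) \<phi>(1) this]
      show ?thesis using \<phi>(2) by (simp add: satisfies_def)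
    qed
    have "\<forall>\<psi>\<in>F. satisfies M (\<lambda>_. a) \<psi>"
    proof
      fix \<psi> assume "\<psi> \<in> F" then show "satisfies M (\<lambda>_. a) \<psi>" by (cases \<psi>) (simp add: *)
    qed
    then show ?thesis using partial_isoD(6)[OF S'(1,3)] by blast
  qed
  moreover have "S \<subseteq> form_over {()} ?E" by (auto simp: S_def)
  ultimately obtain a where a: "a \<in> carrier M" "\<And>\<psi>. \<psi> \<in> S \<Longrightarrow> satisfies M (\<lambda>_. a) \<psi>"
    using sat R(3) ER unfolding saturated_def by metis
  have "partial_iso N M (generate (N \<times>\<times> M) (insert (x, a) R))"
  proof (rule partial_iso_generateI[OF N.is_group is_group])
    show "insert (x, a) R \<subseteq> carrier N \<times> carrier M" using R(1) a(1) x by auto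
    fix t and \<sigma> :: "nat \<Rightarrow> 'n \<times> 'm" assume \<sigma>: "\<forall>n\<in>term_vars t. \<sigma> n \<in> insert (x, a) R"
    define \<tau> where "\<tau> n = (if \<sigma> n = (x, a) then Inl () else Inr (snd (\<sigma> n)))" for n
    have \<tau>: "\<tau> ` term_vars t \<subseteq> {()} <+> ?E" using \<sigma> by (auto simp: \<tau>_def)
    have val: "case_sum (\<lambda>_. x) g (\<tau> n) = fst (\<sigma> n)" "case_sum (\<lambda>_. a) id (\<tau> n) = snd (\<sigma> n)"
      if "n \<in> term_vars t" for n
      using \<sigma>[rule_format, OF that] g_eq[of "fst (\<sigma> n)" "snd (\<sigma> n)"] by (auto simp: \<tau>_def)
    have vals: "term_val N (\<lambda>n. case_sum (\<lambda>_. x) g (\<tau> n)) t = term_val N (\<lambda>n. fst (\<sigma> n)) t"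
      "term_val M (\<lambda>n. case_sum (\<lambda>_. a) id (\<tau> n)) t = term_val M (\<lambda>n. snd (\<sigma> n)) t"
      by (rule term_val_cong, use val in auto)+
    \<comment> \<open>The realised type contains each such formula or its negation, so truth in
      \<open>N\<close> is equivalent to satisfaction by \<open>a\<close>, not only sufficient for
      it.\<close>
    have eq: "sat N (\<lambda>n. case_sum (\<lambda>_. x) g (\<tau> n)) \<phi> \<longleftrightarrow> satisfies M (\<lambda>_. a) (\<phi>, \<tau>)"
      if "quantifier_free \<phi>" "free_vars \<phi> \<subseteq> term_vars t" for \<phi>
    proof -
      have *: "satisfies M (\<lambda>_. a) (\<psi>, \<tau>)"
        if "sat N (\<lambda>n. case_sum (\<lambda>_. x) g (\<tau> n)) \<psi>" "quantifier_free \<psi>" "free_vars \<psi> \<subseteq> term_vars t" for \<psi>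
        using that \<tau> by (intro a(2)) (auto simp: S_def form_over_def)
      show ?thesis using *[of \<phi>] *[of "Neg \<phi>"] that by (auto simp: satisfies_def)
    qed
    show "(term_val N (\<lambda>n. fst (\<sigma> n)) t = \<one>\<^bsub>N\<^esub> \<longleftrightarrow> term_val M (\<lambda>n. snd (\<sigma> n)) t = \<one>) \<and>
      (term_val N (\<lambda>n. fst (\<sigma> n)) t \<in> ppred N \<longleftrightarrow> term_val M (\<lambda>n. snd (\<sigma> n)) t \<in> ppred M)"
      using eq[of "Eq t One"] eq[of "Pred t"] by (simp add: satisfies_def vals)
  qed
  then show ?thesis using that a(1) by blast
qed

text \<open>Saturation supplies one point at a time, and Zorn's lemma iterates this through
  \<open>T\<close>. The candidates are generating sets with first coordinates in \<open>T\<close>: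
  the first projection is injective on them, so they stay small, as saturation requires.\<close>

lemma saturated_extension:
  fixes N :: "'n lp_struct" and \<kappa> :: "'k rel"
  assumes N: "nil2_group N p" and sat: "saturated \<kappa> M"
    and R0: "R0 \<subseteq> T \<times> carrier M" "partial_iso N M (generate (N \<times>\<times> M) R0)"
    and T: "T \<subseteq> carrier N" "small \<kappa> T"
  obtains S where "partial_iso N M S" "R0 \<subseteq> S" "T \<subseteq> fst ` S"
proof -
  interpret N: nil2_group N p by fact
  interpret NM: group "N \<times>\<times> M" by (intro DirProd_group is_group N.is_group)
  define \<A> where "\<A> = {R. R0 \<subseteq> R \<and> R \<subseteq> T \<times> carrier M \<and> partial_iso N M (generate (N \<times>\<times> M) R)}"
  have sub: "R \<subseteq> carrier (N \<times>\<times> M)" if "R \<subseteq> T \<times> carrier M" for R using that T(1) by auto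
  have "\<A> \<noteq> {}" using R0 by (auto simp: \<A>_def)
  moreover have "\<Union>\<C> \<in> \<A>" if \<C>: "\<C> \<noteq> {}" "subset.chain \<A> \<C>" for \<C>
  proof -
    have C: "\<C> \<subseteq> \<A>" using \<C>(2) by (auto simp: subset_chain_def)
    have le: "\<Union>\<C> \<subseteq> T \<times> carrier M" "R0 \<subseteq> \<Union>\<C>" using C \<C>(1) by (auto simp: \<A>_def)
    have "partial_iso N M (generate (N \<times>\<times> M) (\<Union>\<C>))"
      unfolding partial_iso_def
    proof (intro conjI ballI)
      show "subgroup (generate (N \<times>\<times> M) (\<Union>\<C>)) (N \<times>\<times> M)" using sub[OF le(1)] by (rule NM.generate_is_subgroup)
      fix u assume "u \<in> generate (N \<times>\<times> M) (\<Union>\<C>)"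
      then obtain R where "R \<in> \<C>" "u \<in> generate (N \<times>\<times> M) R" using NM.generate_Union_chain[OF \<C>] by blast
      then show "case u of (x, y) \<Rightarrow> (x = \<one>\<^bsub>N\<^esub> \<longleftrightarrow> y = \<one>) \<and> (x \<in> ppred N \<longleftrightarrow> y \<in> ppred M)"
        using C by (auto simp: \<A>_def partial_iso_def)
    qed
    then show ?thesis using le by (simp add: \<A>_def)
  qed
  ultimately obtain R where "R \<in> \<A>" and max: "\<And>X. X \<in> \<A> \<Longrightarrow> R \<subseteq> X \<Longrightarrow> X = R"
    using subset_Zorn_nonempty[of \<A>] by metis
  then have R: "R0 \<subseteq> R" "R \<subseteq> T \<times> carrier M" "partial_iso N M (generate (N \<times>\<times> M) R)"
    by (auto simp: \<A>_def)
  have "T \<subseteq> fst ` R"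
  proof
    fix x assume x: "x \<in> T"
    have Rc: "R \<subseteq> carrier N \<times> carrier M" using R(2) T(1) by auto
    have "inj_on fst R"
    proof (rule inj_onI)
      fix u v assume "u \<in> R" "v \<in> R" "fst u = fst v"
      then show "u = v"
        using partial_iso_unique_right[OF N.is_group is_group R(3), of "fst u" "snd u" "snd v"] generate.incl
        by (metis prod.collapse)
    qed
    then have "|R| \<le>o |T|" using R(2) by (intro card_of_ordLeqI[of fst R T]) auto
    then have "small \<kappa> (snd ` R)"
      using T(2) card_of_image[of snd R] unfolding small_def by (blast intro: ordLeq_ordLess_trans)
    from saturated_one_point_extension[OF N sat Rc R(3) this]
    obtain a where "a \<in> carrier M" "partial_iso N M (generate (N \<times>\<times> M) (insert (x, a) R))"
      using x T(1) by blast
    then have "insert (x, a) R \<in> \<A>" using R(1,2) x by (auto simp: \<A>_def)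
    then have "insert (x, a) R = R" by (rule max) auto
    then show "x \<in> fst ` R" by force
  qed
  then show ?thesis using that[OF R(3)] R(1) generate.incl[of _ R "N \<times>\<times> M"] by (meson image_mono order_trans subsetI)
qed

text \<open>Send the element (1, 0, 0) of the Heisenberg group to \<open>x\<close>: both generate
  cyclic groups of order \<open>p\<close> that meet the predicate trivially. The extension property
  gives an image for (0, 1, 0), which does not commute with (1, 0, 0).\<close>

lemma noncommuting_exists:
  assumes x: "x \<in> carrier M" "x \<notin> ppred M"
  obtains y where "y \<in> carrier M" "x \<otimes> y \<noteq> y \<otimes> x"
proof -
  define Z where "Z = integer_mod_group p"
  interpret H: alternating_form "Z \<times>\<times> Z \<times>\<times> Z" p "{0} \<times> {0} \<times> carrier Z" "heisenberg_form p"
    unfolding Z_def using prime_p p_neq_2 by (rule heisenberg_alternating)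
  have Zs: "x \<otimes>\<^bsub>Z\<^esub> y = (x + y) mod int p" "\<one>\<^bsub>Z\<^esub> = 0" for x y by (simp_all add: Z_def)
  have hf: "heisenberg_form p (a, b, c) (a', b', c') = (0, 0, (a * b' - a' * b) mod int p)" for a b c a' b' c'
    by (simp add: heisenberg_form_def)
  let ?H = H.baer_group
  interpret B: nil2_group ?H p by (rule H.nil2_baer_group)
  have p: "0 < p" "1 < p" using prime_p prime_gt_0_nat prime_gt_1_nat by auto
  have Zc: "a \<in> carrier Z \<longleftrightarrow> 0 \<le> a \<and> a < int p" for a
    using p by (auto simp: Z_def carrier_integer_mod_group)
  let ?S = "(\<lambda>k. ((int k, 0 :: int, 0 :: int), x [^] k)) ` {..<p}"
  have S_I: "((int k mod int p, 0, 0), x [^] k) \<in> ?S" for k :: nat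
  proof -
    have "x [^] k = (x [^] p) [^] (k div p) \<otimes> x [^] (k mod p)"
      using x by (simp add: nat_pow_pow nat_pow_mult)
    then have "x [^] k = x [^] (k mod p)" using exponent x by simp
    then show ?thesis using p by (auto simp: zmod_int intro!: image_eqI[of _ _ "k mod p"])
  qed
  have xP: "k = 0" if "x [^] k \<in> ppred M" "k < p" for k :: nat
    using pow_in_subgroup_prime_exponent[OF prime_p exponent[OF x(1)] x(1) P_subgroup that(1) x(2)] that(2)
    by (auto dest: dvd_imp_le)
  have P1: "\<one> \<in> ppred M" using P_subgroup by (rule subgroup.one_closed)
  have S: "partial_iso ?H M ?S"
  proof (rule partial_isoI[OF B.is_group is_group])
    show "?S \<subseteq> carrier ?H \<times> carrier M" using x p by (auto simp: Zc)
    show "(\<one>\<^bsub>?H\<^esub>, \<one>) \<in> ?S" using p by (auto simp: Zs intro!: image_eqI[of _ _ 0])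
    fix u v assume "(u, v) \<in> ?S"
    then obtain k where k: "u = (int k, 0, 0)" "v = x [^] k" "k < p" by auto
    have "k = 0" if "x [^] k = \<one>" using xP that k P1 by simp
    then show "(u = \<one>\<^bsub>?H\<^esub>) = (v = \<one>)" using k by (auto simp: Zs)
    show "(u \<in> ppred ?H) = (v \<in> ppred M)" using k xP P1 p by (auto simp: Zc)
    fix u' v' assume "(u', v') \<in> ?S"
    then obtain l where l: "u' = (int l, 0, 0)" "v' = x [^] l" by auto
    show "(u \<otimes>\<^bsub>?H\<^esub> u', v \<otimes> v') \<in> ?S"
      using S_I[of "k + l"] k l x by (simp add: Zs hf nat_pow_mult)
  next
    fix u v assume "(u, v) \<in> ?S"
    then obtain k where k: "u = (int k, 0, 0)" "v = x [^] k" "k < p" by auto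
    have "v \<otimes> x [^] (p - k) = \<one>" using k x exponent by (simp add: nat_pow_mult)
    then have "inv v = x [^] (p - k)" using k x by (metis inv_equality nat_pow_closed nat_pow_comm)
    moreover have "inv\<^bsub>?H\<^esub> u = (int (p - k) mod int p, 0, 0)"
      by (rule B.inv_equality) (use k p in \<open>auto simp: Zs Zc hf mod_simps\<close>)
    ultimately show "(inv\<^bsub>?H\<^esub> u, inv v) \<in> ?S" using S_I[of "p - k"] by simp
  qed
  have "finite ?S" by simp
  moreover have "(0, 1, 0) \<in> carrier ?H" using p by (simp add: Zc)
  ultimately obtain S' y where S': "partial_iso ?H M S'" "?S \<subseteq> S'" "((0, 1, 0), y) \<in> S'"
    by (rule one_point_extension[OF B.nil2_group_axioms S])
  have "((1, 0, 0), x) \<in> S'" using S_I[of 1] S'(2) p x(1) by auto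
  from partial_iso_mult[OF S'(1) this S'(3)] partial_iso_mult[OF S'(1) S'(3) this]
  have *: "((1, 1, 1), x \<otimes> y) \<in> S'" "((1, 1, - 1 mod int p), y \<otimes> x) \<in> S'"
    using p by (simp_all add: Zs hf)
  \<comment> \<open>The two products of the generators differ only in the third coordinate, 1
    against -1 modulo \<open>p\<close>; these are distinct because \<open>p\<close> exceeds
    2.\<close>
  have "- 1 mod int p \<noteq> 1"
  proof -
    have "2 < p" using p p_neq_2 by simp
    then show ?thesis by (simp add: zmod_minus1)
  qed
  then have "x \<otimes> y \<noteq> y \<otimes> x"
    using *(1) *(2) partial_iso_unique_left[OF B.is_group is_group S'(1)] by (metis Pair_inject)
  then show ?thesis using that partial_isoD(6)[OF S'(1,3)] by blast
qed

text \<open>Condition (2) is stated modulo the centre, which embeddings need not respect; this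
  replaces it by the predicate, which they do respect.\<close>

lemma center_eq_ppred: "center M = ppred M"
proof
  show "ppred M \<subseteq> center M" using P_central P_closed by (auto simp: center_def)
  show "center M \<subseteq> ppred M"
  proof (rule subsetI, rule ccontr)
    fix z assume z: "z \<in> center M" "z \<notin> ppred M"
    then have "z \<in> carrier M" by (simp add: center_def)
    then obtain y where "y \<in> carrier M" "z \<otimes> y \<noteq> y \<otimes> z" using z(2) by (rule noncommuting_exists)
    then show False using z(1) by (simp add: center_def)
  qed
qed

end

section \<open>The independence relation\<close>

lemma small_Un:
  assumes "Card_order \<kappa>" "natLeq <o \<kappa>" "small \<kappa> A" "small \<kappa> B"
  shows "small \<kappa> (A \<union> B)"
proof -
  have "infinite (Field \<kappa>)"
  proof -
    have "natLeq \<le>o |Field \<kappa>|"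
      using assms(1,2) card_of_Field_ordIso ordIso_symmetric ordLess_imp_ordLeq ordLeq_ordIso_trans by blast
    then show ?thesis using infinite_iff_natLeq_ordLeq by blast
  qed
  then show ?thesis using assms card_of_Un_ordLess_infinite_Field unfolding small_def by blast
qed

lemma small_image: "small \<kappa> A \<Longrightarrow> small \<kappa> (f ` A)"
  unfolding small_def using card_of_image by (rule ordLeq_ordLess_trans)

text \<open>Strong homogeneity speaks about maps of sets, equality of types about tuples. The tuple
  \<open>c0\<close> may repeat entries or meet \<open>D\<close>; the map is still well defined,
  since equations between entries and parameters belong to the type.\<close>

lemma partial_elementary_of_tp_eq:
  assumes "tp M I c0 D = tp M I c1 D" "c0 ` I \<subseteq> carrier M" "c1 ` I \<subseteq> carrier M" "D \<subseteq> carrier M"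
  obtains f where "partial_elementary M (c0 ` I \<union> D) f" "\<And>i. i \<in> I \<Longrightarrow> f (c0 i) = c1 i" "\<And>d. d \<in> D \<Longrightarrow> f d = d"
proof -
  have tp: "satisfies M c0 (\<phi>, \<sigma>) \<longleftrightarrow> satisfies M c1 (\<phi>, \<sigma>)" if "\<sigma> ` free_vars \<phi> \<subseteq> I <+> D" for \<phi> \<sigma>
    using assms(1) that unfolding tp_def form_over_def by blast
  \<comment> \<open>Elements of \<open>D\<close> are named as parameters even when they occur in
    \<open>c0\<close>, so that \<open>f\<close> fixes \<open>D\<close> by construction.\<close>
  define pick where "pick a = (if a \<in> D then Inr a else Inl (SOME i. i \<in> I \<and> c0 i = a))" for a
  have pick: "pick a \<in> I <+> D" "case_sum c0 id (pick a) = a" if "a \<in> c0 ` I \<union> D" for a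
  proof -
    have "(SOME i. i \<in> I \<and> c0 i = a) \<in> I \<and> c0 (SOME i. i \<in> I \<and> c0 i = a) = a" if "a \<in> c0 ` I"
      using someI_ex[of "\<lambda>i. i \<in> I \<and> c0 i = a"] that by blast
    then show "pick a \<in> I <+> D" "case_sum c0 id (pick a) = a" using that by (auto simp: pick_def)
  qed
  define f where "f a = case_sum c1 id (pick a)" for a
  have eq: "case_sum c1 id s = case_sum c1 id t"
    if st: "s \<in> I <+> D" "t \<in> I <+> D" "case_sum c0 id s = case_sum c0 id t" for s t
  proof -
    let ?\<sigma> = "\<lambda>n::nat. if n = 0 then s else t"
    have "?\<sigma> ` free_vars (Eq (Var 0) (Var 1)) \<subseteq> I <+> D" using st by auto
    from tp[OF this] show ?thesis using st(3) by (simp add: satisfies_def)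
  qed
  show ?thesis
  proof
    show f_c0: "f (c0 i) = c1 i" if "i \<in> I" for i
      using eq[of "pick (c0 i)" "Inl i"] pick[of "c0 i"] that by (auto simp: f_def)
    show f_D: "f d = d" if "d \<in> D" for d using that by (simp add: f_def pick_def)
    have "satisfies M f (\<phi>, \<sigma>) \<longleftrightarrow> satisfies M id (\<phi>, \<sigma>)" if \<sigma>: "(\<phi>, \<sigma>) \<in> form_over (c0 ` I \<union> D) {}" for \<phi> \<sigma>
    proof -
      have mem: "\<exists>a\<in>c0 ` I \<union> D. \<sigma> n = Inl a" if "n \<in> free_vars \<phi>" for n
        using \<sigma> that by (auto simp: form_over_def)
      let ?\<tau> = "\<lambda>n. pick (case_sum id id (\<sigma> n))"
      have \<tau>: "?\<tau> n \<in> I <+> D" "case_sum c0 id (?\<tau> n) = case_sum id id (\<sigma> n)" "case_sum c1 id (?\<tau> n) = case_sum f id (\<sigma> n)"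
        if "n \<in> free_vars \<phi>" for n
        using mem[OF that] pick by (auto simp: f_def)
      have "satisfies M c0 (\<phi>, ?\<tau>) \<longleftrightarrow> satisfies M c1 (\<phi>, ?\<tau>)" using \<tau>(1) by (intro tp) auto
      moreover have "satisfies M c0 (\<phi>, ?\<tau>) \<longleftrightarrow> satisfies M id (\<phi>, \<sigma>)"
        unfolding satisfies_def prod.case by (rule sat_cong) (rule \<tau>(2))
      moreover have "satisfies M c1 (\<phi>, ?\<tau>) \<longleftrightarrow> satisfies M f (\<phi>, \<sigma>)"
        unfolding satisfies_def prod.case by (rule sat_cong) (rule \<tau>(3))
      ultimately show ?thesis by simp
    qed
    then have "tp M (c0 ` I \<union> D) f {} = tp M (c0 ` I \<union> D) id {}" by (auto simp: tp_def)
    moreover have "f ` (c0 ` I \<union> D) \<subseteq> carrier M" using f_c0 f_D assms(3,4) by (auto simp: image_subset_iff)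
    ultimately show "partial_elementary M (c0 ` I \<union> D) f" using assms(2,4) by (simp add: partial_elementary_def)
  qed
qed

lemma (in group) generate_image_hom:
  assumes "h \<in> hom G G" "X \<subseteq> carrier G"
  shows "h ` generate G X = generate G (h ` X)"
  using group_hom.generate_img[of G G h X] assms by (simp add: group_hom_def group_hom_axioms_def)

context extension_closed
begin

lemma coset_generate_eq:
  assumes "X \<subseteq> carrier M"
  shows "coset_generate M X = (\<lambda>x. ppred M #> x) ` generate M X"
proof -
  interpret N: normal "ppred M" M by (rule P_normal)
  interpret F: group_hom M "M Mod ppred M" "\<lambda>x. ppred M #> x"
    using N.r_coset_hom_Mod N.factorgroup_is_group by (simp add: group_hom_def group_hom_axioms_def)
  show ?thesis unfolding coset_generate_def center_eq_ppred using F.generate_img[OF assms] by simp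
qed

lemma P_coset_eq_iff:
  assumes "x \<in> carrier M" "y \<in> carrier M"
  shows "ppred M #> x = ppred M #> y \<longleftrightarrow> x \<otimes> inv y \<in> ppred M"
proof -
  interpret P: subgroup "ppred M" M by (rule P_subgroup)
  show ?thesis
  proof
    assume "ppred M #> x = ppred M #> y"
    then have "x \<in> ppred M #> y" using rcos_self[OF assms(1) P_subgroup] by simp
    then obtain z where "z \<in> ppred M" "x = z \<otimes> y" by (auto simp: r_coset_def)
    then show "x \<otimes> inv y \<in> ppred M" using assms by (simp add: m_assoc)
  next
    assume "x \<otimes> inv y \<in> ppred M"
    then have "x \<in> ppred M #> y" using assms
      by (auto simp: r_coset_def m_assoc intro!: bexI[of _ "x \<otimes> inv y"])
    then show "ppred M #> x = ppred M #> y" using repr_independence[OF _ assms(2) P_subgroup] by simp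
  qed
qed

lemma inv_mult_in_P_iff:
  assumes "x \<in> carrier M" "y \<in> carrier M"
  shows "inv x \<otimes> y \<in> ppred M \<longleftrightarrow> ppred M #> x = ppred M #> y"
proof -
  have "inv x \<otimes> y \<in> ppred M \<longleftrightarrow> y \<otimes> inv x \<in> ppred M"
  proof
    assume z: "inv x \<otimes> y \<in> ppred M"
    have "y \<otimes> inv x = x \<otimes> (inv x \<otimes> y) \<otimes> inv x" using assms by simp
    also have "\<dots> = inv x \<otimes> y"
      using assms P_closed[OF z] unfolding P_central[OF z assms(1), symmetric] by (simp add: m_assoc)
    finally show "y \<otimes> inv x \<in> ppred M" using z by simp
  next
    assume z: "y \<otimes> inv x \<in> ppred M"
    have "inv x \<otimes> y = inv x \<otimes> ((y \<otimes> inv x) \<otimes> x)" using assms by (simp add: m_assoc)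
    also have "\<dots> = y \<otimes> inv x" using assms P_closed[OF z] unfolding P_central[OF z assms(1)] by simp
    finally show "inv x \<otimes> y \<in> ppred M" using z by simp
  qed
  also have "\<dots> \<longleftrightarrow> ppred M #> x = ppred M #> y" using P_coset_eq_iff[OF assms(2,1)] by auto
  finally show ?thesis .
qed

text \<open>Condition (1) is stated with the base adjoined, condition (2) without it. This allows
  the base to be adjoined in (2) as well.\<close>

lemma coset_generate_absorb:
  assumes "X \<subseteq> carrier M" "D \<subseteq> carrier M" "coset_generate M D \<subseteq> coset_generate M X"
  shows "coset_generate M (X \<union> D) = coset_generate M X"
proof -
  interpret N: normal "ppred M" M by (rule P_normal)
  interpret K: group "M Mod ppred M" by (rule N.factorgroup_is_group)
  let ?\<phi> = "\<lambda>x. ppred M #> x"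
  have X: "?\<phi> ` X \<subseteq> carrier (M Mod ppred M)" using assms(1) by (auto simp: FactGroup_def RCOSETS_def)
  have "?\<phi> ` D \<subseteq> generate (M Mod ppred M) (?\<phi> ` X)"
    using assms(3) generate.incl[of _ "?\<phi> ` D"] unfolding coset_generate_def center_eq_ppred by blast
  then have "?\<phi> ` (X \<union> D) \<subseteq> generate (M Mod ppred M) (?\<phi> ` X)"
    by (auto simp: image_Un intro: generate.incl)
  then have "generate (M Mod ppred M) (?\<phi> ` (X \<union> D)) \<subseteq> generate (M Mod ppred M) (?\<phi> ` X)"
    using K.generate_is_subgroup[OF X] by (rule K.generate_subgroup_incl)
  moreover have "generate (M Mod ppred M) (?\<phi> ` X) \<subseteq> generate (M Mod ppred M) (?\<phi> ` (X \<union> D))"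
    by (rule K.mono_generate) auto
  ultimately show ?thesis unfolding coset_generate_def center_eq_ppred by blast
qed

lemma coset_generate_mono: "X \<subseteq> Y \<Longrightarrow> Y \<subseteq> carrier M \<Longrightarrow> coset_generate M X \<subseteq> coset_generate M Y"
  using mono_generate[of X Y] by (auto simp: coset_generate_eq)

text \<open>Condition (2) in the elementwise form used by \<open>three_amalgamation\<close>: the
  common coset of \<open>a\<close> and \<open>x\<close> lies in both groups of cosets, hence
  contains an element generated by \<open>D\<close>.\<close>

lemma star_indep_mod_P:
  assumes "star_indep M X D Y" "X \<subseteq> carrier M" "Y \<subseteq> carrier M" "D \<subseteq> carrier M"
    and ax: "a \<in> generate M (X \<union> D)" "x \<in> generate M (Y \<union> D)" "a \<otimes> inv x \<in> ppred M"
  shows "\<exists>d\<in>generate M D. a \<otimes> inv d \<in> ppred M"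
proof -
  have XY: "coset_generate M X \<inter> coset_generate M Y = coset_generate M D"
    using assms(1) by (simp add: star_indep_def)
  have mem: "a \<in> carrier M" "x \<in> carrier M"
    using generate_in_carrier[OF _ ax(1)] generate_in_carrier[OF _ ax(2)] assms by auto
  have "ppred M #> a = ppred M #> x" using P_coset_eq_iff[OF mem] ax(3) by simp
  moreover have "ppred M #> a \<in> coset_generate M (X \<union> D)" "ppred M #> x \<in> coset_generate M (Y \<union> D)"
    using ax assms by (auto simp: coset_generate_eq)
  moreover have "coset_generate M (X \<union> D) = coset_generate M X" "coset_generate M (Y \<union> D) = coset_generate M Y"
    using coset_generate_absorb[OF assms(2,4)] coset_generate_absorb[OF assms(3,4)] XY by blast+
  ultimately have "ppred M #> a \<in> coset_generate M D" using XY by auto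
  then obtain d where d: "d \<in> generate M D" "ppred M #> a = ppred M #> d"
    using assms(4) by (auto simp: coset_generate_eq)
  then have "d \<in> carrier M" using generate_in_carrier assms(4) by blast
  then show ?thesis using d P_coset_eq_iff[OF mem(1)] by blast
qed

end

lemma partial_iso_generate_lift:
  assumes "group N" "group M" "partial_iso N M S" "\<And>y. y \<in> Y \<Longrightarrow> \<exists>x\<in>X. (x, y) \<in> S" "y \<in> generate M Y"
  shows "\<exists>x\<in>generate N X. (x, y) \<in> S"
  using assms(5)
proof (induction rule: generate.induct)
  case one then show ?case using partial_iso_one[OF assms(3)] generate.one by blast
next
  case (incl h)
  then obtain x where x: "x \<in> X" "(x, h) \<in> S" using assms(4) by blast
  then show ?case using generate.incl[OF x(1), of N] by blast
next
  case (inv h)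
  then obtain x where x: "x \<in> X" "(x, h) \<in> S" using assms(4) by blast
  show ?case using partial_iso_inv[OF assms(1-3) x(2)] generate.inv[OF x(1), of N] by blast
next
  case (eng h1 h2)
  then obtain x1 x2 where x: "x1 \<in> generate N X" "(x1, h1) \<in> S" "x2 \<in> generate N X" "(x2, h2) \<in> S" by blast
  show ?case using partial_iso_mult[OF assms(3) x(2,4)] generate.eng[OF x(1,3)] by blast
qed

lemma partial_iso_generate_fixed:
  assumes "group M" "partial_iso M M S" "\<And>x. x \<in> X \<Longrightarrow> (x, x) \<in> S" "y \<in> generate M X"
  shows "(y, y) \<in> S"
  using assms(4)
  by (induction rule: generate.induct)
    (use assms(3) partial_iso_one[OF assms(2)] partial_iso_inv[OF assms(1,1,2)] partial_iso_mult[OF assms(2)] in auto)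

theorem theorem3p6:
  fixes p :: nat
    and G :: "'g lp_struct"
    and M :: "'m lp_struct"
    and \<kappa> :: "'k rel"
    and A B D :: "'m set"
    and I :: "'i set"
    and c0 c1 :: "'i \<Rightarrow> 'm"
  assumes "prime p" and "p \<noteq> 2"
    and "fraisse_limit (KP p) G"
    and "monster_model \<kappa> (Th G) M"
    and "A \<subseteq> carrier M" and "small \<kappa> A"
    and "B \<subseteq> carrier M" and "small \<kappa> B"
    and "D \<subseteq> carrier M" and "small \<kappa> D"
    and "small \<kappa> I" and "c0 ` I \<subseteq> carrier M" and "c1 ` I \<subseteq> carrier M"
    and "star_indep M A D (c0 ` I)"
    and "star_indep M B D (c1 ` I)"
    and "star_indep M A D B"
    and "tp M I c0 D = tp M I c1 D"
  shows "\<exists>c. c ` I \<subseteq> carrier M \<and>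
    tp M I c (A \<union> D) = tp M I c0 (A \<union> D) \<and>
    tp M I c (B \<union> D) = tp M I c1 (B \<union> D) \<and>
    star_indep M (c ` I) D (A \<union> B)"
proof -
  have \<kappa>: "Card_order \<kappa>" "natLeq <o \<kappa>" and M: "model_of M (Th G)"
    and sat: "saturated \<kappa> M" and hom: "strongly_homogeneous \<kappa> M"
    using assms(4) by (auto simp: monster_model_def)
  interpret extension_closed M p
    using assms(1,2,3) M by (rule fraisse_limit_model_extension_closed)
  note carr = assms(5,7,9,12,13)
  obtain f0 where f0: "partial_elementary M (c0 ` I \<union> D) f0" "\<And>i. i \<in> I \<Longrightarrow> f0 (c0 i) = c1 i" "\<And>d. d \<in> D \<Longrightarrow> f0 d = d"
    using partial_elementary_of_tp_eq[OF assms(17,12,13,9)] by metis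
  have "small \<kappa> (c0 ` I \<union> D)" using \<kappa> assms(10,11) by (intro small_Un small_image)
  \<comment> \<open>The equality of types over \<open>D\<close> becomes an automorphism, along which
    the second and third copy can be glued.\<close>
  then obtain \<sigma> where \<sigma>: "\<sigma> \<in> lp_iso M M" "\<And>a. a \<in> c0 ` I \<union> D \<Longrightarrow> \<sigma> a = f0 a"
    using hom f0(1) unfolding strongly_homogeneous_def by metis
  have \<sigma>_c: "\<sigma> (c0 i) = c1 i" if "i \<in> I" for i using \<sigma>(2)[of "c0 i"] f0(2) that by auto
  have \<sigma>_D: "\<sigma> d = d" if "d \<in> D" for d using \<sigma>(2)[of d] f0(3) that by auto
  define A' B' C' D' where "A' = generate M (A \<union> D)" "B' = generate M (B \<union> D)" "C' = generate M (c0 ` I \<union> D)"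
    "D' = generate M D"
  note defs = this
  have sub: "subgroup A' M" "subgroup B' M" "subgroup C' M" "subgroup D' M"
    unfolding defs using carr by (auto intro!: generate_is_subgroup)
  have \<sigma>_hom: "\<sigma> \<in> hom M M" using \<sigma>(1) by (auto simp: lp_iso_def iso_def)
  have "\<sigma> ` (c0 ` I \<union> D) = c1 ` I \<union> D" using \<sigma>_c \<sigma>_D by (force simp: image_Un image_image)
  then have \<sigma>C: "\<sigma> ` C' = generate M (c1 ` I \<union> D)"
    unfolding defs using generate_image_hom[OF \<sigma>_hom, of "c0 ` I \<union> D"] carr by simp
  have "partial_iso M M {(x, \<sigma> x) | x. x \<in> carrier M}"
    using is_group is_group lp_iso_imp_embedding[OF \<sigma>(1)] by (rule partial_iso_graph)
  from partial_iso_generate_fixed[OF is_group this, of D] have \<sigma>_D': "\<sigma> d = d" if "d \<in> D'" for d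
    using that \<sigma>_D carr by (force simp: defs)
  have inter: "A' \<inter> B' = D'" "A' \<inter> C' = D'" "B' \<inter> \<sigma> ` C' = D'"
    using assms(14,15,16) unfolding \<sigma>C unfolding defs star_indep_def by simp_all
  have mods: "\<exists>d\<in>D'. a \<otimes>\<^bsub>M\<^esub> inv\<^bsub>M\<^esub> d \<in> ppred M" if "a \<in> A'" "x \<in> B'" "a \<otimes>\<^bsub>M\<^esub> inv\<^bsub>M\<^esub> x \<in> ppred M" for a x
    using star_indep_mod_P[OF assms(16,5,7,9)] that by (simp add: defs)
  have mods2: "\<exists>d\<in>D'. a \<otimes>\<^bsub>M\<^esub> inv\<^bsub>M\<^esub> d \<in> ppred M" if "a \<in> A'" "x \<in> C'" "a \<otimes>\<^bsub>M\<^esub> inv\<^bsub>M\<^esub> x \<in> ppred M" for a x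
    using star_indep_mod_P[OF assms(14,5,12,9)] that by (simp add: defs)
  have mods3: "\<exists>d\<in>D'. a \<otimes>\<^bsub>M\<^esub> inv\<^bsub>M\<^esub> d \<in> ppred M" if "a \<in> B'" "x \<in> \<sigma> ` C'" "a \<otimes>\<^bsub>M\<^esub> inv\<^bsub>M\<^esub> x \<in> ppred M" for a x
    using star_indep_mod_P[OF assms(15,7,13,9)] that unfolding \<sigma>C by (simp add: defs)
  obtain N :: "('m \<times> 'm \<times> 'm) lp_struct" and f g h where N: "nil2_group N p"
    and emb: "lp_embedding M N f" "lp_embedding M N g" "lp_embedding M N h"
    and agree: "\<And>a. a \<in> A' \<Longrightarrow> f a = g a" "\<And>x. x \<in> B' \<Longrightarrow> f x = h x" "\<And>c. c \<in> C' \<Longrightarrow> g c = h (\<sigma> c)"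
    and amal: "\<And>c x. c \<in> C' \<Longrightarrow> x \<in> carrier M \<Longrightarrow> g c = f x \<Longrightarrow> c \<in> D'"
    "\<And>c x z. c \<in> C' \<Longrightarrow> x \<in> carrier M \<Longrightarrow> z \<in> ppred N \<Longrightarrow> g c = f x \<otimes>\<^bsub>N\<^esub> z \<Longrightarrow> \<exists>d\<in>D'. inv\<^bsub>M\<^esub> x \<otimes>\<^bsub>M\<^esub> d \<in> ppred M"
    by (rule three_amalgamation[OF sub \<sigma>(1) \<sigma>_D' inter mods mods2 mods3]) (assumption | rule that)+
  interpret N: nil2_group N p by (rule N)
  note closed = emb[THEN lp_embedding_closed]
  let ?X = "A \<union> B \<union> D"
  have X: "?X \<subseteq> carrier M" "A \<subseteq> A'" "B \<subseteq> B'" "D \<subseteq> A'" "D \<subseteq> B'" "c0 ` I \<subseteq> C'" "D \<subseteq> C'" "D \<subseteq> D'"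
    using carr unfolding defs by (auto intro: generate.incl)
  \<comment> \<open>Saturation reaches only small sets, so just this part of \<open>N\<close> is
    mapped to \<open>M\<close>: \<open>f\<close> places \<open>A\<close>, \<open>B\<close> and
    \<open>D\<close>, and \<open>g\<close> places the entries of \<open>c0\<close>.\<close>
  define T where "T = f ` ?X \<union> g ` c0 ` I"
  have T: "T \<subseteq> carrier N" using closed X(1) carr(4) by (auto simp: T_def)
  have "small \<kappa> T" unfolding T_def using \<kappa> assms(6,8,10,11) by (intro small_Un small_image)
  \<comment> \<open>Starting from the inverse of \<open>f\<close> forces the map into
    \<open>M\<close> to undo \<open>f\<close> on \<open>A\<close>, \<open>B\<close> and
    \<open>D\<close>, so that the composite fixes them.\<close>
  define R0 where "R0 = (\<lambda>x. (f x, x)) ` ?X"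
  define Gr where "Gr e = {(x, e x) | x. x \<in> carrier M}" for e :: "'m \<Rightarrow> 'm \<times> 'm \<times> 'm"
  note Gr = emb[THEN partial_iso_graph[OF is_group N.is_group], folded Gr_def]
  interpret NM: group "N \<times>\<times> M" by (intro DirProd_group is_group N.is_group)
  have conv: "partial_iso N M ((Gr f)\<inverse>)" using is_group N.is_group Gr(1) by (rule partial_iso_converse)
  have R0c: "R0 \<subseteq> carrier (N \<times>\<times> M)" using X(1) closed by (auto simp: R0_def)
  have "partial_iso N M (generate (N \<times>\<times> M) R0)"
  proof (rule partial_iso_subgroup[OF conv])
    show "subgroup (generate (N \<times>\<times> M) R0) (N \<times>\<times> M)" using R0c by (rule NM.generate_is_subgroup)
    show "generate (N \<times>\<times> M) R0 \<subseteq> (Gr f)\<inverse>"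
      by (rule NM.generate_subgroup_incl[OF _ partial_isoD(1)[OF conv]]) (use X(1) in \<open>auto simp: R0_def Gr_def\<close>)
  qed
  moreover have "R0 \<subseteq> T \<times> carrier M" using X(1) by (auto simp: R0_def T_def)
  ultimately obtain S where S: "partial_iso N M S" "R0 \<subseteq> S" "T \<subseteq> fst ` S"
    using saturated_extension[OF N sat _ _ T \<open>small \<kappa> T\<close>] by metis
  \<comment> \<open>The tuple \<open>c0\<close> enters \<open>N\<close> by \<open>g\<close> and
    returns to \<open>M\<close> by \<open>S\<close>.\<close>
  define c where "c i = (SOME y. (g (c0 i), y) \<in> S)" for i
  have c: "(g (c0 i), c i) \<in> S" if "i \<in> I" for i
  proof -
    have "g (c0 i) \<in> fst ` S" using S(3) that by (auto simp: T_def)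
    then have "\<exists>y. (g (c0 i), y) \<in> S" by force
    then show ?thesis unfolding c_def by (rule someI_ex)
  qed
  have cM: "c ` I \<subseteq> carrier M" using partial_isoD(6)[OF S(1) c] by auto
  have fS: "(f x, x) \<in> S" if "x \<in> ?X" for x using S(2) that by (auto simp: R0_def)
  \<comment> \<open>Each embedding followed by \<open>S\<close> is a partial isomorphism of
    \<open>M\<close>. The one through \<open>f\<close> fixes \<open>A\<close>, \<open>B\<close>,
    \<open>D\<close>; the one through \<open>g\<close> fixes \<open>A\<close>, \<open>D\<close> and
    takes \<open>c0\<close> to \<open>c\<close>; the one through \<open>h\<close> fixes
    \<open>B\<close>, \<open>D\<close> and takes \<open>c1\<close> to \<open>c\<close>. The last two
    give the equalities of types.\<close>
  have comp: "partial_iso M M (Gr f O S)" "partial_iso M M (Gr g O S)" "partial_iso M M (Gr h O S)"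
    using Gr[THEN partial_iso_relcomp[OF is_group N.is_group is_group _ S(1)]] .
  have Gr_iff: "(x, y) \<in> Gr e O S \<longleftrightarrow> x \<in> carrier M \<and> (e x, y) \<in> S" for x y e by (auto simp: Gr_def)
  have fixX: "(x, x) \<in> Gr f O S" if "x \<in> ?X" for x using fS[OF that] that X(1) by (auto simp: Gr_iff)
  have fixA: "(x, x) \<in> Gr g O S" if "x \<in> A \<union> D" for x
  proof -
    have "x \<in> A'" "x \<in> ?X" using that X by auto
    then show ?thesis using fS[of x] agree(1)[of x] X(1) by (auto simp: Gr_iff)
  qed
  have fixB: "(x, x) \<in> Gr h O S" if "x \<in> B \<union> D" for x
  proof -
    have "x \<in> B'" "x \<in> ?X" using that X by auto
    then show ?thesis using fS[of x] agree(2)[of x] X(1) by (auto simp: Gr_iff)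
  qed
  have gc: "(c0 i, c i) \<in> Gr g O S" if "i \<in> I" for i using c[OF that] that carr by (auto simp: Gr_iff)
  have hc: "(c1 i, c i) \<in> Gr h O S" if "i \<in> I" for i
  proof -
    have "c0 i \<in> C'" using X that by auto
    then show ?thesis using c[OF that] agree(3)[of "c0 i"] \<sigma>_c[OF that] that carr by (auto simp: Gr_iff)
  qed
  have tp0: "tp M I c0 (A \<union> D) = tp M I c (A \<union> D)" using comp(2) gc fixA by (rule tp_eqI)
  have tp1: "tp M I c1 (B \<union> D) = tp M I c (B \<union> D)" using comp(3) hc fixB by (rule tp_eqI)
  have D_fix: "(d, d) \<in> Gr g O S" "(d, d) \<in> Gr f O S" if "d \<in> D'" for d
    using partial_iso_generate_fixed[OF is_group comp(2), of D d] partial_iso_generate_fixed[OF is_group comp(1), of D d]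
      fixA fixX that by (auto simp: defs)
  have cD: "c ` I \<union> D \<subseteq> carrier M" and AB: "A \<union> B \<subseteq> carrier M" using cM carr by auto
  have lift_c: "\<exists>u\<in>generate M (c0 ` I). (u, y) \<in> Gr g O S" if "y \<in> generate M (c ` I)" for y
    by (rule partial_iso_generate_lift[OF is_group is_group comp(2) _ that]) (use gc in blast)
  have lift_X: "\<exists>x\<in>generate M Y. (x, y) \<in> Gr f O S" if "Y \<subseteq> ?X" "y \<in> generate M Y" for y Y
    by (rule partial_iso_generate_lift[OF is_group is_group comp(1) _ that(2)]) (use fixX that(1) in blast)
  have "generate M (c ` I \<union> D) \<inter> generate M (A \<union> B \<union> D) = generate M D"
  proof
    show "generate M D \<subseteq> generate M (c ` I \<union> D) \<inter> generate M (A \<union> B \<union> D)"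
      by (intro Int_greatest mono_generate) auto
    show "generate M (c ` I \<union> D) \<inter> generate M (A \<union> B \<union> D) \<subseteq> generate M D"
    proof
      fix y assume y: "y \<in> generate M (c ` I \<union> D) \<inter> generate M (A \<union> B \<union> D)"
      \<comment> \<open>The element is traced back through \<open>g\<close> to \<open>u\<close> and
        through \<open>f\<close> to \<open>x\<close>. Both have the same image in \<open>N\<close>,
        so the amalgam puts \<open>u\<close> into the subgroup generated by \<open>D\<close>, and
        the map through \<open>g\<close> fixes that subgroup.\<close>
      have "\<exists>u\<in>C'. (u, y) \<in> Gr g O S" unfolding defs(3)
        by (rule partial_iso_generate_lift[OF is_group is_group comp(2) _ IntD1[OF y]]) (use gc fixA in blast)
      then obtain u where u: "u \<in> C'" "(g u, y) \<in> S" by (auto simp: Gr_iff)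
      obtain x where x: "x \<in> carrier M" "(f x, y) \<in> S" using lift_X[of ?X y] y by (auto simp: Gr_iff)
      have "g u = f x" using N.is_group is_group S(1) u(2) x(2) by (rule partial_iso_unique_left)
      then have "u \<in> D'" using amal(1) u(1) x(1) by blast
      then have "(g u, u) \<in> S" using D_fix(1) by (simp add: Gr_iff)
      then have "y = u" using partial_iso_unique_right[OF N.is_group is_group S(1) u(2)] by blast
      then show "y \<in> generate M D" using \<open>u \<in> D'\<close> by (simp add: defs)
    qed
  qed
  moreover have "coset_generate M (c ` I) \<inter> coset_generate M (A \<union> B) = coset_generate M D"
  proof
    show "coset_generate M D \<subseteq> coset_generate M (c ` I) \<inter> coset_generate M (A \<union> B)"
    proof (rule Int_greatest)
      have "coset_generate M D \<subseteq> coset_generate M A" using assms(16) by (auto simp: star_indep_def)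
      also have "\<dots> \<subseteq> coset_generate M (A \<union> B)" using AB by (intro coset_generate_mono) auto
      finally show "coset_generate M D \<subseteq> coset_generate M (A \<union> B)" .
      show "coset_generate M D \<subseteq> coset_generate M (c ` I)"
      proof
        fix k assume k: "k \<in> coset_generate M D"
        \<comment> \<open>By hypothesis a coset from \<open>D\<close> is also one from
          \<open>c0\<close>. The partial isomorphism through \<open>g\<close> fixes
          \<open>D\<close>, respects \<open>P\<close> and takes \<open>c0\<close> to
          \<open>c\<close>, so the same holds for \<open>c\<close>.\<close>
        then have "k \<in> coset_generate M (c0 ` I)" using assms(14) by (auto simp: star_indep_def)
        then obtain u where u: "u \<in> generate M (c0 ` I)" "k = ppred M #>\<^bsub>M\<^esub> u" using carr by (auto simp: coset_generate_eq)
        obtain d where d: "d \<in> D'" "k = ppred M #>\<^bsub>M\<^esub> d" using k carr by (auto simp: coset_generate_eq defs)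
        have "\<exists>y\<in>generate M (c ` I). (y, u) \<in> (Gr g O S)\<inverse>"
          by (rule partial_iso_generate_lift[OF is_group is_group partial_iso_converse[OF is_group is_group comp(2)] _ u(1)])
            (use gc in blast)
        then obtain y where y: "y \<in> generate M (c ` I)" "(u, y) \<in> Gr g O S" by auto
        note mem = partial_isoD(5,6)[OF comp(2) y(2)] partial_isoD(5)[OF comp(2) D_fix(1)[OF d(1)]]
        have "d \<otimes>\<^bsub>M\<^esub> inv\<^bsub>M\<^esub> u \<in> ppred M" using P_coset_eq_iff[of d u] mem u d by simp
        moreover have "(d \<otimes>\<^bsub>M\<^esub> inv\<^bsub>M\<^esub> u, d \<otimes>\<^bsub>M\<^esub> inv\<^bsub>M\<^esub> y) \<in> Gr g O S"
          by (rule partial_iso_mult[OF comp(2) D_fix(1)[OF d(1)] partial_iso_inv[OF is_group is_group comp(2) y(2)]])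
        ultimately have "d \<otimes>\<^bsub>M\<^esub> inv\<^bsub>M\<^esub> y \<in> ppred M" using partial_isoD(4)[OF comp(2)] by blast
        then have "k = ppred M #>\<^bsub>M\<^esub> y" using P_coset_eq_iff[of d y] mem d by simp
        then show "k \<in> coset_generate M (c ` I)" using y(1) cM by (auto simp: coset_generate_eq)
      qed
    qed
    show "coset_generate M (c ` I) \<inter> coset_generate M (A \<union> B) \<subseteq> coset_generate M D"
    proof
      fix k assume k: "k \<in> coset_generate M (c ` I) \<inter> coset_generate M (A \<union> B)"
      obtain y where y: "y \<in> generate M (c ` I)" "k = ppred M #>\<^bsub>M\<^esub> y" using k cM by (auto simp: coset_generate_eq)
      obtain y' where y': "y' \<in> generate M (A \<union> B)" "k = ppred M #>\<^bsub>M\<^esub> y'" using k AB by (auto simp: coset_generate_eq)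
      obtain u where u: "u \<in> generate M (c0 ` I)" "(u, y) \<in> Gr g O S" using lift_c[OF y(1)] by blast
      have "u \<in> C'" using u(1) mono_generate[of "c0 ` I" "c0 ` I \<union> D"] by (auto simp: defs)
      obtain x where x: "(x, y') \<in> Gr f O S" using lift_X[OF _ y'(1)] by blast
      note mem = partial_isoD(5,6)[OF comp(2) u(2)] partial_isoD(5,6)[OF comp(1) x]
      \<comment> \<open>\<open>y\<close> and \<open>y'\<close> agree modulo \<open>P\<close>, hence
        so do their sources \<open>g u\<close> and \<open>f x\<close> in \<open>N\<close>. The
        amalgam then yields \<open>d\<close> from the base that agrees with \<open>x\<close> modulo
        \<open>P\<close>, and the map through \<open>f\<close>, which fixes \<open>d\<close>, moves
        this to \<open>y'\<close>.\<close>
      have uS: "(g u, y) \<in> S" and xS: "(f x, y') \<in> S" using u(2) x by (auto simp: Gr_iff)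
      have "(inv\<^bsub>N\<^esub> (f x) \<otimes>\<^bsub>N\<^esub> g u, inv\<^bsub>M\<^esub> y' \<otimes>\<^bsub>M\<^esub> y) \<in> S"
        by (rule partial_iso_mult[OF S(1) partial_iso_inv[OF N.is_group is_group S(1) xS] uS])
      moreover have "inv\<^bsub>M\<^esub> y' \<otimes>\<^bsub>M\<^esub> y \<in> ppred M" using inv_mult_in_P_iff[of y' y] mem y(2) y'(2) by simp
      ultimately have "inv\<^bsub>N\<^esub> (f x) \<otimes>\<^bsub>N\<^esub> g u \<in> ppred N" using partial_isoD(4)[OF S(1)] by blast
      moreover have "g u = f x \<otimes>\<^bsub>N\<^esub> (inv\<^bsub>N\<^esub> (f x) \<otimes>\<^bsub>N\<^esub> g u)" using closed mem by simp
      ultimately obtain d where d: "d \<in> D'" "inv\<^bsub>M\<^esub> x \<otimes>\<^bsub>M\<^esub> d \<in> ppred M" using amal(2)[OF \<open>u \<in> C'\<close> mem(3)] by blast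
      have "(inv\<^bsub>M\<^esub> x \<otimes>\<^bsub>M\<^esub> d, inv\<^bsub>M\<^esub> y' \<otimes>\<^bsub>M\<^esub> d) \<in> Gr f O S"
        by (rule partial_iso_mult[OF comp(1) partial_iso_inv[OF is_group is_group comp(1) x] D_fix(2)[OF d(1)]])
      then have "inv\<^bsub>M\<^esub> y' \<otimes>\<^bsub>M\<^esub> d \<in> ppred M" using partial_isoD(4)[OF comp(1)] d(2) by blast
      then have "k = ppred M #>\<^bsub>M\<^esub> d"
        using inv_mult_in_P_iff[of y' d] mem y'(2) partial_isoD(5)[OF comp(2) D_fix(1)[OF d(1)]] by simp
      then show "k \<in> coset_generate M D" using d(1) carr by (auto simp: coset_generate_eq defs)
    qed
  qed
  ultimately have "star_indep M (c ` I) D (A \<union> B)" by (simp add: star_indep_def)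
  then show ?thesis using cM tp0 tp1 by (intro exI[of _ c]) simp
qed

end
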